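(* Let $X$ be a connected topological space which is locally path-connected and semi-locally simply-connected. The category of covering spaces of $X$ and the category of locally constant sheaves (of sets) on $X$ are equivalent. Moreover, trivial coverings correspond to constant sheaves.
   Context: A cover of $X$ is a continuous map $p:Y\to X$ such that every $x\in X$ has a neighbourhood $U$ with $p^{-1}(U)=\bigsqcup_{y\in p^{-1}(x)}V_y$, each $V_y$ open (with $y\in V_y$) and mapped homeomorphically onto $U$ by $p$; morphisms of covers are continuous maps over $X$. The trivial cover with fibre $I$ is the projection $X\times I\to X$, where $I$ is a non-empty discrete topological space. For a discrete set $S$, the constant sheaf with values in $S$ is $U\mapsto\{\text{continuous maps }U\to S\}$; a sheaf on $X$ is locally constant if it restricts to a constant sheaf on each member of some open covering of $X$. The functor from covers to locally constant sheaves used for the equivalence sends $p:Y\to X$ to its sheaf of sections $\mathcal{F}_Y$, where $\mathcal{F}_Y(U)$ is the set of continuous sections of $p$ over $U$ with restriction of sections, and sends a morphism of covers $\phi:Y\to Z$ to the morphism $s\mapsto\phi\circ s$. The functor in the other direction sends a locally constant sheaf $\mathcal{F}$ to its étale space $\bigsqcup_{x\in X}\mathcal{F}_x$, the disjoint union of the stalks, projected to $X$ and topologised so that the sets $\{s_x : x\in U\}$, for $U\subset X$ open and $s\in\mathcal{F}(U)$, are open. *)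

theory Defs
  imports "HOL-Analysis.Analysis"
begin

section \<open>Categories and equivalences of categories\<close>

text \<open>
  Hom-sets of different pairs of objects may overlap, so composition and the
  arrow part of a functor take the objects involved as arguments.
\<close>

record ('o, 'm) cat =
  Obj :: "'o set"
  Hom :: "'o \<Rightarrow> 'o \<Rightarrow> 'm set"
  Ident :: "'o \<Rightarrow> 'm"
  Comp :: "'o \<Rightarrow> 'o \<Rightarrow> 'o \<Rightarrow> 'm \<Rightarrow> 'm \<Rightarrow> 'm"

definition is_category :: "('o, 'm) cat \<Rightarrow> bool" where
  "is_category C \<longleftrightarrow>
     (\<forall>A\<in>Obj C. Ident C A \<in> Hom C A A) \<and>
     (\<forall>A\<in>Obj C. \<forall>B\<in>Obj C. \<forall>D\<in>Obj C. \<forall>f\<in>Hom C A B. \<forall>g\<in>Hom C B D.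
        Comp C A B D g f \<in> Hom C A D) \<and>
     (\<forall>A\<in>Obj C. \<forall>B\<in>Obj C. \<forall>f\<in>Hom C A B.
        Comp C A A B f (Ident C A) = f \<and> Comp C A B B (Ident C B) f = f) \<and>
     (\<forall>A\<in>Obj C. \<forall>B\<in>Obj C. \<forall>D\<in>Obj C. \<forall>E\<in>Obj C.
        \<forall>f\<in>Hom C A B. \<forall>g\<in>Hom C B D. \<forall>h\<in>Hom C D E.
        Comp C A D E h (Comp C A B D g f) = Comp C A B E (Comp C B D E h g) f)"

definition is_iso :: "('o, 'm) cat \<Rightarrow> 'o \<Rightarrow> 'o \<Rightarrow> 'm \<Rightarrow> bool" where
  "is_iso C A B f \<longleftrightarrow> f \<in> Hom C A B \<and>
     (\<exists>g\<in>Hom C B A. Comp C A B A g f = Ident C A \<and> Comp C B A B f g = Ident C B)"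

record ('o, 'm, 'p, 'n) func =
  on_obj :: "'o \<Rightarrow> 'p"
  on_hom :: "'o \<Rightarrow> 'o \<Rightarrow> 'm \<Rightarrow> 'n"

definition is_functor ::
  "('o, 'm) cat \<Rightarrow> ('p, 'n) cat \<Rightarrow> ('o, 'm, 'p, 'n) func \<Rightarrow> bool" where
  "is_functor C D F \<longleftrightarrow> is_category C \<and> is_category D \<and>
     (\<forall>A\<in>Obj C. on_obj F A \<in> Obj D) \<and>
     (\<forall>A\<in>Obj C. \<forall>B\<in>Obj C. \<forall>f\<in>Hom C A B.
        on_hom F A B f \<in> Hom D (on_obj F A) (on_obj F B)) \<and>
     (\<forall>A\<in>Obj C. on_hom F A A (Ident C A) = Ident D (on_obj F A)) \<and>
     (\<forall>A\<in>Obj C. \<forall>B\<in>Obj C. \<forall>E\<in>Obj C. \<forall>f\<in>Hom C A B. \<forall>g\<in>Hom C B E.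
        on_hom F A E (Comp C A B E g f) =
        Comp D (on_obj F A) (on_obj F B) (on_obj F E) (on_hom F B E g) (on_hom F A B f))"

definition id_func :: "('o, 'm, 'o, 'm) func" where
  "id_func = \<lparr>on_obj = (\<lambda>A. A), on_hom = (\<lambda>A B f. f)\<rparr>"

definition comp_func ::
  "('p, 'n, 'q, 'l) func \<Rightarrow> ('o, 'm, 'p, 'n) func \<Rightarrow> ('o, 'm, 'q, 'l) func" where
  "comp_func G F =
     \<lparr>on_obj = (\<lambda>A. on_obj G (on_obj F A)),
      on_hom = (\<lambda>A B f. on_hom G (on_obj F A) (on_obj F B) (on_hom F A B f))\<rparr>"

definition is_natural_iso ::
  "('o, 'm) cat \<Rightarrow> ('p, 'n) cat \<Rightarrow> ('o, 'm, 'p, 'n) func \<Rightarrow> ('o, 'm, 'p, 'n) func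
    \<Rightarrow> ('o \<Rightarrow> 'n) \<Rightarrow> bool" where
  "is_natural_iso C D F G \<eta> \<longleftrightarrow>
     (\<forall>A\<in>Obj C. is_iso D (on_obj F A) (on_obj G A) (\<eta> A)) \<and>
     (\<forall>A\<in>Obj C. \<forall>B\<in>Obj C. \<forall>f\<in>Hom C A B.
        Comp D (on_obj F A) (on_obj G A) (on_obj G B) (on_hom G A B f) (\<eta> A) =
        Comp D (on_obj F A) (on_obj F B) (on_obj G B) (\<eta> B) (on_hom F A B f))"

definition is_equivalence ::
  "('o, 'm) cat \<Rightarrow> ('p, 'n) cat \<Rightarrow> ('o, 'm, 'p, 'n) func \<Rightarrow> ('p, 'n, 'o, 'm) func
    \<Rightarrow> bool" where
  "is_equivalence C D F G \<longleftrightarrow> is_functor C D F \<and> is_functor D C G \<and>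
     (\<exists>\<eta>. is_natural_iso C C id_func (comp_func G F) \<eta>) \<and>
     (\<exists>\<epsilon>. is_natural_iso D D (comp_func F G) id_func \<epsilon>)"


section \<open>Semi-local simple connectedness\<close>

definition semilocally_simply_connected_space :: "'a topology \<Rightarrow> bool" where
  "semilocally_simply_connected_space X \<longleftrightarrow>
     (\<forall>x\<in>topspace X. \<exists>U. openin X U \<and> x \<in> U \<and>
        (\<forall>g. pathin (subtopology X U) g \<and> g 0 = x \<and> g 1 = x \<longrightarrow>
           homotopic_with (\<lambda>h. h 0 = x \<and> h 1 = x) (top_of_set {0..1}) X g (\<lambda>t. x)))"


section \<open>Covers\<close>

text \<open>
  Spaces over X are not tied to one carrier type, so that morphisms can
  also be formed between spaces over X whose points have different types.
  Morphisms are undefined off the total space, so that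
  equality of morphisms is equality of maps. No surjectivity is required of a
  cover; fibres may be empty.
\<close>

record ('a, 'b) over_space =
  total :: "'b topology"
  proj :: "'b \<Rightarrow> 'a"

definition is_cover :: "'a topology \<Rightarrow> ('a, 'b) over_space \<Rightarrow> bool" where
  "is_cover X Y \<longleftrightarrow> continuous_map (total Y) X (proj Y) \<and>
     (\<forall>x\<in>topspace X. \<exists>U V. openin X U \<and> x \<in> U \<and>
        (let fib = {y \<in> topspace (total Y). proj Y y = x} in
           (\<forall>y\<in>fib. openin (total Y) (V y) \<and> y \<in> V y \<and>
              homeomorphic_map (subtopology (total Y) (V y)) (subtopology X U) (proj Y)) \<and>
           disjoint_family_on V fib \<and>
           {y \<in> topspace (total Y). proj Y y \<in> U} = (\<Union>y\<in>fib. V y)))"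

definition cover_hom :: "('a, 'b) over_space \<Rightarrow> ('a, 'c) over_space \<Rightarrow> ('b \<Rightarrow> 'c) set" where
  "cover_hom Y Z = {\<phi> \<in> extensional (topspace (total Y)).
     continuous_map (total Y) (total Z) \<phi> \<and>
     (\<forall>y\<in>topspace (total Y). proj Z (\<phi> y) = proj Y y)}"

definition cover_id :: "('a, 'b) over_space \<Rightarrow> 'b \<Rightarrow> 'b" where
  "cover_id Y = (\<lambda>y\<in>topspace (total Y). y)"

definition cover_comp ::
  "('a, 'b) over_space \<Rightarrow> ('c \<Rightarrow> 'd) \<Rightarrow> ('b \<Rightarrow> 'c) \<Rightarrow> ('b \<Rightarrow> 'd)" where
  "cover_comp Y \<psi> \<phi> = compose (topspace (total Y)) \<psi> \<phi>"

definition is_cover_iso ::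
  "('a, 'b) over_space \<Rightarrow> ('a, 'c) over_space \<Rightarrow> ('b \<Rightarrow> 'c) \<Rightarrow> bool" where
  "is_cover_iso Y Z \<phi> \<longleftrightarrow> \<phi> \<in> cover_hom Y Z \<and>
     (\<exists>\<psi>\<in>cover_hom Z Y. cover_comp Y \<psi> \<phi> = cover_id Y \<and> cover_comp Z \<phi> \<psi> = cover_id Z)"

definition covers_isomorphic :: "('a, 'b) over_space \<Rightarrow> ('a, 'c) over_space \<Rightarrow> bool" where
  "covers_isomorphic Y Z \<longleftrightarrow> (\<exists>\<phi>. is_cover_iso Y Z \<phi>)"

definition cover_cat :: "'a topology \<Rightarrow> (('a, 'b) over_space, 'b \<Rightarrow> 'b) cat" where
  "cover_cat X =
     \<lparr>Obj = {Y. is_cover X Y}, Hom = cover_hom, Ident = cover_id,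
      Comp = (\<lambda>Y Z W. cover_comp Y)\<rparr>"

definition trivial_cover :: "'a topology \<Rightarrow> 'i set \<Rightarrow> ('a, 'a \<times> 'i) over_space" where
  "trivial_cover X I = \<lparr>total = prod_topology X (discrete_topology I), proj = fst\<rparr>"


section \<open>Sheaves of sets\<close>

text \<open>
  The restriction map from the sections over U to those over V is
  res F U V. Only values at open sets of the base matter, so a presheaf on X
  is restricted to an open set U by reading the same record over
  the subspace U.
\<close>

record ('a, 'c) presheaf =
  sect :: "'a set \<Rightarrow> 'c set"
  res :: "'a set \<Rightarrow> 'a set \<Rightarrow> 'c \<Rightarrow> 'c"

definition is_presheaf :: "'a topology \<Rightarrow> ('a, 'c) presheaf \<Rightarrow> bool" where
  "is_presheaf X F \<longleftrightarrow>
     (\<forall>U V. openin X U \<and> openin X V \<and> V \<subseteq> U \<longrightarrow> res F U V \<in> sect F U \<rightarrow> sect F V) \<and>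
     (\<forall>U. openin X U \<longrightarrow> (\<forall>s\<in>sect F U. res F U U s = s)) \<and>
     (\<forall>U V W. openin X U \<and> openin X V \<and> openin X W \<and> W \<subseteq> V \<and> V \<subseteq> U \<longrightarrow>
        (\<forall>s\<in>sect F U. res F V W (res F U V s) = res F U W s))"

definition is_sheaf :: "'a topology \<Rightarrow> ('a, 'c) presheaf \<Rightarrow> bool" where
  "is_sheaf X F \<longleftrightarrow> is_presheaf X F \<and>
     (\<forall>\<U> s. (\<forall>U\<in>\<U>. openin X U) \<and> (\<forall>U\<in>\<U>. s U \<in> sect F U) \<and>
        (\<forall>U\<in>\<U>. \<forall>V\<in>\<U>. res F U (U \<inter> V) (s U) = res F V (U \<inter> V) (s V)) \<longrightarrow>
        (\<exists>!t. t \<in> sect F (\<Union>\<U>) \<and> (\<forall>U\<in>\<U>. res F (\<Union>\<U>) U t = s U)))"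

definition sheaf_hom ::
  "'a topology \<Rightarrow> ('a, 'c) presheaf \<Rightarrow> ('a, 'd) presheaf \<Rightarrow> ('a set \<Rightarrow> 'c \<Rightarrow> 'd) set" where
  "sheaf_hom X F G = {\<alpha> \<in> (\<Pi>\<^sub>E U\<in>{U. openin X U}. sect F U \<rightarrow>\<^sub>E sect G U).
     \<forall>U V. openin X U \<and> openin X V \<and> V \<subseteq> U \<longrightarrow>
       (\<forall>s\<in>sect F U. \<alpha> V (res F U V s) = res G U V (\<alpha> U s))}"

definition sheaf_id :: "'a topology \<Rightarrow> ('a, 'c) presheaf \<Rightarrow> 'a set \<Rightarrow> 'c \<Rightarrow> 'c" where
  "sheaf_id X F = (\<lambda>U\<in>{U. openin X U}. \<lambda>s\<in>sect F U. s)"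

definition sheaf_comp ::
  "'a topology \<Rightarrow> ('a, 'c) presheaf \<Rightarrow> ('a set \<Rightarrow> 'd \<Rightarrow> 'e) \<Rightarrow> ('a set \<Rightarrow> 'c \<Rightarrow> 'd)
    \<Rightarrow> 'a set \<Rightarrow> 'c \<Rightarrow> 'e" where
  "sheaf_comp X F \<beta> \<alpha> = (\<lambda>U\<in>{U. openin X U}. compose (sect F U) (\<beta> U) (\<alpha> U))"

definition sheaves_isomorphic ::
  "'a topology \<Rightarrow> ('a, 'c) presheaf \<Rightarrow> ('a, 'd) presheaf \<Rightarrow> bool" where
  "sheaves_isomorphic X F G \<longleftrightarrow>
     (\<exists>\<alpha>\<in>sheaf_hom X F G. \<exists>\<beta>\<in>sheaf_hom X G F.
        sheaf_comp X F \<beta> \<alpha> = sheaf_id X F \<and> sheaf_comp X G \<alpha> \<beta> = sheaf_id X G)"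

definition constant_sheaf :: "'a topology \<Rightarrow> 'i set \<Rightarrow> ('a, 'a \<Rightarrow> 'i) presheaf" where
  "constant_sheaf X S =
     \<lparr>sect = (\<lambda>U. {f \<in> extensional U.
         continuous_map (subtopology X U) (discrete_topology S) f}),
      res = (\<lambda>U V f. restrict f V)\<rparr>"

text \<open>
  Taking S in the type of the sections is no restriction: S embeds into the
  sections over any nonempty open set on which the sheaf is constant with value S.
\<close>

definition is_locally_constant :: "'a topology \<Rightarrow> ('a, 'c) presheaf \<Rightarrow> bool" where
  "is_locally_constant X F \<longleftrightarrow>
     (\<exists>\<U>. (\<forall>U\<in>\<U>. openin X U) \<and> \<Union>\<U> = topspace X \<and>
        (\<forall>U\<in>\<U>. \<exists>S :: 'c set.
           sheaves_isomorphic (subtopology X U) F (constant_sheaf (subtopology X U) S)))"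

definition locally_constant_sheaf_cat ::
  "'a topology \<Rightarrow> (('a, 'c) presheaf, 'a set \<Rightarrow> 'c \<Rightarrow> 'c) cat" where
  "locally_constant_sheaf_cat X =
     \<lparr>Obj = {F. is_sheaf X F \<and> is_locally_constant X F}, Hom = sheaf_hom X,
      Ident = sheaf_id X, Comp = (\<lambda>F G H. sheaf_comp X F)\<rparr>"


section \<open>The sheaf of sections of a cover\<close>

definition section_sheaf ::
  "'a topology \<Rightarrow> ('a, 'b) over_space \<Rightarrow> ('a, 'a \<Rightarrow> 'b) presheaf" where
  "section_sheaf X Y =
     \<lparr>sect = (\<lambda>U. {s \<in> extensional U.
         continuous_map (subtopology X U) (total Y) s \<and> (\<forall>x\<in>U. proj Y (s x) = x)}),
      res = (\<lambda>U V s. restrict s V)\<rparr>"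

definition section_map ::
  "'a topology \<Rightarrow> ('a, 'b) over_space \<Rightarrow> ('b \<Rightarrow> 'c)
    \<Rightarrow> 'a set \<Rightarrow> ('a \<Rightarrow> 'b) \<Rightarrow> ('a \<Rightarrow> 'c)" where
  "section_map X Y \<phi> =
     (\<lambda>U\<in>{U. openin X U}. \<lambda>s\<in>sect (section_sheaf X Y) U. compose U \<phi> s)"

text \<open>
  Size conventions: if the points of covers have type 'u, then sections have type
  'a => 'u. When 'u is infinite and 'a => 'u injects into 'u, the subsets of the
  two types are the same up to bijection, so that covers with points in 'u and
  sheaves with sections in 'a => 'u are formed from the same sets. The type
  nat * 'a => 'd satisfies both conditions for every type 'd with at least two
  elements, so arbitrarily large covers and sheaves are accommodated.
\<close>

definition section_func ::
  "'a topology \<Rightarrow> (('a, 'b) over_space, 'b \<Rightarrow> 'b,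
     ('a, 'a \<Rightarrow> 'b) presheaf, 'a set \<Rightarrow> ('a \<Rightarrow> 'b) \<Rightarrow> ('a \<Rightarrow> 'b)) func" where
  "section_func X =
     \<lparr>on_obj = section_sheaf X, on_hom = (\<lambda>Y Z. section_map X Y)\<rparr>"


section \<open>The etale space of a sheaf\<close>

text \<open>A germ at x is an equivalence class of pairs of an open set containing x and a section over it.\<close>

definition germ ::
  "'a topology \<Rightarrow> ('a, 'c) presheaf \<Rightarrow> 'a \<Rightarrow> 'a set \<Rightarrow> 'c \<Rightarrow> ('a set \<times> 'c) set" where
  "germ X F x U s = {(V, t). openin X V \<and> x \<in> V \<and> t \<in> sect F V \<and>
     (\<exists>W. openin X W \<and> x \<in> W \<and> W \<subseteq> U \<inter> V \<and> res F U W s = res F V W t)}"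

text \<open>
  The underlying set is the union of the generating sets, that is, the disjoint
  union of the stalks.
\<close>

definition etale_space ::
  "'a topology \<Rightarrow> ('a, 'c) presheaf \<Rightarrow> ('a, 'a \<times> ('a set \<times> 'c) set) over_space" where
  "etale_space X F =
     \<lparr>total = topology_generated_by
        {{(x, germ X F x U s) | x. x \<in> U} | U s. openin X U \<and> s \<in> sect F U},
      proj = fst\<rparr>"

text \<open>
  On stalks: the germ of s at x goes to the germ of \<open>\<alpha> U s\<close> at x. All members
  of the union are equal, being indexed by the representatives of one germ.
\<close>

definition etale_map ::
  "'a topology \<Rightarrow> ('a, 'c) presheaf \<Rightarrow> ('a, 'd) presheaf \<Rightarrow> ('a set \<Rightarrow> 'c \<Rightarrow> 'd)
    \<Rightarrow> 'a \<times> ('a set \<times> 'c) set \<Rightarrow> 'a \<times> ('a set \<times> 'd) set" where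
  "etale_map X F G \<alpha> =
     (\<lambda>(x, g)\<in>topspace (total (etale_space X F)).
        (x, \<Union>(U, s)\<in>g. germ X G x U (\<alpha> U s)))"

text \<open>
  \<open>G\<close> is the etale space functor up to natural isomorphism over X. The two
  cannot be equal because the points of an etale space have a type of their own.
\<close>

definition represents_etale_functor ::
  "'a topology \<Rightarrow> (('a, 'c) presheaf, 'a set \<Rightarrow> 'c \<Rightarrow> 'c, ('a, 'b) over_space, 'b \<Rightarrow> 'b) func
    \<Rightarrow> bool" where
  "represents_etale_functor X G \<longleftrightarrow>
     (\<exists>\<theta>. (\<forall>F\<in>Obj (locally_constant_sheaf_cat X).
             is_cover_iso (etale_space X F) (on_obj G F) (\<theta> F)) \<and>
          (\<forall>F\<in>Obj (locally_constant_sheaf_cat X). \<forall>H\<in>Obj (locally_constant_sheaf_cat X).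
             \<forall>\<alpha>\<in>Hom (locally_constant_sheaf_cat X) F H.
             cover_comp (etale_space X F) (on_hom G F H \<alpha>) (\<theta> F) =
             cover_comp (etale_space X F) (\<theta> H) (etale_map X F H \<alpha>)))"

end

theory Submission
  imports Defs
begin

text \<open>
  A germ of sections of a local homeomorphism \<open>Y \<rightarrow> X\<close> is determined by its value, and every
  point of \<open>Y\<close> is the value of a germ; so evaluation is an isomorphism from the etale space of the
  sheaf of sections onto \<open>Y\<close>. Conversely, a continuous section of the etale space of a sheaf is
  locally a family of germs of one section, and these glue, so the sheaf is isomorphic to the sheaf
  of sections of its etale space. Both isomorphisms are natural. Over a set where a sheaf is constant,
  the constant sections split the etale space into sheets, and over an evenly covered set a section of
  a cover is a locally constant choice of a sheet; so covers match locally constant sheaves. Finally,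
  the etale space of a sheaf is copied along an injection of its points into the type of the points
  of covers, which gives the inverse functor.
\<close>

section \<open>Natural isomorphisms\<close>

text \<open>The obstacle is one of types. Germs are sets of representatives, so an etale space has
  points of its own type and must be replaced by a copy before it is an object of the category of
  covers. The inverse functor therefore depends on a choice: for each sheaf \<open>F\<close> a copy
  \<open>Z F\<close> and an isomorphism \<open>\<theta> F\<close> onto it, with morphisms acting by
  conjugation with \<open>\<theta>\<close>. In the same way a trivial cover has points in a product
  type, so the clauses on trivial covers cannot be read off from the equivalence of categories; they
  come from chains of isomorphisms between objects of different types. This is why functoriality and
  the two comparison isomorphisms are stated for arbitrary presheaves, sheaves and local
  homeomorphisms, with free types of points and sections, and only at the end specialised to the
  objects of the two categories.\<close>

lemma category_comp:
  "is_category C \<Longrightarrow> A \<in> Obj C \<Longrightarrow> B \<in> Obj C \<Longrightarrow> D \<in> Obj C \<Longrightarrow> f \<in> Hom C A B \<Longrightarrow>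
    g \<in> Hom C B D \<Longrightarrow> Comp C A B D g f \<in> Hom C A D"
  by (simp add: is_category_def)

lemma category_id_right:
  "is_category C \<Longrightarrow> A \<in> Obj C \<Longrightarrow> B \<in> Obj C \<Longrightarrow> f \<in> Hom C A B \<Longrightarrow>
    Comp C A A B f (Ident C A) = f"
  by (simp add: is_category_def)

lemma category_id_left:
  "is_category C \<Longrightarrow> A \<in> Obj C \<Longrightarrow> B \<in> Obj C \<Longrightarrow> f \<in> Hom C A B \<Longrightarrow>
    Comp C A B B (Ident C B) f = f"
  by (simp add: is_category_def)

lemma category_assoc:
  "is_category C \<Longrightarrow> A \<in> Obj C \<Longrightarrow> B \<in> Obj C \<Longrightarrow> D \<in> Obj C \<Longrightarrow> E \<in> Obj C \<Longrightarrow>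
    f \<in> Hom C A B \<Longrightarrow> g \<in> Hom C B D \<Longrightarrow> h \<in> Hom C D E \<Longrightarrow>
    Comp C A D E h (Comp C A B D g f) = Comp C A B E (Comp C B D E h g) f"
  by (simp add: is_category_def)

lemma functor_obj: "is_functor C D F \<Longrightarrow> A \<in> Obj C \<Longrightarrow> on_obj F A \<in> Obj D"
  by (simp add: is_functor_def)

lemma functor_hom:
  "is_functor C D F \<Longrightarrow> A \<in> Obj C \<Longrightarrow> B \<in> Obj C \<Longrightarrow> f \<in> Hom C A B \<Longrightarrow>
    on_hom F A B f \<in> Hom D (on_obj F A) (on_obj F B)"
  by (simp add: is_functor_def)

lemma is_functor_id_func: "is_category C \<Longrightarrow> is_functor C C id_func"
  by (simp add: is_functor_def id_func_def)

lemma is_functor_comp_func: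
  "is_functor C D F \<Longrightarrow> is_functor D E G \<Longrightarrow> is_functor C E (comp_func G F)"
  by (simp add: is_functor_def comp_func_def)

text \<open>Both comparison isomorphisms are most easily built in the direction opposite to the one
  that \<open>is_equivalence\<close> asks for. The pointwise inverses \<open>\<eta>\<close> of
  \<open>\<zeta>\<close> are natural: insert \<open>\<zeta> \<eta>\<close> to the right of G(f),
  move \<open>\<zeta>\<close> past f by naturality, and cancel \<open>\<eta> \<zeta>\<close> on the
  left.\<close>

lemma natural_iso_inverse:
  assumes F: "is_functor C D F" and G: "is_functor C D G"
    and \<zeta>: "is_natural_iso C D F G \<zeta>"
  shows "\<exists>\<eta>. is_natural_iso C D G F \<eta>"
proof -
  have D: "is_category D" using F by (simp add: is_functor_def)
  note o = functor_obj[OF F] functor_obj[OF G]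
  have \<zeta>_hom: "\<zeta> A \<in> Hom D (on_obj F A) (on_obj G A)" if "A \<in> Obj C" for A
    using \<zeta> that by (simp add: is_natural_iso_def is_iso_def)
  have "\<forall>A\<in>Obj C. \<exists>g. g \<in> Hom D (on_obj G A) (on_obj F A) \<and>
      Comp D (on_obj F A) (on_obj G A) (on_obj F A) g (\<zeta> A) = Ident D (on_obj F A) \<and>
      Comp D (on_obj G A) (on_obj F A) (on_obj G A) (\<zeta> A) g = Ident D (on_obj G A)"
    using \<zeta> by (auto simp: is_natural_iso_def is_iso_def)
  then obtain \<eta> where \<eta>:
    "\<And>A. A \<in> Obj C \<Longrightarrow> \<eta> A \<in> Hom D (on_obj G A) (on_obj F A)"
    "\<And>A. A \<in> Obj C \<Longrightarrow>
      Comp D (on_obj F A) (on_obj G A) (on_obj F A) (\<eta> A) (\<zeta> A) = Ident D (on_obj F A)"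
    "\<And>A. A \<in> Obj C \<Longrightarrow>
      Comp D (on_obj G A) (on_obj F A) (on_obj G A) (\<zeta> A) (\<eta> A) = Ident D (on_obj G A)"
    by metis
  have nat: "Comp D (on_obj G A) (on_obj F A) (on_obj F B) (on_hom F A B f) (\<eta> A) =
      Comp D (on_obj G A) (on_obj G B) (on_obj F B) (\<eta> B) (on_hom G A B f)"
    if A: "A \<in> Obj C" and B: "B \<in> Obj C" and f: "f \<in> Hom C A B" for A B f
  proof -
    let ?FA = "on_obj F A" and ?GA = "on_obj G A" and ?FB = "on_obj F B" and ?GB = "on_obj G B"
    let ?Ff = "on_hom F A B f" and ?Gf = "on_hom G A B f"
    note h = functor_hom[OF F A B f] functor_hom[OF G A B f] \<eta>(1)[OF A] \<eta>(1)[OF B]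
      \<zeta>_hom[OF A] \<zeta>_hom[OF B] o[OF A] o[OF B]
    have "?Gf = Comp D ?GA ?GA ?GB ?Gf (Comp D ?GA ?FA ?GA (\<zeta> A) (\<eta> A))"
      using \<eta>(3)[OF A] category_id_right[OF D] h by metis
    also have "\<dots> = Comp D ?GA ?FA ?GB (Comp D ?FA ?GA ?GB ?Gf (\<zeta> A)) (\<eta> A)"
      using h by (intro category_assoc[OF D])
    also have "Comp D ?FA ?GA ?GB ?Gf (\<zeta> A) = Comp D ?FA ?FB ?GB (\<zeta> B) ?Ff"
      using \<zeta> A B f by (simp add: is_natural_iso_def)
    also have "Comp D ?GA ?FA ?GB (Comp D ?FA ?FB ?GB (\<zeta> B) ?Ff) (\<eta> A) =
        Comp D ?GA ?FB ?GB (\<zeta> B) (Comp D ?GA ?FA ?FB ?Ff (\<eta> A))"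
      using h by (intro category_assoc[OF D, symmetric])
    finally have "Comp D ?GA ?GB ?FB (\<eta> B) ?Gf =
        Comp D ?GA ?GB ?FB (\<eta> B) (Comp D ?GA ?FB ?GB (\<zeta> B) (Comp D ?GA ?FA ?FB ?Ff (\<eta> A)))"
      by simp
    also have "\<dots> = Comp D ?GA ?FB ?FB (Comp D ?FB ?GB ?FB (\<eta> B) (\<zeta> B))
        (Comp D ?GA ?FA ?FB ?Ff (\<eta> A))"
      using h category_comp[OF D] by (intro category_assoc[OF D]) auto
    also have "\<dots> = Comp D ?GA ?FA ?FB ?Ff (\<eta> A)"
      unfolding \<eta>(2)[OF B] using h category_comp[OF D] by (intro category_id_left[OF D]) auto
    finally show ?thesis by simp
  qed
  have "is_iso D (on_obj G A) (on_obj F A) (\<eta> A)" if "A \<in> Obj C" for A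
    unfolding is_iso_def using that \<eta> \<zeta>_hom by (intro conjI bexI[of _ "\<zeta> A"]) auto
  with nat have "is_natural_iso C D G F \<eta>"
    by (simp add: is_natural_iso_def)
  then show ?thesis by blast
qed

section \<open>Morphisms of spaces over a base\<close>

lemma cover_homD:
  assumes "\<phi> \<in> cover_hom Y Z"
  shows "continuous_map (total Y) (total Z) \<phi>"
    and "\<phi> \<in> extensional (topspace (total Y))"
    and "y \<in> topspace (total Y) \<Longrightarrow> \<phi> y \<in> topspace (total Z)"
    and "y \<in> topspace (total Y) \<Longrightarrow> proj Z (\<phi> y) = proj Y y"
  using assms continuous_map_image_subset_topspace[of "total Y" "total Z" \<phi>]
  by (auto simp: cover_hom_def)

lemma cover_hom_restrictI:
  assumes "continuous_map (total Y) (total Z) \<phi>"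
    and "\<And>y. y \<in> topspace (total Y) \<Longrightarrow> proj Z (\<phi> y) = proj Y y"
  shows "restrict \<phi> (topspace (total Y)) \<in> cover_hom Y Z"
  using assms by (auto simp: cover_hom_def intro: continuous_map_eq)

lemma cover_hom_eqI:
  assumes "\<phi> \<in> cover_hom Y Z" "\<psi> \<in> cover_hom Y Z"
    and "\<And>y. y \<in> topspace (total Y) \<Longrightarrow> \<phi> y = \<psi> y"
  shows "\<phi> = \<psi>"
  using assms by (blast intro: extensionalityI cover_homD(2))

lemma cover_id_hom: "cover_id Y \<in> cover_hom Y Y"
  unfolding cover_id_def by (rule cover_hom_restrictI) auto

lemma cover_id_apply [simp]: "y \<in> topspace (total Y) \<Longrightarrow> cover_id Y y = y"
  by (simp add: cover_id_def)

lemma cover_comp_apply [simp]: "y \<in> topspace (total Y) \<Longrightarrow> cover_comp Y \<psi> \<phi> y = \<psi> (\<phi> y)"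
  by (simp add: cover_comp_def compose_def)

lemma cover_comp_hom:
  assumes "\<phi> \<in> cover_hom Y Z" "\<psi> \<in> cover_hom Z W"
  shows "cover_comp Y \<psi> \<phi> \<in> cover_hom Y W"
proof -
  have "restrict (\<psi> \<circ> \<phi>) (topspace (total Y)) \<in> cover_hom Y W"
    using assms by (intro cover_hom_restrictI continuous_map_compose[of _ "total Z"]) (auto simp: cover_homD)
  then show ?thesis
    by (simp add: cover_comp_def compose_def restrict_def o_def)
qed

text \<open>The inverse of a homeomorphism over the base is again over the base, since proj Y
  (\<psi> z) = proj Z (\<phi> (\<psi> z)) = proj Z z. Isomorphisms can thus be recognised by
  topological criteria, such as being a continuous open bijection.\<close>

lemma cover_iso_iff_homeomorphic_map:
  "is_cover_iso Y Z \<phi> \<longleftrightarrow> \<phi> \<in> cover_hom Y Z \<and> homeomorphic_map (total Y) (total Z) \<phi>"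
proof
  assume "is_cover_iso Y Z \<phi>"
  then obtain \<psi> where \<phi>: "\<phi> \<in> cover_hom Y Z" and \<psi>: "\<psi> \<in> cover_hom Z Y"
    and eq: "cover_comp Y \<psi> \<phi> = cover_id Y" "cover_comp Z \<phi> \<psi> = cover_id Z"
    by (auto simp: is_cover_iso_def)
  have "\<psi> (\<phi> y) = y" if "y \<in> topspace (total Y)" for y
    using fun_cong[OF eq(1), of y] that by simp
  moreover have "\<phi> (\<psi> z) = z" if "z \<in> topspace (total Z)" for z
    using fun_cong[OF eq(2), of z] that by simp
  ultimately have "homeomorphic_maps (total Y) (total Z) \<phi> \<psi>"
    using \<phi> \<psi> by (simp add: homeomorphic_maps_def cover_homD(1))
  then show "\<phi> \<in> cover_hom Y Z \<and> homeomorphic_map (total Y) (total Z) \<phi>"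
    using \<phi> homeomorphic_map_maps by blast
next
  assume "\<phi> \<in> cover_hom Y Z \<and> homeomorphic_map (total Y) (total Z) \<phi>"
  then obtain \<psi> where \<phi>: "\<phi> \<in> cover_hom Y Z"
    and \<psi>: "homeomorphic_maps (total Y) (total Z) \<phi> \<psi>"
    by (auto simp: homeomorphic_map_maps)
  have inv: "\<psi> (\<phi> y) = y" if "y \<in> topspace (total Y)" for y
    using \<psi> that by (simp add: homeomorphic_maps_def)
  have inv': "\<psi> z \<in> topspace (total Y)" "\<phi> (\<psi> z) = z" if "z \<in> topspace (total Z)" for z
    using \<psi> that continuous_map_image_subset_topspace[of "total Z" "total Y" \<psi>]
    by (auto simp: homeomorphic_maps_def)
  have \<psi>_hom: "restrict \<psi> (topspace (total Z)) \<in> cover_hom Z Y"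
    using \<psi> cover_homD(4)[OF \<phi>] inv'
    by (intro cover_hom_restrictI) (auto simp: homeomorphic_maps_def, metis)
  have "cover_comp Y (restrict \<psi> (topspace (total Z))) \<phi> = cover_id Y"
    using \<phi> \<psi>_hom
    by (intro cover_hom_eqI[OF cover_comp_hom cover_id_hom]) (auto simp: inv cover_homD(3))
  moreover have "cover_comp Z \<phi> (restrict \<psi> (topspace (total Z))) = cover_id Z"
    using \<phi> \<psi>_hom
    by (intro cover_hom_eqI[OF cover_comp_hom cover_id_hom]) (auto simp: inv')
  ultimately show "is_cover_iso Y Z \<phi>"
    using \<phi> \<psi>_hom by (auto simp: is_cover_iso_def)
qed

lemma cover_iso_comp:
  assumes "is_cover_iso Y Z \<phi>" "is_cover_iso Z W \<psi>"
  shows "is_cover_iso Y W (cover_comp Y \<psi> \<phi>)"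
proof -
  have "homeomorphic_map (total Y) (total W) (\<psi> \<circ> \<phi>)"
    using assms by (auto simp: cover_iso_iff_homeomorphic_map intro: homeomorphic_map_compose)
  then have "homeomorphic_map (total Y) (total W) (cover_comp Y \<psi> \<phi>)"
    by (rule homeomorphic_map_eq) simp
  then show ?thesis
    using assms by (auto simp: cover_iso_iff_homeomorphic_map intro: cover_comp_hom)
qed

lemma cover_iso_inverse:
  assumes "is_cover_iso Y Z \<phi>"
  obtains \<psi> where "is_cover_iso Z Y \<psi>"
    "\<And>y. y \<in> topspace (total Y) \<Longrightarrow> \<psi> (\<phi> y) = y"
    "\<And>z. z \<in> topspace (total Z) \<Longrightarrow> \<phi> (\<psi> z) = z"
proof -
  obtain \<psi> where \<psi>: "\<psi> \<in> cover_hom Z Y"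
    "cover_comp Y \<psi> \<phi> = cover_id Y" "cover_comp Z \<phi> \<psi> = cover_id Z"
    using assms by (auto simp: is_cover_iso_def)
  show ?thesis
  proof
    show "is_cover_iso Z Y \<psi>"
      using assms \<psi> by (auto simp: is_cover_iso_def)
    show "\<psi> (\<phi> y) = y" if "y \<in> topspace (total Y)" for y
      using fun_cong[OF \<psi>(2), of y] that by simp
    show "\<phi> (\<psi> z) = z" if "z \<in> topspace (total Z)" for z
      using fun_cong[OF \<psi>(3), of z] that by simp
  qed
qed

lemma covers_isomorphic_sym: "covers_isomorphic Y Z \<Longrightarrow> covers_isomorphic Z Y"
  by (auto simp: covers_isomorphic_def elim: cover_iso_inverse)

lemma covers_isomorphic_trans:
  "covers_isomorphic Y Z \<Longrightarrow> covers_isomorphic Z W \<Longrightarrow> covers_isomorphic Y W"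
  by (auto simp: covers_isomorphic_def dest: cover_iso_comp)

lemma is_category_cover_cat: "is_category (cover_cat X)"
  unfolding is_category_def cover_cat_def cat.simps
proof (intro conjI ballI)
  fix A B D E :: "('a, 'b) over_space" and f g h
  assume f: "f \<in> cover_hom A B" and g: "g \<in> cover_hom B D" and h: "h \<in> cover_hom D E"
  show "cover_comp A h (cover_comp A g f) = cover_comp A (cover_comp B h g) f"
    using f g h cover_comp_hom[OF g h] cover_comp_hom[OF f g]
    by (intro cover_hom_eqI[of _ A E]) (auto simp: cover_homD(3) intro: cover_comp_hom)
next
  fix A B :: "('a, 'b) over_space" and f
  assume f: "f \<in> cover_hom A B"
  show "cover_comp A f (cover_id A) = f"
    using f by (intro cover_hom_eqI[OF cover_comp_hom[OF cover_id_hom]]) simp_all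
  show "cover_comp A (cover_id B) f = f"
    using f by (intro cover_hom_eqI[OF cover_comp_hom[OF _ cover_id_hom]]) (simp_all add: cover_homD(3))
qed (rule cover_id_hom cover_comp_hom; assumption)+

section \<open>Evenly covered neighbourhoods and transport along isomorphisms\<close>

lemma is_coverE:
  assumes "is_cover X Y" and "x \<in> topspace X"
  obtains U V where "openin X U" "x \<in> U"
    "\<forall>y\<in>{y \<in> topspace (total Y). proj Y y = x}. openin (total Y) (V y) \<and> y \<in> V y \<and>
      homeomorphic_map (subtopology (total Y) (V y)) (subtopology X U) (proj Y)"
    "disjoint_family_on V {y \<in> topspace (total Y). proj Y y = x}"
    "{y \<in> topspace (total Y). proj Y y \<in> U} = (\<Union>y\<in>{y \<in> topspace (total Y). proj Y y = x}. V y)"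
  using bspec[OF conjunct2[OF assms(1)[unfolded is_cover_def Let_def]] assms(2)]
  by (elim exE conjE) (rule that)

text \<open>Needed for the copies of etale spaces. The evenly covered set stays the same, and the
  fibre over its centre is matched with the old fibre by the isomorphism, so the sheets can be
  carried over one by one.\<close>

lemma is_cover_cover_iso:
  assumes "is_cover_iso Y Z \<phi>" and "is_cover X Y"
  shows "is_cover X Z"
proof -
  obtain \<psi> where \<psi>: "is_cover_iso Z Y \<psi>"
    "\<And>y. y \<in> topspace (total Y) \<Longrightarrow> \<psi> (\<phi> y) = y"
    "\<And>z. z \<in> topspace (total Z) \<Longrightarrow> \<phi> (\<psi> z) = z"
    using cover_iso_inverse[OF assms(1)] by metis
  have \<phi>h: "\<phi> \<in> cover_hom Y Z" "homeomorphic_map (total Y) (total Z) \<phi>"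
    and \<psi>h: "\<psi> \<in> cover_hom Z Y" "homeomorphic_map (total Z) (total Y) \<psi>"
    using assms(1) \<psi>(1) by (auto simp: cover_iso_iff_homeomorphic_map)
  note D = cover_homD[OF \<phi>h(1)] cover_homD[OF \<psi>h(1)]
  have proj_eq: "proj Y (\<psi> z) = proj Z z" if "z \<in> topspace (total Z)" for z
    using D that by simp
  have "continuous_map (total Z) X (proj Y \<circ> \<psi>)"
    using assms(2) D by (auto simp: is_cover_def intro: continuous_map_compose)
  then have cont: "continuous_map (total Z) X (proj Z)"
    by (rule continuous_map_eq) (simp add: proj_eq)
  have "\<exists>U V. openin X U \<and> x \<in> U \<and>
        (\<forall>z\<in>{z \<in> topspace (total Z). proj Z z = x}. openin (total Z) (V z) \<and> z \<in> V z \<and>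
            homeomorphic_map (subtopology (total Z) (V z)) (subtopology X U) (proj Z)) \<and>
         disjoint_family_on V {z \<in> topspace (total Z). proj Z z = x} \<and>
         {z \<in> topspace (total Z). proj Z z \<in> U} = (\<Union>z\<in>{z \<in> topspace (total Z). proj Z z = x}. V z)"
    if x: "x \<in> topspace X" for x
  proof -
    let ?Y = "{y \<in> topspace (total Y). proj Y y = x}" and ?Z = "{z \<in> topspace (total Z). proj Z z = x}"
    obtain U V where U: "openin X U" "x \<in> U"
      and V0: "\<forall>y\<in>?Y. openin (total Y) (V y) \<and> y \<in> V y \<and>
        homeomorphic_map (subtopology (total Y) (V y)) (subtopology X U) (proj Y)"
      and disj: "disjoint_family_on V ?Y"
      and un: "{y \<in> topspace (total Y). proj Y y \<in> U} = (\<Union>y\<in>?Y. V y)"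
      by (rule is_coverE[OF assms(2) x])
    have V: "openin (total Y) (V y)" "y \<in> V y"
        "homeomorphic_map (subtopology (total Y) (V y)) (subtopology X U) (proj Y)" if "y \<in> ?Y" for y
      using V0 that by auto
    \<comment> \<open>The sheets are written as preimages under \<open>\<psi>\<close> instead of
      images under \<open>\<phi>\<close>, so that their openness is just continuity of
      \<open>\<psi>\<close>.\<close>
    let ?V = "\<lambda>z. {w \<in> topspace (total Z). \<psi> w \<in> V (\<psi> z)}"
    have fib: "\<psi> z \<in> ?Y" if "z \<in> ?Z" for z
      using that D by auto
    have 1: "openin (total Z) (?V z)" if "z \<in> ?Z" for z
      using D(5) V(1)[OF fib[OF that]] by (rule openin_continuous_map_preimage)
    have 2: "z \<in> ?V z" if "z \<in> ?Z" for z
      using that V(2)[OF fib[OF that]] by auto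
    have 3: "homeomorphic_map (subtopology (total Z) (?V z)) (subtopology X U) (proj Z)"
      if "z \<in> ?Z" for z
    proof -
      have sub: "V (\<psi> z) \<subseteq> topspace (total Y)"
        using V(1)[OF fib[OF that]] openin_subset by blast
      have "\<psi> ` (topspace (total Z) \<inter> ?V z) = topspace (total Y) \<inter> V (\<psi> z)"
        using D(3) sub \<psi>(2) D(7) by (force simp: image_iff)
      then have "homeomorphic_map (subtopology (total Z) (?V z)) (subtopology (total Y) (V (\<psi> z))) \<psi>"
        by (intro homeomorphic_map_subtopologies[OF \<psi>h(2)])
      then have "homeomorphic_map (subtopology (total Z) (?V z)) (subtopology X U) (proj Y \<circ> \<psi>)"
        using V(3)[OF fib[OF that]] by (rule homeomorphic_map_compose)
      then show ?thesis
        by (rule homeomorphic_map_eq) (simp add: proj_eq)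
    qed
    have 4: "disjoint_family_on ?V ?Z"
      unfolding disjoint_family_on_def
    proof (intro ballI impI)
      fix z w assume zw: "z \<in> ?Z" "w \<in> ?Z" "z \<noteq> w"
      then have "\<psi> z \<noteq> \<psi> w"
        using \<psi>(3) by (metis (no_types, lifting) mem_Collect_eq)
      then have "V (\<psi> z) \<inter> V (\<psi> w) = {}"
        using disj fib[OF zw(1)] fib[OF zw(2)] unfolding disjoint_family_on_def by blast
      then show "?V z \<inter> ?V w = {}" by blast
    qed
    have 5: "{z \<in> topspace (total Z). proj Z z \<in> U} = (\<Union>z\<in>?Z. ?V z)"
    proof (intro subset_antisym subsetI)
      fix z assume z: "z \<in> {z \<in> topspace (total Z). proj Z z \<in> U}"
      then have "\<psi> z \<in> {y \<in> topspace (total Y). proj Y y \<in> U}"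
        using D by auto
      then obtain y where y: "y \<in> ?Y" "\<psi> z \<in> V y"
        using un by blast
      then have "\<phi> y \<in> ?Z" "\<psi> (\<phi> y) = y"
        using D \<psi>(2) by auto
      then show "z \<in> (\<Union>z\<in>?Z. ?V z)"
        using y z by (intro UN_I[of "\<phi> y"]) auto
    next
      fix z assume "z \<in> (\<Union>z\<in>?Z. ?V z)"
      then obtain w where w: "w \<in> ?Z" "z \<in> topspace (total Z)" "\<psi> z \<in> V (\<psi> w)" by blast
      then have "\<psi> z \<in> {y \<in> topspace (total Y). proj Y y \<in> U}"
        using fib[OF w(1)] un by blast
      then show "z \<in> {z \<in> topspace (total Z). proj Z z \<in> U}"
        using w(2) proj_eq by auto
    qed
    show ?thesis
      by (intro exI[of _ U] exI[of _ ?V] conjI ballI U 1 2 3 4 5)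
  qed
  then show ?thesis
    unfolding is_cover_def Let_def by (intro conjI ballI cont)
qed

text \<open>The copy lives on the image of \<open>e\<close>, with the topology pulled back along a
  left inverse \<open>i\<close>; this makes both \<open>e\<close> and \<open>i\<close> continuous.
  Injectivity is asked only on the points of the space, because the ambient type of germs may be too
  large to inject.\<close>

lemma cover_iso_transport:
  fixes Y :: "('a, 'b) over_space" and e :: "'b \<Rightarrow> 'u"
  assumes "inj_on e (topspace (total Y))"
  obtains Z :: "('a, 'u) over_space" and \<phi> where "is_cover_iso Y Z \<phi>"
proof -
  let ?T = "topspace (total Y)"
  obtain i where inv: "\<And>y. y \<in> ?T \<Longrightarrow> i (e y) = y"
    using assms by (metis inv_into_f_f)
  define Z :: "('a, 'u) over_space"
    where "Z = \<lparr>total = pullback_topology (e ` ?T) i (total Y), proj = proj Y \<circ> i\<rparr>"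
  have e: "continuous_map (total Y) (total Z) e"
    unfolding Z_def over_space.simps
  proof (rule continuous_map_pullback')
    show "continuous_map (total Y) (total Y) (i \<circ> e)"
      by (rule continuous_map_eq[OF continuous_map_id]) (simp add: inv)
    show "?T \<subseteq> e -` e ` ?T" by blast
  qed
  have i: "continuous_map (total Z) (total Y) i"
    unfolding Z_def over_space.simps
    using continuous_map_pullback[OF continuous_map_id, of "e ` ?T" i "total Y"]
    unfolding id_comp .
  have Z: "topspace (total Z) = e ` ?T"
    unfolding Z_def over_space.simps topspace_pullback_topology using inv by auto
  have "homeomorphic_maps (total Y) (total Z) e i"
    unfolding homeomorphic_maps_def Z using e i inv by simp
  then have "homeomorphic_map (total Y) (total Z) e"
    by (rule homeomorphic_maps_imp_map)
  then have "homeomorphic_map (total Y) (total Z) (restrict e ?T)"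
    by (rule homeomorphic_map_eq) simp
  moreover have "restrict e ?T \<in> cover_hom Y Z"
    using e by (rule cover_hom_restrictI) (simp add: Z_def inv)
  ultimately have "is_cover_iso Y Z (restrict e ?T)"
    unfolding cover_iso_iff_homeomorphic_map by blast
  then show ?thesis by (rule that)
qed

section \<open>Morphisms of sheaves\<close>

lemma sheaf_hom_sect:
  "\<alpha> \<in> sheaf_hom X F G \<Longrightarrow> openin X U \<Longrightarrow> s \<in> sect F U \<Longrightarrow> \<alpha> U s \<in> sect G U"
  by (fastforce simp: sheaf_hom_def PiE_iff Pi_iff)

lemma sheaf_hom_res:
  "\<alpha> \<in> sheaf_hom X F G \<Longrightarrow> openin X U \<Longrightarrow> openin X V \<Longrightarrow> V \<subseteq> U \<Longrightarrow> s \<in> sect F U \<Longrightarrow>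
    \<alpha> V (res F U V s) = res G U V (\<alpha> U s)"
  by (simp add: sheaf_hom_def)

lemma sheaf_hom_eqI:
  assumes \<alpha>: "\<alpha> \<in> sheaf_hom X F G" and \<beta>: "\<beta> \<in> sheaf_hom X F G"
    and eq: "\<And>U s. openin X U \<Longrightarrow> s \<in> sect F U \<Longrightarrow> \<alpha> U s = \<beta> U s"
  shows "\<alpha> = \<beta>"
proof (rule PiE_ext)
  show "\<alpha> \<in> (\<Pi>\<^sub>E U\<in>{U. openin X U}. sect F U \<rightarrow>\<^sub>E sect G U)"
    "\<beta> \<in> (\<Pi>\<^sub>E U\<in>{U. openin X U}. sect F U \<rightarrow>\<^sub>E sect G U)"
    using \<alpha> \<beta> by (simp_all add: sheaf_hom_def)
  fix U assume U: "U \<in> {U. openin X U}"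
  have "\<alpha> U \<in> sect F U \<rightarrow>\<^sub>E sect G U" "\<beta> U \<in> sect F U \<rightarrow>\<^sub>E sect G U"
    using \<alpha> \<beta> U by (auto simp: sheaf_hom_def PiE_iff)
  then show "\<alpha> U = \<beta> U"
    using eq U by (intro PiE_ext) auto
qed

lemma sheaf_hom_restrictI:
  assumes "\<And>U s. openin X U \<Longrightarrow> s \<in> sect F U \<Longrightarrow> \<alpha> U s \<in> sect G U"
    and "\<And>U V s. openin X U \<Longrightarrow> openin X V \<Longrightarrow> V \<subseteq> U \<Longrightarrow> s \<in> sect F U \<Longrightarrow>
      res F U V s \<in> sect F V"
    and "\<And>U V s. openin X U \<Longrightarrow> openin X V \<Longrightarrow> V \<subseteq> U \<Longrightarrow> s \<in> sect F U \<Longrightarrow>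
      \<alpha> V (res F U V s) = res G U V (\<alpha> U s)"
  shows "(\<lambda>U\<in>{U. openin X U}. \<lambda>s\<in>sect F U. \<alpha> U s) \<in> sheaf_hom X F G"
  using assms by (auto simp: sheaf_hom_def)

lemma presheaf_res_sect:
  "is_presheaf X F \<Longrightarrow> openin X U \<Longrightarrow> openin X V \<Longrightarrow> V \<subseteq> U \<Longrightarrow> s \<in> sect F U \<Longrightarrow>
    res F U V s \<in> sect F V"
  by (auto simp: is_presheaf_def)

lemma presheaf_res_id:
  "is_presheaf X F \<Longrightarrow> openin X U \<Longrightarrow> s \<in> sect F U \<Longrightarrow> res F U U s = s"
  by (auto simp: is_presheaf_def)

lemma presheaf_res_res:
  "is_presheaf X F \<Longrightarrow> openin X U \<Longrightarrow> openin X V \<Longrightarrow> openin X W \<Longrightarrow> W \<subseteq> V \<Longrightarrow> V \<subseteq> U \<Longrightarrow>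
    s \<in> sect F U \<Longrightarrow> res F V W (res F U V s) = res F U W s"
  by (simp add: is_presheaf_def)

lemma is_sheaf_is_presheaf: "is_sheaf X F \<Longrightarrow> is_presheaf X F"
  by (simp add: is_sheaf_def)

lemma sheaf_id_apply: "openin X U \<Longrightarrow> s \<in> sect F U \<Longrightarrow> sheaf_id X F U s = s"
  by (simp add: sheaf_id_def)

lemma sheaf_comp_apply:
  "openin X U \<Longrightarrow> s \<in> sect F U \<Longrightarrow> sheaf_comp X F \<beta> \<alpha> U s = \<beta> U (\<alpha> U s)"
  by (simp add: sheaf_comp_def compose_def)

lemma sheaf_id_hom: "is_presheaf X F \<Longrightarrow> sheaf_id X F \<in> sheaf_hom X F F"
  unfolding sheaf_id_def by (rule sheaf_hom_restrictI) (auto intro: presheaf_res_sect)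

lemma sheaf_comp_hom:
  assumes F: "is_presheaf X F" and \<alpha>: "\<alpha> \<in> sheaf_hom X F G" and \<beta>: "\<beta> \<in> sheaf_hom X G H"
  shows "sheaf_comp X F \<beta> \<alpha> \<in> sheaf_hom X F H"
  unfolding sheaf_comp_def compose_def
proof (rule sheaf_hom_restrictI)
  fix U s assume U: "openin X U" and s: "s \<in> sect F U"
  show "\<beta> U (\<alpha> U s) \<in> sect H U"
    using U s sheaf_hom_sect[OF \<alpha>] sheaf_hom_sect[OF \<beta>] by blast
  fix V assume V: "openin X V" "V \<subseteq> U"
  show "res F U V s \<in> sect F V"
    by (rule presheaf_res_sect[OF F U V s])
  show "\<beta> V (\<alpha> V (res F U V s)) = res H U V (\<beta> U (\<alpha> U s))"
    using sheaf_hom_res[OF \<alpha> U V s] sheaf_hom_res[OF \<beta> U V sheaf_hom_sect[OF \<alpha> U s]] by simp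
qed

text \<open>Bijectivity over every open set is what can be checked in practice; for presheaves it
  amounts to having an inverse morphism, and it composes easily.\<close>

definition is_sheaf_iso ::
  "'a topology \<Rightarrow> ('a, 'c) presheaf \<Rightarrow> ('a, 'd) presheaf \<Rightarrow> ('a set \<Rightarrow> 'c \<Rightarrow> 'd) \<Rightarrow> bool" where
  "is_sheaf_iso X F G \<alpha> \<longleftrightarrow> \<alpha> \<in> sheaf_hom X F G \<and>
     (\<forall>U. openin X U \<longrightarrow> bij_betw (\<alpha> U) (sect F U) (sect G U))"

lemma sheaf_iso_hom: "is_sheaf_iso X F G \<alpha> \<Longrightarrow> \<alpha> \<in> sheaf_hom X F G"
  by (simp add: is_sheaf_iso_def)

lemma sheaf_isoI:
  assumes \<alpha>: "\<alpha> \<in> sheaf_hom X F G" and \<beta>: "\<beta> \<in> sheaf_hom X G F"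
    and eq: "sheaf_comp X F \<beta> \<alpha> = sheaf_id X F" "sheaf_comp X G \<alpha> \<beta> = sheaf_id X G"
  shows "is_sheaf_iso X F G \<alpha>"
  unfolding is_sheaf_iso_def
proof (intro conjI allI impI)
  fix U assume U: "openin X U"
  show "bij_betw (\<alpha> U) (sect F U) (sect G U)"
  proof (rule bij_betwI)
    show "\<alpha> U \<in> sect F U \<rightarrow> sect G U" "\<beta> U \<in> sect G U \<rightarrow> sect F U"
      using sheaf_hom_sect[OF \<alpha> U] sheaf_hom_sect[OF \<beta> U] by auto
    show "\<beta> U (\<alpha> U s) = s" if "s \<in> sect F U" for s
      using sheaf_comp_apply[OF U that, of \<beta> \<alpha>] sheaf_id_apply[OF U that] eq(1) by simp
    show "\<alpha> U (\<beta> U t) = t" if "t \<in> sect G U" for t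
      using sheaf_comp_apply[OF U that, of \<alpha> \<beta>] sheaf_id_apply[OF U that] eq(2) by simp
  qed
qed (rule \<alpha>)

text \<open>The sectionwise inverses commute with restriction because \<open>\<alpha>\<close> does:
  write a section of \<open>G\<close> as the image under \<open>\<alpha>\<close> of a section of
  \<open>F\<close>, restrict, and undo \<open>\<alpha>\<close> over the smaller set.\<close>

lemma sheaf_iso_inverse:
  assumes F: "is_presheaf X F" and G: "is_presheaf X G" and \<alpha>: "is_sheaf_iso X F G \<alpha>"
  obtains \<beta> where "is_sheaf_iso X G F \<beta>"
    "sheaf_comp X F \<beta> \<alpha> = sheaf_id X F" "sheaf_comp X G \<alpha> \<beta> = sheaf_id X G"
proof -
  have \<alpha>h: "\<alpha> \<in> sheaf_hom X F G" and bij: "\<And>U. openin X U \<Longrightarrow> bij_betw (\<alpha> U) (sect F U) (sect G U)"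
    using \<alpha> by (auto simp: is_sheaf_iso_def)
  define b where "b U = inv_into (sect F U) (\<alpha> U)" for U
  define \<beta> where "\<beta> = (\<lambda>U\<in>{U. openin X U}. \<lambda>t\<in>sect G U. b U t)"
  have b_sect: "b U t \<in> sect F U" and \<alpha>b: "\<alpha> U (b U t) = t"
    if "openin X U" "t \<in> sect G U" for U t
    using bij[OF that(1)] that(2) unfolding b_def
    by (metis bij_betw_imp_surj_on inv_into_into, metis bij_betw_inv_into_right)
  have b\<alpha>: "b U (\<alpha> U s) = s" if "openin X U" "s \<in> sect F U" for U s
    using bij[OF that(1)] that(2) unfolding b_def by (rule bij_betw_inv_into_left)
  have \<beta>h: "\<beta> \<in> sheaf_hom X G F"
    unfolding \<beta>_def
  proof (rule sheaf_hom_restrictI)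
    fix U t assume U: "openin X U" and t: "t \<in> sect G U"
    show "b U t \<in> sect F U" by (rule b_sect[OF U t])
    fix V assume V: "openin X V" "V \<subseteq> U"
    show "res G U V t \<in> sect G V" by (rule presheaf_res_sect[OF G U V t])
    have "b V (res G U V t) = b V (\<alpha> V (res F U V (b U t)))"
      using sheaf_hom_res[OF \<alpha>h U V b_sect[OF U t]] \<alpha>b[OF U t] by simp
    also have "\<dots> = res F U V (b U t)"
      by (rule b\<alpha>[OF V(1) presheaf_res_sect[OF F U V b_sect[OF U t]]])
    finally show "b V (res G U V t) = res F U V (b U t)" .
  qed
  have \<beta>: "\<beta> U t = b U t" if "openin X U" "t \<in> sect G U" for U t
    using that by (simp add: \<beta>_def)
  have 1: "sheaf_comp X F \<beta> \<alpha> = sheaf_id X F"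
    by (rule sheaf_hom_eqI[OF sheaf_comp_hom[OF F \<alpha>h \<beta>h] sheaf_id_hom[OF F]])
      (simp add: sheaf_comp_apply sheaf_id_apply \<beta> b\<alpha> sheaf_hom_sect[OF \<alpha>h])
  have 2: "sheaf_comp X G \<alpha> \<beta> = sheaf_id X G"
    by (rule sheaf_hom_eqI[OF sheaf_comp_hom[OF G \<beta>h \<alpha>h] sheaf_id_hom[OF G]])
      (simp add: sheaf_comp_apply sheaf_id_apply \<beta> \<alpha>b)
  show ?thesis
    by (rule that[OF sheaf_isoI[OF \<beta>h \<alpha>h 2 1] 1 2])
qed

lemma sheaf_iso_comp:
  assumes F: "is_presheaf X F" and \<alpha>: "is_sheaf_iso X F G \<alpha>" and \<beta>: "is_sheaf_iso X G H \<beta>"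
  shows "is_sheaf_iso X F H (sheaf_comp X F \<beta> \<alpha>)"
  unfolding is_sheaf_iso_def
proof (intro conjI allI impI)
  show "sheaf_comp X F \<beta> \<alpha> \<in> sheaf_hom X F H"
    using \<alpha> \<beta> by (intro sheaf_comp_hom[OF F]) (auto simp: is_sheaf_iso_def)
  fix U assume U: "openin X U"
  have "bij_betw (\<beta> U \<circ> \<alpha> U) (sect F U) (sect H U)"
    using \<alpha> \<beta> U by (auto simp: is_sheaf_iso_def intro: bij_betw_trans)
  then show "bij_betw (sheaf_comp X F \<beta> \<alpha> U) (sect F U) (sect H U)"
    by (rule iffD1[OF bij_betw_cong, rotated]) (simp add: sheaf_comp_apply U)
qed

lemma sheaves_isomorphic_iff:
  assumes "is_presheaf X F" "is_presheaf X G"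
  shows "sheaves_isomorphic X F G \<longleftrightarrow> (\<exists>\<alpha>. is_sheaf_iso X F G \<alpha>)"
proof
  assume "sheaves_isomorphic X F G"
  then show "\<exists>\<alpha>. is_sheaf_iso X F G \<alpha>"
    unfolding sheaves_isomorphic_def using sheaf_isoI by blast
next
  assume "\<exists>\<alpha>. is_sheaf_iso X F G \<alpha>"
  then obtain \<alpha> where \<alpha>: "is_sheaf_iso X F G \<alpha>" ..
  obtain \<beta> where \<beta>: "is_sheaf_iso X G F \<beta>"
    "sheaf_comp X F \<beta> \<alpha> = sheaf_id X F" "sheaf_comp X G \<alpha> \<beta> = sheaf_id X G"
    using sheaf_iso_inverse[OF assms \<alpha>] by blast
  then show "sheaves_isomorphic X F G"
    unfolding sheaves_isomorphic_def using sheaf_iso_hom[OF \<alpha>] sheaf_iso_hom[OF \<beta>(1)] by blast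
qed

lemma sheaves_isomorphic_sym: "sheaves_isomorphic X F G \<Longrightarrow> sheaves_isomorphic X G F"
  unfolding sheaves_isomorphic_def by blast

lemma sheaves_isomorphic_trans:
  assumes F: "is_presheaf X F" and G: "is_presheaf X G" and H: "is_presheaf X H"
    and "sheaves_isomorphic X F G" "sheaves_isomorphic X G H"
  shows "sheaves_isomorphic X F H"
  using assms(4,5) sheaf_iso_comp[OF F]
  unfolding sheaves_isomorphic_iff[OF F G] sheaves_isomorphic_iff[OF G H]
    sheaves_isomorphic_iff[OF F H] by blast

section \<open>The category of locally constant sheaves\<close>

lemma sheaf_comp_assoc:
  assumes F: "is_presheaf X F" and G: "is_presheaf X G"
    and \<alpha>: "\<alpha> \<in> sheaf_hom X F G" and \<beta>: "\<beta> \<in> sheaf_hom X G H" and \<gamma>: "\<gamma> \<in> sheaf_hom X H K"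
  shows "sheaf_comp X F \<gamma> (sheaf_comp X F \<beta> \<alpha>) = sheaf_comp X F (sheaf_comp X G \<gamma> \<beta>) \<alpha>"
proof (rule sheaf_hom_eqI)
  show "sheaf_comp X F \<gamma> (sheaf_comp X F \<beta> \<alpha>) \<in> sheaf_hom X F K"
    by (rule sheaf_comp_hom[OF F sheaf_comp_hom[OF F \<alpha> \<beta>] \<gamma>])
  show "sheaf_comp X F (sheaf_comp X G \<gamma> \<beta>) \<alpha> \<in> sheaf_hom X F K"
    by (rule sheaf_comp_hom[OF F \<alpha> sheaf_comp_hom[OF G \<beta> \<gamma>]])
qed (simp add: sheaf_comp_apply sheaf_hom_sect[OF \<alpha>])

lemma sheaf_comp_id_right:
  assumes F: "is_presheaf X F" and \<alpha>: "\<alpha> \<in> sheaf_hom X F G"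
  shows "sheaf_comp X F \<alpha> (sheaf_id X F) = \<alpha>"
  by (rule sheaf_hom_eqI[OF sheaf_comp_hom[OF F sheaf_id_hom[OF F] \<alpha>] \<alpha>])
    (simp add: sheaf_comp_apply sheaf_id_apply)

lemma sheaf_comp_id_left:
  assumes F: "is_presheaf X F" and G: "is_presheaf X G" and \<alpha>: "\<alpha> \<in> sheaf_hom X F G"
  shows "sheaf_comp X F (sheaf_id X G) \<alpha> = \<alpha>"
  by (rule sheaf_hom_eqI[OF sheaf_comp_hom[OF F \<alpha> sheaf_id_hom[OF G]] \<alpha>])
    (simp add: sheaf_comp_apply sheaf_id_apply sheaf_hom_sect[OF \<alpha>])

lemma is_category_locally_constant_sheaf_cat: "is_category (locally_constant_sheaf_cat X)"
  unfolding is_category_def locally_constant_sheaf_cat_def cat.simps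
  by (intro conjI ballI; clarsimp)
    (auto simp: is_sheaf_is_presheaf sheaf_id_hom sheaf_comp_hom
      sheaf_comp_id_right sheaf_comp_id_left sheaf_comp_assoc)

section \<open>The sheaf of sections\<close>

lemma subtopology_subtopology_subset:
  "W \<subseteq> U \<Longrightarrow> subtopology (subtopology X U) W = subtopology X W"
  by (simp add: subtopology_subtopology Int_absorb1)

lemma mem_section_sheaf:
  "s \<in> sect (section_sheaf X Y) U \<longleftrightarrow> s \<in> extensional U \<and>
     continuous_map (subtopology X U) (total Y) s \<and> (\<forall>x\<in>U. proj Y (s x) = x)"
  by (simp add: section_sheaf_def)

lemma res_section_sheaf [simp]: "res (section_sheaf X Y) U V s = restrict s V"
  by (simp add: section_sheaf_def)

lemma mem_constant_sheaf:
  "f \<in> sect (constant_sheaf X S) U \<longleftrightarrow>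
     f \<in> extensional U \<and> continuous_map (subtopology X U) (discrete_topology S) f"
  by (simp add: constant_sheaf_def)

lemma res_constant_sheaf [simp]: "res (constant_sheaf X S) U V f = restrict f V"
  by (simp add: constant_sheaf_def)

lemma section_topspace:
  assumes "openin X U" "s \<in> sect (section_sheaf X Y) U" "x \<in> U"
  shows "s x \<in> topspace (total Y)"
proof -
  have "continuous_map (subtopology X U) (total Y) s"
    using assms(2) by (simp add: mem_section_sheaf)
  moreover have "x \<in> topspace (subtopology X U)"
    using assms(1,3) openin_subset by fastforce
  ultimately show ?thesis
    by (meson continuous_map_funspace funcset_mem)
qed

lemma restrict_section:
  assumes "s \<in> sect (section_sheaf X Y) U" "V \<subseteq> U"
  shows "restrict s V \<in> sect (section_sheaf X Y) V"
proof -
  have "continuous_map (subtopology (subtopology X U) V) (total Y) s"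
    using assms(1) by (simp add: mem_section_sheaf continuous_map_from_subtopology)
  then have "continuous_map (subtopology X V) (total Y) (restrict s V)"
    unfolding subtopology_subtopology_subset[OF assms(2)]
    by (rule continuous_map_eq) simp
  then show ?thesis
    using assms by (auto simp: mem_section_sheaf)
qed

lemma restrict_locally_constant_map:
  assumes "f \<in> sect (constant_sheaf X S) U" "V \<subseteq> U"
  shows "restrict f V \<in> sect (constant_sheaf X S) V"
proof -
  have "continuous_map (subtopology (subtopology X U) V) (discrete_topology S) f"
    using assms(1) by (simp add: mem_constant_sheaf continuous_map_from_subtopology)
  then have "continuous_map (subtopology X V) (discrete_topology S) (restrict f V)"
    unfolding subtopology_subtopology_subset[OF assms(2)]
    by (rule continuous_map_eq) simp
  then show ?thesis
    by (simp add: mem_constant_sheaf)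
qed

lemma is_presheaf_section_sheaf: "is_presheaf X (section_sheaf X Y)"
  unfolding is_presheaf_def
  by (auto simp: restrict_section Int_absorb1 restrict_restrict
      intro!: extensional_restrict) (simp_all add: mem_section_sheaf)

lemma is_presheaf_constant_sheaf: "is_presheaf X (constant_sheaf X S)"
  unfolding is_presheaf_def
  by (auto simp: restrict_locally_constant_map Int_absorb1 restrict_restrict
      intro!: extensional_restrict) (simp_all add: mem_constant_sheaf)

section \<open>Functoriality and gluing of sections\<close>

lemma section_map_apply:
  assumes "openin X U" "s \<in> sect (section_sheaf X Y) U"
  shows "section_map X Y \<phi> U s = (\<lambda>x\<in>U. \<phi> (s x))"
  using assms by (simp add: section_map_def compose_def)

lemma section_map_hom:
  assumes \<phi>: "\<phi> \<in> cover_hom Y Z"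
  shows "section_map X Y \<phi> \<in> sheaf_hom X (section_sheaf X Y) (section_sheaf X Z)"
  unfolding section_map_def
proof (rule sheaf_hom_restrictI)
  fix U s assume U: "openin X U" and s: "s \<in> sect (section_sheaf X Y) U"
  have "continuous_map (subtopology X U) (total Z) (\<phi> \<circ> s)"
    using s cover_homD(1)[OF \<phi>] by (auto simp: mem_section_sheaf intro: continuous_map_compose)
  then have "continuous_map (subtopology X U) (total Z) (compose U \<phi> s)"
    by (rule continuous_map_eq) (simp add: compose_def)
  then show "compose U \<phi> s \<in> sect (section_sheaf X Z) U"
    using s section_topspace[OF U s] cover_homD(4)[OF \<phi>]
    by (simp add: mem_section_sheaf compose_eq)
  fix V assume V: "openin X V" "V \<subseteq> U"
  show "res (section_sheaf X Y) U V s \<in> sect (section_sheaf X Y) V"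
    using restrict_section[OF s V(2)] by simp
  show "compose V \<phi> (res (section_sheaf X Y) U V s) = res (section_sheaf X Z) U V (compose U \<phi> s)"
    using V(2) by (auto simp: compose_def fun_eq_iff)
qed

lemma section_map_id: "section_map X Y (cover_id Y) = sheaf_id X (section_sheaf X Y)"
proof (rule sheaf_hom_eqI)
  show "section_map X Y (cover_id Y) \<in> sheaf_hom X (section_sheaf X Y) (section_sheaf X Y)"
    by (rule section_map_hom[OF cover_id_hom])
  show "sheaf_id X (section_sheaf X Y) \<in> sheaf_hom X (section_sheaf X Y) (section_sheaf X Y)"
    by (rule sheaf_id_hom[OF is_presheaf_section_sheaf])
  fix U s assume U: "openin X U" and s: "s \<in> sect (section_sheaf X Y) U"
  have "(\<lambda>x\<in>U. cover_id Y (s x)) = s"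
    using s section_topspace[OF U s]
    by (intro extensionalityI[of _ U]) (simp_all add: mem_section_sheaf)
  then show "section_map X Y (cover_id Y) U s = sheaf_id X (section_sheaf X Y) U s"
    by (simp add: section_map_apply sheaf_id_apply U s)
qed

lemma section_map_comp:
  assumes \<phi>: "\<phi> \<in> cover_hom Y Z" and \<psi>: "\<psi> \<in> cover_hom Z W"
  shows "section_map X Y (cover_comp Y \<psi> \<phi>) =
    sheaf_comp X (section_sheaf X Y) (section_map X Z \<psi>) (section_map X Y \<phi>)"
proof (rule sheaf_hom_eqI)
  show "section_map X Y (cover_comp Y \<psi> \<phi>) \<in> sheaf_hom X (section_sheaf X Y) (section_sheaf X W)"
    by (rule section_map_hom[OF cover_comp_hom[OF \<phi> \<psi>]])
  show "sheaf_comp X (section_sheaf X Y) (section_map X Z \<psi>) (section_map X Y \<phi>)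
      \<in> sheaf_hom X (section_sheaf X Y) (section_sheaf X W)"
    by (rule sheaf_comp_hom[OF is_presheaf_section_sheaf section_map_hom[OF \<phi>] section_map_hom[OF \<psi>]])
  fix U s assume U: "openin X U" and s: "s \<in> sect (section_sheaf X Y) U"
  have "section_map X Y \<phi> U s \<in> sect (section_sheaf X Z) U"
    by (rule sheaf_hom_sect[OF section_map_hom[OF \<phi>] U s])
  then show "section_map X Y (cover_comp Y \<psi> \<phi>) U s =
      sheaf_comp X (section_sheaf X Y) (section_map X Z \<psi>) (section_map X Y \<phi>) U s"
    using section_topspace[OF U s]
    by (auto simp: section_map_apply sheaf_comp_apply U s intro: restrict_ext)
qed

lemma section_map_iso:
  assumes "is_cover_iso Y Z \<phi>"
  shows "is_sheaf_iso X (section_sheaf X Y) (section_sheaf X Z) (section_map X Y \<phi>)"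
proof -
  obtain \<psi> where \<phi>: "\<phi> \<in> cover_hom Y Z" and \<psi>: "\<psi> \<in> cover_hom Z Y"
    and eq: "cover_comp Y \<psi> \<phi> = cover_id Y" "cover_comp Z \<phi> \<psi> = cover_id Z"
    using assms by (auto simp: is_cover_iso_def)
  show ?thesis
    using section_map_comp[OF \<phi> \<psi>, of X] section_map_comp[OF \<psi> \<phi>, of X]
    by (intro sheaf_isoI[OF section_map_hom[OF \<phi>] section_map_hom[OF \<psi>]])
      (simp_all add: eq section_map_id)
qed

lemma sheaves_isomorphic_section_sheaf:
  "covers_isomorphic Y Z \<Longrightarrow> sheaves_isomorphic X (section_sheaf X Y) (section_sheaf X Z)"
  unfolding covers_isomorphic_def
    sheaves_isomorphic_iff[OF is_presheaf_section_sheaf is_presheaf_section_sheaf]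
  using section_map_iso by blast

lemma is_sheaf_section_sheaf: "is_sheaf X (section_sheaf X Y)"
  unfolding is_sheaf_def
proof (intro conjI allI impI is_presheaf_section_sheaf)
  fix \<U> and s :: "'a set \<Rightarrow> 'a \<Rightarrow> 'b"
  assume "(\<forall>U\<in>\<U>. openin X U) \<and> (\<forall>U\<in>\<U>. s U \<in> sect (section_sheaf X Y) U) \<and>
    (\<forall>U\<in>\<U>. \<forall>V\<in>\<U>. res (section_sheaf X Y) U (U \<inter> V) (s U) = res (section_sheaf X Y) V (U \<inter> V) (s V))"
  then have op: "\<And>U. U \<in> \<U> \<Longrightarrow> openin X U"
    and s: "\<And>U. U \<in> \<U> \<Longrightarrow> s U \<in> sect (section_sheaf X Y) U"
    and compat: "\<And>U V. U \<in> \<U> \<Longrightarrow> V \<in> \<U> \<Longrightarrow> restrict (s U) (U \<inter> V) = restrict (s V) (U \<inter> V)"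
    by auto
  have compat': "s U x = s V x" if "U \<in> \<U>" "V \<in> \<U>" "x \<in> U" "x \<in> V" for U V x
    using fun_cong[OF compat[OF that(1,2)], of x] that by simp
  have "\<forall>x\<in>\<Union>\<U>. \<exists>U. U \<in> \<U> \<and> x \<in> U" by blast
  then obtain p where p: "\<And>x. x \<in> \<Union>\<U> \<Longrightarrow> p x \<in> \<U>" "\<And>x. x \<in> \<Union>\<U> \<Longrightarrow> x \<in> p x"
    by metis
  \<comment> \<open>The member \<open>p x\<close> chosen at \<open>x\<close> has no influence on the
    value, by \<open>compat'\<close>. So \<open>t\<close> agrees with \<open>s U\<close> on all of
    \<open>U\<close>, and continuity follows by pasting over the open sets of the family.\<close>
  define t where "t = (\<lambda>x\<in>\<Union>\<U>. s (p x) x)"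
  have t: "t x = s U x" if "U \<in> \<U>" "x \<in> U" for U x
    using that p[of x] compat'[of "p x" U x] by (auto simp: t_def)
  have "continuous_map (subtopology X (\<Union>\<U>)) (total Y) t"
  proof (rule pasting_lemma[where I=\<U> and T="\<lambda>U. U" and f=s])
    show "openin (subtopology X (\<Union>\<U>)) U" if "U \<in> \<U>" for U
      using op that by (subst openin_open_subtopology) auto
    show "continuous_map (subtopology (subtopology X (\<Union>\<U>)) U) (total Y) (s U)" if "U \<in> \<U>" for U
      using s[OF that] that by (subst subtopology_subtopology_subset) (auto simp: mem_section_sheaf)
    show "s U x = s V x" if "U \<in> \<U>" "V \<in> \<U>" "x \<in> topspace (subtopology X (\<Union>\<U>)) \<inter> U \<inter> V" for U V x
      using that compat' by blast
    show "\<exists>U. U \<in> \<U> \<and> x \<in> U \<and> t x = s U x" if "x \<in> topspace (subtopology X (\<Union>\<U>))" for x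
      using that t by auto
  qed
  moreover have "proj Y (t x) = x" if x: "x \<in> \<Union>\<U>" for x
  proof -
    obtain U where U: "U \<in> \<U>" "x \<in> U" using x by blast
    then show ?thesis using s[OF U(1)] t[OF U] by (simp add: mem_section_sheaf)
  qed
  ultimately have t_sect: "t \<in> sect (section_sheaf X Y) (\<Union>\<U>)"
    by (auto simp: mem_section_sheaf t_def)
  have t_res: "restrict t U = s U" if "U \<in> \<U>" for U
    using s[OF that] t[OF that] by (intro extensionalityI[of _ U]) (auto simp: mem_section_sheaf)
  show "\<exists>!t. t \<in> sect (section_sheaf X Y) (\<Union>\<U>) \<and>
      (\<forall>U\<in>\<U>. res (section_sheaf X Y) (\<Union>\<U>) U t = s U)"
  proof (intro ex1I[of _ t] conjI ballI)
    fix t' assume t': "t' \<in> sect (section_sheaf X Y) (\<Union>\<U>) \<and>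
      (\<forall>U\<in>\<U>. res (section_sheaf X Y) (\<Union>\<U>) U t' = s U)"
    show "t' = t"
    proof (rule extensionalityI)
      show "t' \<in> extensional (\<Union>\<U>)" "t \<in> extensional (\<Union>\<U>)"
        using t' t_sect by (auto simp: mem_section_sheaf)
      fix x assume "x \<in> \<Union>\<U>"
      then obtain U where U: "U \<in> \<U>" "x \<in> U" by blast
      then have "restrict t' U = s U" using t' by simp
      then show "t' x = t x" using t[OF U] U(2) by (metis restrict_apply')
    qed
  qed (use t_sect t_res in auto)
qed

section \<open>Germs and the etale space\<close>

lemma mem_germ:
  "(V, t) \<in> germ X F x U s \<longleftrightarrow> openin X V \<and> x \<in> V \<and> t \<in> sect F V \<and>
     (\<exists>W. openin X W \<and> x \<in> W \<and> W \<subseteq> U \<inter> V \<and> res F U W s = res F V W t)"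
  by (simp add: germ_def)

lemma germ_self: "openin X U \<Longrightarrow> x \<in> U \<Longrightarrow> s \<in> sect F U \<Longrightarrow> (U, s) \<in> germ X F x U s"
  by (auto simp: mem_germ)

text \<open>Germs are whole equivalence classes, so this is transitivity of local agreement: a third
  section that agrees with \<open>s\<close> on \<open>B\<close> agrees with \<open>t\<close> on W
  \<inter> B. One inclusion is proved for arbitrary representatives; the other follows by exchanging
  them.\<close>

lemma germ_eqI:
  assumes F: "is_presheaf X F" and U: "openin X U" "s \<in> sect F U" and V: "openin X V" "t \<in> sect F V"
    and W: "openin X W" "x \<in> W" "W \<subseteq> U" "W \<subseteq> V" and eq: "res F U W s = res F V W t"
  shows "germ X F x U s = germ X F x V t"
proof -
  have *: "germ X F x U s \<subseteq> germ X F x V t"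
    if U: "openin X U" "s \<in> sect F U" and V: "openin X V" "t \<in> sect F V"
      and W: "openin X W" "x \<in> W" "W \<subseteq> U" "W \<subseteq> V" and eq: "res F U W s = res F V W t"
    for U V s t
  proof clarify
    fix A r assume "(A, r) \<in> germ X F x U s"
    then obtain B where A: "openin X A" "x \<in> A" "r \<in> sect F A"
      and B: "openin X B" "x \<in> B" "B \<subseteq> U \<inter> A" "res F U B s = res F A B r"
      by (auto simp: mem_germ)
    have WB: "openin X (W \<inter> B)" using W B by blast
    have "res F V (W \<inter> B) t = res F W (W \<inter> B) (res F V W t)"
      using F V W WB by (intro presheaf_res_res[symmetric]) auto
    also have "\<dots> = res F W (W \<inter> B) (res F U W s)"
      using eq by simp
    also have "\<dots> = res F U (W \<inter> B) s"
      using F U W WB by (intro presheaf_res_res) auto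
    also have "\<dots> = res F B (W \<inter> B) (res F U B s)"
      using F U B WB by (intro presheaf_res_res[symmetric]) auto
    also have "\<dots> = res F B (W \<inter> B) (res F A B r)"
      using B(4) by simp
    also have "\<dots> = res F A (W \<inter> B) r"
      using F A B WB by (intro presheaf_res_res) auto
    finally show "(A, r) \<in> germ X F x V t"
      using A W B WB unfolding mem_germ by blast
  qed
  show ?thesis
    using *[OF U V W eq] *[OF V U W(1,2,4,3) eq[symmetric]] by blast
qed

lemma germ_eqE:
  assumes "germ X F x U s = germ X F x V t" "openin X V" "x \<in> V" "t \<in> sect F V"
  obtains W where "openin X W" "x \<in> W" "W \<subseteq> U" "W \<subseteq> V" "res F U W s = res F V W t"
proof -
  have "(V, t) \<in> germ X F x U s"
    using germ_self[OF assms(2-4)] assms(1) by simp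
  then show ?thesis using that by (auto simp: mem_germ)
qed

lemma germ_res:
  assumes "is_presheaf X F" "openin X U" "openin X V" "V \<subseteq> U" "x \<in> V" "s \<in> sect F U"
  shows "germ X F x V (res F U V s) = germ X F x U s"
  using assms by (intro germ_eqI[where W=V]) (auto intro: presheaf_res_sect presheaf_res_id)

text \<open>This is the map x \<mapsto> s_x, cut off outside \<open>U\<close> so that it can itself
  be a member of the sheaf of sections of the etale space.\<close>

definition germ_section ::
  "'a topology \<Rightarrow> ('a, 'c) presheaf \<Rightarrow> 'a set \<Rightarrow> 'c \<Rightarrow> 'a \<Rightarrow> 'a \<times> ('a set \<times> 'c) set" where
  "germ_section X F U s = (\<lambda>x\<in>U. (x, germ X F x U s))"

lemma germ_section_apply [simp]: "x \<in> U \<Longrightarrow> germ_section X F U s x = (x, germ X F x U s)"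
  by (simp add: germ_section_def)

lemma total_etale_space:
  "total (etale_space X F) =
     topology_generated_by {germ_section X F U s ` U | U s. openin X U \<and> s \<in> sect F U}"
proof -
  have "{(x, germ X F x U s) | x. x \<in> U} = germ_section X F U s ` U" for U s
    by force
  then show ?thesis by (simp add: etale_space_def)
qed

lemma proj_etale_space [simp]: "proj (etale_space X F) = fst"
  by (simp add: etale_space_def)

lemma mem_topspace_etale_space:
  "p \<in> topspace (total (etale_space X F)) \<longleftrightarrow>
     (\<exists>U s x. openin X U \<and> s \<in> sect F U \<and> x \<in> U \<and> p = (x, germ X F x U s))"
  unfolding etale_space_def over_space.simps topology_generated_by_topspace by blast

lemma topspace_etale_spaceI [intro]:
  "openin X U \<Longrightarrow> s \<in> sect F U \<Longrightarrow> x \<in> U \<Longrightarrow> (x, germ X F x U s) \<in> topspace (total (etale_space X F))"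
  by (auto simp: mem_topspace_etale_space)

lemma topspace_etale_spaceE:
  assumes "p \<in> topspace (total (etale_space X F))"
  obtains U s x where "openin X U" "s \<in> sect F U" "x \<in> U" "p = (x, germ X F x U s)"
  using assms by (auto simp: mem_topspace_etale_space)

lemma openin_germ_section_image:
  "openin X U \<Longrightarrow> s \<in> sect F U \<Longrightarrow> openin (total (etale_space X F)) (germ_section X F U s ` U)"
  unfolding total_etale_space by (rule topology_generated_by_Basis) blast

text \<open>The generating sets form a base, so the topology is coinduced by the maps \<open>x \<mapsto> s_x\<close>.\<close>

lemma openin_etale_space_iff:
  assumes F: "is_presheaf X F"
  shows "openin (total (etale_space X F)) A \<longleftrightarrow> A \<subseteq> topspace (total (etale_space X F)) \<and>
    (\<forall>U s. openin X U \<and> s \<in> sect F U \<longrightarrow> openin X {x \<in> U. (x, germ X F x U s) \<in> A})"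
    (is "?lhs \<longleftrightarrow> ?rhs")
proof
  assume A: ?lhs
  have "openin X {x \<in> U. (x, germ X F x U s) \<in> A}" if U: "openin X U" "s \<in> sect F U" for U s
  proof -
    \<comment> \<open>Taking preimages under x \<mapsto> s_x commutes with finite intersections and
      unions, so by induction over the generation of the topology only the generating sets need an
      argument.\<close>
    have "generate_topology_on {germ_section X F U s ` U | U s. openin X U \<and> s \<in> sect F U} A"
      using A unfolding total_etale_space openin_topology_generated_by_iff .
    then show ?thesis
    proof induction
      case Empty
      then show ?case by simp
    next
      case (Int a b)
      have "{x \<in> U. (x, germ X F x U s) \<in> a \<inter> b} =
          {x \<in> U. (x, germ X F x U s) \<in> a} \<inter> {x \<in> U. (x, germ X F x U s) \<in> b}" by blast
      then show ?case using Int by (simp add: openin_Int)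
    next
      case (UN K)
      have "{x \<in> U. (x, germ X F x U s) \<in> \<Union>K} = (\<Union>k\<in>K. {x \<in> U. (x, germ X F x U s) \<in> k})"
        by blast
      moreover have "openin X (\<Union>k\<in>K. {x \<in> U. (x, germ X F x U s) \<in> k})"
        using UN by (intro openin_Union) auto
      ultimately show ?case by simp
    next
      case (Basis a)
      then obtain V t where V: "openin X V" "t \<in> sect F V" and a: "a = germ_section X F V t ` V"
        by blast
      have a': "(x, germ X F x U s) \<in> a \<longleftrightarrow> x \<in> V \<and> germ X F x U s = germ X F x V t" for x
        unfolding a by (auto simp: germ_section_def)
      show ?case
      proof (subst openin_subopen, intro ballI)
        fix x assume "x \<in> {x \<in> U. (x, germ X F x U s) \<in> a}"
        then have x: "x \<in> U" "x \<in> V" "germ X F x U s = germ X F x V t" by (auto simp: a')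
        \<comment> \<open>Equality of germs is an open condition: it comes from agreement on a whole
          neighbourhood, and there the germs are equal at every point.\<close>
        obtain W where W: "openin X W" "x \<in> W" "W \<subseteq> U" "W \<subseteq> V" "res F U W s = res F V W t"
          using germ_eqE[OF x(3) V(1) x(2) V(2)] by blast
        have "W \<subseteq> {x \<in> U. (x, germ X F x U s) \<in> a}"
          using W germ_eqI[OF F U V W(1) _ W(3-5)] by (auto simp: a')
        then show "\<exists>T. openin X T \<and> x \<in> T \<and> T \<subseteq> {x \<in> U. (x, germ X F x U s) \<in> a}"
          using W by blast
      qed
    qed
  qed
  then show ?rhs using openin_subset[OF A] by blast
next
  assume A: ?rhs
  show ?lhs
  proof (subst openin_subopen, intro ballI)
    fix p assume p: "p \<in> A"
    obtain U s x where U: "openin X U" "s \<in> sect F U" and x: "x \<in> U" "p = (x, germ X F x U s)"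
      using A p by (meson subsetD topspace_etale_spaceE)
    \<comment> \<open>The part of \<open>U\<close> whose germs lie in \<open>A\<close> is open by
      assumption. Restricting \<open>s\<close> to it does not change germs, so it yields a
      generating set between \<open>p\<close> and \<open>A\<close>.\<close>
    let ?W = "{x \<in> U. (x, germ X F x U s) \<in> A}"
    have W: "openin X ?W" "?W \<subseteq> U" using A U by auto
    have eq: "germ_section X F ?W (res F U ?W s) y = (y, germ X F y U s)" if "y \<in> ?W" for y
      using that germ_res[OF F U(1) W that U(2)] by simp
    have "openin (total (etale_space X F)) (germ_section X F ?W (res F U ?W s) ` ?W)"
      using W by (intro openin_germ_section_image presheaf_res_sect[OF F U(1) W U(2)])
    moreover have "germ_section X F ?W (res F U ?W s) ` ?W \<subseteq> A"
      using eq by auto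
    moreover have "p \<in> germ_section X F ?W (res F U ?W s) ` ?W"
      using x p eq[of x] by (metis (mono_tags, lifting) image_eqI mem_Collect_eq)
    ultimately show "\<exists>T. openin (total (etale_space X F)) T \<and> p \<in> T \<and> T \<subseteq> A" by blast
  qed
qed

lemma continuous_map_germ_section:
  assumes F: "is_presheaf X F" and U: "openin X U" and s: "s \<in> sect F U"
  shows "continuous_map (subtopology X U) (total (etale_space X F)) (germ_section X F U s)"
  unfolding continuous_map_def
proof (intro conjI allI impI)
  have top: "topspace (subtopology X U) = U"
    using openin_subset[OF U] by auto
  show "germ_section X F U s \<in> topspace (subtopology X U) \<rightarrow> topspace (total (etale_space X F))"
    using U s top by auto
  fix A assume "openin (total (etale_space X F)) A"
  then have "openin X {x \<in> U. (x, germ X F x U s) \<in> A}"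
    using openin_etale_space_iff[OF F] U s by blast
  moreover have "{x \<in> topspace (subtopology X U). germ_section X F U s x \<in> A} =
      {x \<in> U. (x, germ X F x U s) \<in> A}"
    unfolding top by auto
  ultimately show "openin (subtopology X U) {x \<in> topspace (subtopology X U). germ_section X F U s x \<in> A}"
    using U by (auto simp: openin_open_subtopology)
qed

text \<open>The universal property of the coinduced topology. The projection, the maps induced by
  morphisms of sheaves and the evaluation of germs all get their continuity from it.\<close>

lemma continuous_map_from_etale_space:
  assumes F: "is_presheaf X F"
    and f: "\<And>U s. openin X U \<Longrightarrow> s \<in> sect F U \<Longrightarrow>
      continuous_map (subtopology X U) T (\<lambda>x. f (x, germ X F x U s))"
  shows "continuous_map (total (etale_space X F)) T f"
  unfolding continuous_map_def
proof (intro conjI allI impI)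
  have top: "topspace (subtopology X U) = U" if "openin X U" for U
    using openin_subset[OF that] by auto
  show "f \<in> topspace (total (etale_space X F)) \<rightarrow> topspace T"
  proof
    fix p assume "p \<in> topspace (total (etale_space X F))"
    then obtain U s x where U: "openin X U" "s \<in> sect F U" "x \<in> U" "p = (x, germ X F x U s)"
      by (rule topspace_etale_spaceE)
    show "f p \<in> topspace T"
      using continuous_map_funspace[OF f[OF U(1,2)]] U top[OF U(1)] by auto
  qed
  fix A assume A: "openin T A"
  show "openin (total (etale_space X F)) {p \<in> topspace (total (etale_space X F)). f p \<in> A}"
    unfolding openin_etale_space_iff[OF F]
  proof (intro conjI allI impI)
    fix U s assume U: "openin X U \<and> s \<in> sect F U"
    then have "openin (subtopology X U) {x \<in> topspace (subtopology X U). f (x, germ X F x U s) \<in> A}"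
      by (intro openin_continuous_map_preimage[OF f A]) simp_all
    moreover have "{x \<in> topspace (subtopology X U). f (x, germ X F x U s) \<in> A} =
        {x \<in> U. (x, germ X F x U s) \<in> {p \<in> topspace (total (etale_space X F)). f p \<in> A}}"
      using U top by auto
    ultimately show "openin X {x \<in> U. (x, germ X F x U s) \<in> {p \<in> topspace (total (etale_space X F)). f p \<in> A}}"
      using U by (simp add: openin_open_subtopology)
  qed auto
qed

lemma continuous_map_proj_etale_space:
  "is_presheaf X F \<Longrightarrow> continuous_map (total (etale_space X F)) X fst"
  by (rule continuous_map_from_etale_space) (simp_all add: continuous_map_from_subtopology)

section \<open>Functoriality of the etale space\<close>

lemma etale_map_germ:
  assumes F: "is_presheaf X F" and G: "is_presheaf X G" and \<alpha>: "\<alpha> \<in> sheaf_hom X F G"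
    and U: "openin X U" "s \<in> sect F U" and x: "x \<in> U"
  shows "etale_map X F G \<alpha> (x, germ X F x U s) = (x, germ X G x U (\<alpha> U s))"
proof -
  \<comment> \<open>All members of the union in \<open>etale_map\<close> coincide: a morphism
    commutes with restriction, so it preserves agreement on \<open>W\<close>. The union is not
    empty, as the class contains its own representative, and hence collapses to one germ.\<close>
  have "germ X G x V (\<alpha> V t) = germ X G x U (\<alpha> U s)" if Vt: "(V, t) \<in> germ X F x U s" for V t
  proof -
    obtain W where V: "openin X V" "t \<in> sect F V"
      and W: "openin X W" "x \<in> W" "W \<subseteq> U" "W \<subseteq> V" "res F U W s = res F V W t"
      using Vt by (auto simp: mem_germ)
    have "res G V W (\<alpha> V t) = res G U W (\<alpha> U s)"
      using sheaf_hom_res[OF \<alpha> U(1) W(1,3) U(2)] sheaf_hom_res[OF \<alpha> V(1) W(1,4) V(2)] W(5) by simp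
    then show ?thesis
      using W U V sheaf_hom_sect[OF \<alpha>] by (intro germ_eqI[OF G, where W=W]) auto
  qed
  then have "(\<Union>(V, t)\<in>germ X F x U s. germ X G x V (\<alpha> V t)) = germ X G x U (\<alpha> U s)"
    using germ_self[OF U(1) x U(2)] by blast
  then show ?thesis
    using U x by (auto simp: etale_map_def)
qed

lemma etale_map_hom:
  assumes F: "is_presheaf X F" and G: "is_presheaf X G" and \<alpha>: "\<alpha> \<in> sheaf_hom X F G"
  shows "etale_map X F G \<alpha> \<in> cover_hom (etale_space X F) (etale_space X G)"
proof -
  note germ = etale_map_germ[OF F G \<alpha>]
  have "continuous_map (total (etale_space X F)) (total (etale_space X G)) (etale_map X F G \<alpha>)"
  proof (rule continuous_map_from_etale_space[OF F])
    fix U s assume U: "openin X U" "s \<in> sect F U"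
    show "continuous_map (subtopology X U) (total (etale_space X G))
        (\<lambda>x. etale_map X F G \<alpha> (x, germ X F x U s))"
      by (rule continuous_map_eq[OF continuous_map_germ_section[OF G U(1) sheaf_hom_sect[OF \<alpha> U]]])
        (simp add: germ[OF U])
  qed
  moreover have "fst (etale_map X F G \<alpha> p) = fst p" if "p \<in> topspace (total (etale_space X F))" for p
    using that by (auto elim!: topspace_etale_spaceE simp: germ)
  moreover have "etale_map X F G \<alpha> \<in> extensional (topspace (total (etale_space X F)))"
    by (simp add: etale_map_def)
  ultimately show ?thesis by (simp add: cover_hom_def)
qed

lemma etale_map_id:
  assumes F: "is_presheaf X F"
  shows "etale_map X F F (sheaf_id X F) = cover_id (etale_space X F)"
proof (rule cover_hom_eqI[OF etale_map_hom[OF F F sheaf_id_hom[OF F]] cover_id_hom])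
  fix p assume p: "p \<in> topspace (total (etale_space X F))"
  then show "etale_map X F F (sheaf_id X F) p = cover_id (etale_space X F) p"
    by (auto elim!: topspace_etale_spaceE
        simp: etale_map_germ[OF F F sheaf_id_hom[OF F]] sheaf_id_apply topspace_etale_spaceI)
qed

lemma etale_map_comp:
  assumes F: "is_presheaf X F" and G: "is_presheaf X G" and H: "is_presheaf X H"
    and \<alpha>: "\<alpha> \<in> sheaf_hom X F G" and \<beta>: "\<beta> \<in> sheaf_hom X G H"
  shows "etale_map X F H (sheaf_comp X F \<beta> \<alpha>) =
    cover_comp (etale_space X F) (etale_map X G H \<beta>) (etale_map X F G \<alpha>)"
proof (rule cover_hom_eqI)
  note \<beta>\<alpha> = sheaf_comp_hom[OF F \<alpha> \<beta>]
  show "etale_map X F H (sheaf_comp X F \<beta> \<alpha>) \<in> cover_hom (etale_space X F) (etale_space X H)"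
    by (rule etale_map_hom[OF F H \<beta>\<alpha>])
  show "cover_comp (etale_space X F) (etale_map X G H \<beta>) (etale_map X F G \<alpha>)
      \<in> cover_hom (etale_space X F) (etale_space X H)"
    by (rule cover_comp_hom[OF etale_map_hom[OF F G \<alpha>] etale_map_hom[OF G H \<beta>]])
  fix p assume p: "p \<in> topspace (total (etale_space X F))"
  then obtain U s x where U: "openin X U" "s \<in> sect F U" "x \<in> U" "p = (x, germ X F x U s)"
    by (rule topspace_etale_spaceE)
  show "etale_map X F H (sheaf_comp X F \<beta> \<alpha>) p =
      cover_comp (etale_space X F) (etale_map X G H \<beta>) (etale_map X F G \<alpha>) p"
    using p U sheaf_hom_sect[OF \<alpha> U(1,2)]
    by (simp add: etale_map_germ[OF F H \<beta>\<alpha>] etale_map_germ[OF F G \<alpha>] etale_map_germ[OF G H \<beta>]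
        sheaf_comp_apply)
qed

text \<open>The sections of \<open>F\<close> and \<open>G\<close> may have different types, which is
  what later allows a constant sheaf to be compared with a sheaf of sections.\<close>

lemma covers_isomorphic_etale_space:
  assumes F: "is_presheaf X F" and G: "is_presheaf X G" and "sheaves_isomorphic X F G"
  shows "covers_isomorphic (etale_space X F) (etale_space X G)"
proof -
  obtain \<alpha> \<beta> where \<alpha>: "\<alpha> \<in> sheaf_hom X F G" and \<beta>: "\<beta> \<in> sheaf_hom X G F"
    and eq: "sheaf_comp X F \<beta> \<alpha> = sheaf_id X F" "sheaf_comp X G \<alpha> \<beta> = sheaf_id X G"
    using assms(3) by (auto simp: sheaves_isomorphic_def)
  have "is_cover_iso (etale_space X F) (etale_space X G) (etale_map X F G \<alpha>)"
    unfolding is_cover_iso_def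
    using etale_map_hom[OF F G \<alpha>] etale_map_hom[OF G F \<beta>]
      etale_map_comp[OF F G F \<alpha> \<beta>] etale_map_comp[OF G F G \<beta> \<alpha>]
    by (auto simp: eq etale_map_id[OF F] etale_map_id[OF G])
  then show ?thesis by (auto simp: covers_isomorphic_def)
qed

section \<open>A sheaf is the sheaf of sections of its etale space\<close>

lemma sheaf_glue:
  assumes "is_sheaf X F" "\<And>U. U \<in> \<U> \<Longrightarrow> openin X U" "\<And>U. U \<in> \<U> \<Longrightarrow> s U \<in> sect F U"
    and "\<And>U V. U \<in> \<U> \<Longrightarrow> V \<in> \<U> \<Longrightarrow> res F U (U \<inter> V) (s U) = res F V (U \<inter> V) (s V)"
  obtains t where "t \<in> sect F (\<Union>\<U>)" "\<forall>U\<in>\<U>. res F (\<Union>\<U>) U t = s U"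
    "\<forall>r. r \<in> sect F (\<Union>\<U>) \<longrightarrow> (\<forall>U\<in>\<U>. res F (\<Union>\<U>) U r = s U) \<longrightarrow> r = t"
proof -
  have "\<exists>!t. t \<in> sect F (\<Union>\<U>) \<and> (\<forall>U\<in>\<U>. res F (\<Union>\<U>) U t = s U)"
    by (rule conjunct2[OF assms(1)[unfolded is_sheaf_def], rule_format])
      (intro conjI ballI assms(2-4))
  then obtain t where t: "t \<in> sect F (\<Union>\<U>) \<and> (\<forall>U\<in>\<U>. res F (\<Union>\<U>) U t = s U)"
    and unique: "\<forall>r. r \<in> sect F (\<Union>\<U>) \<and> (\<forall>U\<in>\<U>. res F (\<Union>\<U>) U r = s U) \<longrightarrow> r = t"
    by (rule ex1E)
  show ?thesis
    using unique by (intro that[of t] conjunct1[OF t] conjunct2[OF t]) simp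
qed

text \<open>Separatedness in terms of germs. Equal germs mean that \<open>s\<close> and
  \<open>t\<close> agree on open sets covering \<open>U\<close>, so both glue one and the same
  family of restrictions.\<close>

lemma sheaf_eqI:
  assumes F: "is_sheaf X F" and U: "openin X U" and s: "s \<in> sect F U" and t: "t \<in> sect F U"
    and eq: "\<And>x. x \<in> U \<Longrightarrow> germ X F x U s = germ X F x U t"
  shows "s = t"
proof -
  have pre: "is_presheaf X F" using F by (rule is_sheaf_is_presheaf)
  \<comment> \<open>Taking every open set of agreement, and not one for each point, avoids a choice;
    the restrictions of \<open>s\<close> are then trivially compatible.\<close>
  define \<U> where "\<U> = {W. openin X W \<and> W \<subseteq> U \<and> res F U W s = res F U W t}"
  have \<U>: "openin X W" "W \<subseteq> U" "res F U W s = res F U W t" if "W \<in> \<U>" for W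
    using that by (auto simp: \<U>_def)
  have un: "\<Union>\<U> = U"
  proof
    show "U \<subseteq> \<Union>\<U>"
    proof
      fix x assume x: "x \<in> U"
      show "x \<in> \<Union>\<U>"
        by (rule germ_eqE[OF eq[OF x] U x t]) (auto simp: \<U>_def)
    qed
  qed (auto simp: \<U>_def)
  have compat: "res F W (W \<inter> V) (res F U W s) = res F V (W \<inter> V) (res F U V s)"
    if "W \<in> \<U>" "V \<in> \<U>" for W V
    using \<U>(1,2)[OF that(1)] \<U>(1,2)[OF that(2)] presheaf_res_res[OF pre U _ _ _ _ s, of _ "W \<inter> V"]
    by (simp add: openin_Int)
  obtain r where "\<forall>q. q \<in> sect F (\<Union>\<U>) \<longrightarrow>
      (\<forall>W\<in>\<U>. res F (\<Union>\<U>) W q = res F U W s) \<longrightarrow> q = r"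
    by (rule sheaf_glue[OF F \<U>(1) presheaf_res_sect[OF pre U \<U>(1,2) s] compat])
  then have r: "q = r" if "q \<in> sect F U" "\<forall>W\<in>\<U>. res F U W q = res F U W s" for q
    unfolding un using that by blast
  have "s = r" using r s by simp
  moreover have "t = r" using r t \<U>(3) by simp
  ultimately show ?thesis by simp
qed

text \<open>For a presheaf this is the canonical map to its sheafification. It is made undefined off
  the open sets and off the sections, as \<open>sheaf_hom\<close> requires.\<close>

definition germ_map ::
  "'a topology \<Rightarrow> ('a, 'c) presheaf \<Rightarrow> 'a set \<Rightarrow> 'c \<Rightarrow> 'a \<Rightarrow> 'a \<times> ('a set \<times> 'c) set" where
  "germ_map X F = (\<lambda>U\<in>{U. openin X U}. \<lambda>s\<in>sect F U. germ_section X F U s)"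

lemma germ_map_apply: "openin X U \<Longrightarrow> s \<in> sect F U \<Longrightarrow> germ_map X F U s = germ_section X F U s"
  by (simp add: germ_map_def)

lemma germ_map_hom:
  assumes F: "is_presheaf X F"
  shows "germ_map X F \<in> sheaf_hom X F (section_sheaf X (etale_space X F))"
  unfolding germ_map_def
proof (rule sheaf_hom_restrictI)
  fix U s assume U: "openin X U" and s: "s \<in> sect F U"
  show "germ_section X F U s \<in> sect (section_sheaf X (etale_space X F)) U"
    using continuous_map_germ_section[OF F U s]
    by (auto simp: mem_section_sheaf) (simp add: germ_section_def)
  fix V assume V: "openin X V" "V \<subseteq> U"
  show "res F U V s \<in> sect F V" by (rule presheaf_res_sect[OF F U V s])
  show "germ_section X F V (res F U V s) =
      res (section_sheaf X (etale_space X F)) U V (germ_section X F U s)"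
    using V germ_res[OF F U V _ s] by (auto simp: germ_section_def fun_eq_iff)
qed

text \<open>The value at \<open>x\<close> is the germ of some section \<open>t\<close>. The germs of
  \<open>t\<close> form an open set, so by continuity \<open>\<sigma>\<close> stays among them near
  \<open>x\<close>; and within that set a point is determined by its projection.\<close>

lemma section_etale_space_locally_germ:
  assumes F: "is_presheaf X F" and U: "openin X U"
    and \<sigma>: "\<sigma> \<in> sect (section_sheaf X (etale_space X F)) U" and x: "x \<in> U"
  obtains W s where "openin X W" "W \<subseteq> U" "x \<in> W" "s \<in> sect F W"
    "\<forall>y\<in>W. \<sigma> y = (y, germ X F y W s)"
proof -
  have cont: "continuous_map (subtopology X U) (total (etale_space X F)) \<sigma>"
    and fst: "\<And>y. y \<in> U \<Longrightarrow> fst (\<sigma> y) = y"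
    using \<sigma> by (auto simp: mem_section_sheaf)
  obtain V t z where V: "openin X V" "t \<in> sect F V" "z \<in> V" "\<sigma> x = (z, germ X F z V t)"
    using section_topspace[OF U \<sigma> x] by (rule topspace_etale_spaceE)
  have z: "z = x" using fst[OF x] V by simp
  let ?W = "{y \<in> U. \<sigma> y \<in> germ_section X F V t ` V}"
  have \<sigma>W: "y \<in> V \<and> \<sigma> y = (y, germ X F y V t)" if "y \<in> ?W" for y
    using that fst[of y] by auto
  have "openin (subtopology X U) {y \<in> topspace (subtopology X U). \<sigma> y \<in> germ_section X F V t ` V}"
    by (rule openin_continuous_map_preimage[OF cont openin_germ_section_image[OF V(1,2)]])
  moreover have "topspace (subtopology X U) = U"
    using openin_subset[OF U] by auto
  ultimately have "openin (subtopology X U) ?W"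
    by (simp only:)
  then have W: "openin X ?W"
    using openin_open_subtopology[OF U] by blast
  have WV: "?W \<subseteq> V" using \<sigma>W by blast
  show ?thesis
  proof (rule that[OF W])
    have xV: "x \<in> V" using V(3) z by simp
    then have "\<sigma> x = germ_section X F V t x" using V(4) z by simp
    then show "x \<in> ?W" using x xV by blast
    show "res F V ?W t \<in> sect F ?W" by (rule presheaf_res_sect[OF F V(1) W WV V(2)])
    show "\<forall>y\<in>?W. \<sigma> y = (y, germ X F y ?W (res F V ?W t))"
    proof
      fix y assume y: "y \<in> ?W"
      show "\<sigma> y = (y, germ X F y ?W (res F V ?W t))"
        unfolding germ_res[OF F V(1) W WV y V(2)] using \<sigma>W[OF y] by blast
    qed
  qed blast
qed

text \<open>Injectivity is the uniqueness half of the sheaf axiom and surjectivity the existence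
  half: \<open>\<sigma>\<close> is given locally by sections of \<open>F\<close>, and these are
  glued.\<close>

lemma germ_map_iso:
  assumes F: "is_sheaf X F"
  shows "is_sheaf_iso X F (section_sheaf X (etale_space X F)) (germ_map X F)"
  unfolding is_sheaf_iso_def
proof (intro conjI allI impI)
  have pre: "is_presheaf X F" using F by (rule is_sheaf_is_presheaf)
  show hom: "germ_map X F \<in> sheaf_hom X F (section_sheaf X (etale_space X F))"
    by (rule germ_map_hom[OF pre])
  fix U assume U: "openin X U"
  show "bij_betw (germ_map X F U) (sect F U) (sect (section_sheaf X (etale_space X F)) U)"
  proof (rule bij_betw_imageI)
    show "inj_on (germ_map X F U) (sect F U)"
    proof (rule inj_onI)
      fix s t assume s: "s \<in> sect F U" and t: "t \<in> sect F U"
        and "germ_map X F U s = germ_map X F U t"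
      then have eq: "germ_section X F U s = germ_section X F U t"
        by (simp add: germ_map_apply U)
      have "germ X F x U s = germ X F x U t" if "x \<in> U" for x
        using fun_cong[OF eq, of x] that by simp
      then show "s = t" by (rule sheaf_eqI[OF F U s t])
    qed
    show "germ_map X F U ` sect F U = sect (section_sheaf X (etale_space X F)) U"
    proof (intro subset_antisym subsetI)
      fix \<sigma> assume \<sigma>: "\<sigma> \<in> sect (section_sheaf X (etale_space X F)) U"
      define \<U> where "\<U> = {W. openin X W \<and> W \<subseteq> U \<and>
        (\<exists>s\<in>sect F W. \<forall>y\<in>W. \<sigma> y = (y, germ X F y W s))}"
      have un: "\<Union>\<U> = U"
      proof
        show "U \<subseteq> \<Union>\<U>"
        proof
          fix x assume "x \<in> U"
          then obtain W s where "openin X W" "W \<subseteq> U" "x \<in> W" "s \<in> sect F W"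
            "\<forall>y\<in>W. \<sigma> y = (y, germ X F y W s)"
            by (rule section_etale_space_locally_germ[OF pre U \<sigma>])
          then show "x \<in> \<Union>\<U>"
            unfolding \<U>_def by blast
        qed
      qed (auto simp: \<U>_def)
      have op: "openin X W" "W \<subseteq> U" if "W \<in> \<U>" for W
        using that by (auto simp: \<U>_def)
      have "\<forall>W\<in>\<U>. \<exists>s. s \<in> sect F W \<and> (\<forall>y\<in>W. \<sigma> y = (y, germ X F y W s))"
        by (auto simp: \<U>_def)
      then obtain s where s: "\<And>W. W \<in> \<U> \<Longrightarrow> s W \<in> sect F W"
        and \<sigma>s: "\<And>W y. W \<in> \<U> \<Longrightarrow> y \<in> W \<Longrightarrow> \<sigma> y = (y, germ X F y W (s W))"
        by metis
      \<comment> \<open>Different local sections representing \<open>\<sigma>\<close> have the same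
        germs on the overlap, namely the values of \<open>\<sigma>\<close>, and so are equal there
        by separatedness.\<close>
      have compat: "res F W (W \<inter> V) (s W) = res F V (W \<inter> V) (s V)" if W: "W \<in> \<U>" and V: "V \<in> \<U>" for W V
      proof -
        have WV: "openin X (W \<inter> V)" using op W V by blast
        show ?thesis
        proof (rule sheaf_eqI[OF F WV])
          show "res F W (W \<inter> V) (s W) \<in> sect F (W \<inter> V)" "res F V (W \<inter> V) (s V) \<in> sect F (W \<inter> V)"
            using presheaf_res_sect[OF pre] op s W V WV by auto
          fix y assume y: "y \<in> W \<inter> V"
          have "germ X F y W (s W) = germ X F y V (s V)"
            using \<sigma>s[OF W, of y] \<sigma>s[OF V, of y] y by simp
          then show "germ X F y (W \<inter> V) (res F W (W \<inter> V) (s W)) = germ X F y (W \<inter> V) (res F V (W \<inter> V) (s V))"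
            using germ_res[OF pre op(1)[OF W] WV _ y s[OF W]] germ_res[OF pre op(1)[OF V] WV _ y s[OF V]]
            by simp
        qed
      qed
      obtain t where "t \<in> sect F (\<Union>\<U>)" "\<forall>W\<in>\<U>. res F (\<Union>\<U>) W t = s W"
        by (rule sheaf_glue[OF F op(1) s compat])
      then have t: "t \<in> sect F U" "\<forall>W\<in>\<U>. res F U W t = s W"
        unfolding un by auto
      have "germ_section X F U t = \<sigma>"
      proof (rule extensionalityI[of _ U])
        fix x assume x: "x \<in> U"
        then obtain W where W: "W \<in> \<U>" "x \<in> W" using un by blast
        show "germ_section X F U t x = \<sigma> x"
          using x \<sigma>s[OF W] germ_res[OF pre U op[OF W(1)] W(2) t(1)] t(2) W(1) by simp
      qed (use \<sigma> in \<open>auto simp: mem_section_sheaf germ_section_def\<close>)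
      then show "\<sigma> \<in> germ_map X F U ` sect F U"
        using t(1) by (auto simp: germ_map_apply U)
    qed (use sheaf_hom_sect[OF hom U] in auto)
  qed
qed

text \<open>Either way round, the section \<open>s\<close> becomes the family of germs of
  \<open>\<alpha> U s\<close>.\<close>

lemma germ_map_natural:
  assumes F: "is_presheaf X F" and G: "is_presheaf X G" and \<alpha>: "\<alpha> \<in> sheaf_hom X F G"
    and U: "openin X U" "s \<in> sect F U"
  shows "section_map X (etale_space X F) (etale_map X F G \<alpha>) U (germ_map X F U s) =
    germ_map X G U (\<alpha> U s)"
proof -
  have "germ_section X F U s \<in> sect (section_sheaf X (etale_space X F)) U"
    using sheaf_hom_sect[OF germ_map_hom[OF F] U] by (simp add: germ_map_apply U)
  then show ?thesis
    using sheaf_hom_sect[OF \<alpha> U]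
    by (auto simp: germ_map_apply U section_map_apply etale_map_germ[OF F G \<alpha> U] fun_eq_iff
        germ_section_def)
qed

section \<open>A cover is the etale space of its sheaf of sections\<close>

text \<open>The generality in which evaluation of germs is an isomorphism. It includes both covers
  and \<open>trivial_cover X I\<close>, and for the latter it is quickly checked. The image of
  \<open>V\<close> has to be open so that local inverses are sections over open sets.\<close>

definition is_local_homeomorphism :: "'a topology \<Rightarrow> ('a, 'b) over_space \<Rightarrow> bool" where
  "is_local_homeomorphism X Y \<longleftrightarrow> continuous_map (total Y) X (proj Y) \<and>
     (\<forall>y\<in>topspace (total Y). \<exists>V. openin (total Y) V \<and> y \<in> V \<and> openin X (proj Y ` V) \<and>
        homeomorphic_map (subtopology (total Y) V) (subtopology X (proj Y ` V)) (proj Y))"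

text \<open>The sheet through \<open>y\<close> serves as neighbourhood, since it projects onto the
  whole evenly covered set.\<close>

lemma is_cover_imp_local_homeomorphism:
  assumes Y: "is_cover X Y"
  shows "is_local_homeomorphism X Y"
  unfolding is_local_homeomorphism_def
proof (intro conjI ballI)
  show cont: "continuous_map (total Y) X (proj Y)"
    using Y by (simp add: is_cover_def)
  fix y assume y: "y \<in> topspace (total Y)"
  then have "proj Y y \<in> topspace X"
    using continuous_map_funspace[OF cont] by auto
  then obtain U V where U: "openin X U"
    and V: "\<forall>z\<in>{z \<in> topspace (total Y). proj Y z = proj Y y}. openin (total Y) (V z) \<and> z \<in> V z \<and>
      homeomorphic_map (subtopology (total Y) (V z)) (subtopology X U) (proj Y)"
    by (rule is_coverE[OF Y])
  have Vy: "openin (total Y) (V y)" "y \<in> V y"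
    "homeomorphic_map (subtopology (total Y) (V y)) (subtopology X U) (proj Y)"
    using V y by auto
  have "proj Y ` V y = U"
    using homeomorphic_imp_surjective_map[OF Vy(3)] openin_subset[OF U] openin_subset[OF Vy(1)]
    by (simp add: Int_absorb1)
  then show "\<exists>V. openin (total Y) V \<and> y \<in> V \<and> openin X (proj Y ` V) \<and>
      homeomorphic_map (subtopology (total Y) V) (subtopology X (proj Y ` V)) (proj Y)"
    using U Vy by (intro exI[of _ "V y"]) simp
qed

text \<open>The section is the inverse of the projection on a small neighbourhood of
  \<open>y\<close>. Injectivity of the projection there is recorded as well, because it is what
  forces two local lifts inside \<open>V\<close> to coincide.\<close>

lemma local_section:
  assumes Y: "is_local_homeomorphism X Y" and y: "y \<in> topspace (total Y)"
  obtains V s where "openin (total Y) V" "y \<in> V" "openin X (proj Y ` V)" "inj_on (proj Y) V"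
    "s \<in> sect (section_sheaf X Y) (proj Y ` V)" "s (proj Y y) = y"
proof -
  have "\<exists>V. openin (total Y) V \<and> y \<in> V \<and> openin X (proj Y ` V) \<and>
      homeomorphic_map (subtopology (total Y) V) (subtopology X (proj Y ` V)) (proj Y)"
    using Y y by (simp add: is_local_homeomorphism_def)
  then obtain V where V: "openin (total Y) V" "y \<in> V" "openin X (proj Y ` V)"
    and hom: "homeomorphic_map (subtopology (total Y) V) (subtopology X (proj Y ` V)) (proj Y)"
    by (elim exE conjE)
  obtain g where g: "homeomorphic_maps (subtopology (total Y) V) (subtopology X (proj Y ` V)) (proj Y) g"
    using hom by (auto simp: homeomorphic_map_maps)
  have top: "topspace (subtopology (total Y) V) = V" "topspace (subtopology X (proj Y ` V)) = proj Y ` V"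
    using openin_subset[OF V(1)] openin_subset[OF V(3)] by auto
  have g1: "g (proj Y v) = v" if "v \<in> V" for v
    using g that unfolding homeomorphic_maps_def top by blast
  have g2: "proj Y (g x) = x" if "x \<in> proj Y ` V" for x
    using g that unfolding homeomorphic_maps_def top by blast
  have "continuous_map (subtopology X (proj Y ` V)) (subtopology (total Y) V) g"
    using g by (simp add: homeomorphic_maps_def)
  then have "continuous_map (subtopology X (proj Y ` V)) (total Y) g"
    by (rule continuous_map_into_fulltopology)
  then have "continuous_map (subtopology X (proj Y ` V)) (total Y) (restrict g (proj Y ` V))"
    by (rule continuous_map_eq) (simp add: top)
  then have s: "restrict g (proj Y ` V) \<in> sect (section_sheaf X Y) (proj Y ` V)"
    using g2 by (simp add: mem_section_sheaf)
  have inj: "inj_on (proj Y) V"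
    using g1 by (rule inj_on_inverseI)
  show ?thesis
    by (rule that[OF V inj s]) (simp add: g1 V(2))
qed

text \<open>Near \<open>x\<close> both sections run through a set \<open>N\<close> on which the
  projection is injective, and over each point their values have the same projection.\<close>

lemma openin_sections_agree:
  assumes Y: "is_local_homeomorphism X Y" and U: "openin X U" and V: "openin X V"
    and s: "s \<in> sect (section_sheaf X Y) U" and t: "t \<in> sect (section_sheaf X Y) V"
    and x: "x \<in> U" "x \<in> V" "s x = t x"
  obtains W where "openin X W" "x \<in> W" "W \<subseteq> U" "W \<subseteq> V" "\<forall>y\<in>W. s y = t y"
proof -
  obtain N where N: "openin (total Y) N" "s x \<in> N" "inj_on (proj Y) N"
    by (rule local_section[OF Y section_topspace[OF U s x(1)]])
  have pre: "openin X {y \<in> W. r y \<in> N}" if W: "openin X W" and r: "r \<in> sect (section_sheaf X Y) W" for W r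
  proof -
    have "openin (subtopology X W) {y \<in> topspace (subtopology X W). r y \<in> N}"
      using r by (intro openin_continuous_map_preimage[OF _ N(1)]) (simp add: mem_section_sheaf)
    moreover have "topspace (subtopology X W) = W"
      using openin_subset[OF W] by auto
    ultimately have "openin (subtopology X W) {y \<in> W. r y \<in> N}"
      by (simp only:)
    then show ?thesis
      using openin_open_subtopology[OF W] by blast
  qed
  let ?W = "{y \<in> U. s y \<in> N} \<inter> {y \<in> V. t y \<in> N}"
  have "s y = t y" if "y \<in> ?W" for y
  proof (rule inj_onD[OF N(3)])
    show "proj Y (s y) = proj Y (t y)"
      using that s t by (simp add: mem_section_sheaf)
  qed (use that in auto)
  then show ?thesis
    using x N(2) by (intro that[OF openin_Int[OF pre[OF U s] pre[OF V t]]]) auto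
qed

text \<open>The representative is chosen arbitrarily, which does no harm: any two agree on a
  neighbourhood of the base point and so have the same value at it.\<close>

definition germ_value ::
  "'a topology \<Rightarrow> ('a, 'b) over_space \<Rightarrow> 'a \<times> ('a set \<times> ('a \<Rightarrow> 'b)) set \<Rightarrow> 'b" where
  "germ_value X Y = (\<lambda>(x, g)\<in>topspace (total (etale_space X (section_sheaf X Y))).
     snd (SOME p. p \<in> g) x)"

lemma germ_value_germ:
  assumes U: "openin X U" "s \<in> sect (section_sheaf X Y) U" "x \<in> U"
  shows "germ_value X Y (x, germ X (section_sheaf X Y) x U s) = s x"
proof -
  let ?g = "germ X (section_sheaf X Y) x U s"
  have "(SOME p. p \<in> ?g) \<in> ?g"
    using germ_self[OF U(1,3,2)] by (rule someI)
  moreover obtain V t where Vt: "(SOME p. p \<in> ?g) = (V, t)"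
    by fastforce
  ultimately have "(V, t) \<in> ?g" by simp
  then obtain W where "x \<in> W" "restrict s W = restrict t W"
    unfolding mem_germ by auto
  then have "t x = s x"
    by (metis restrict_apply')
  then show ?thesis
    using U Vt by (simp add: germ_value_def topspace_etale_spaceI)
qed

lemma germ_value_hom: "germ_value X Y \<in> cover_hom (etale_space X (section_sheaf X Y)) Y"
proof -
  let ?E = "etale_space X (section_sheaf X Y)"
  have "continuous_map (total ?E) (total Y) (germ_value X Y)"
  proof (rule continuous_map_from_etale_space[OF is_presheaf_section_sheaf])
    fix U s assume U: "openin X U" "s \<in> sect (section_sheaf X Y) U"
    have "continuous_map (subtopology X U) (total Y) s"
      using U(2) by (simp add: mem_section_sheaf)
    then show "continuous_map (subtopology X U) (total Y)
        (\<lambda>x. germ_value X Y (x, germ X (section_sheaf X Y) x U s))"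
      by (rule continuous_map_eq) (simp add: germ_value_germ[OF U])
  qed
  moreover have "proj Y (germ_value X Y p) = fst p" if "p \<in> topspace (total ?E)" for p
    using that by (auto elim!: topspace_etale_spaceE simp: germ_value_germ)
      (simp add: mem_section_sheaf)
  ultimately show ?thesis
    by (simp add: cover_hom_def) (simp add: germ_value_def)
qed

text \<open>Surjectivity is the existence of local sections through every point, and injectivity is
  the local agreement of sections that share a value. Openness holds because the values of a section
  near a point fill a neighbourhood in \<open>Y\<close>.\<close>

lemma germ_value_iso:
  assumes Y: "is_local_homeomorphism X Y"
  shows "is_cover_iso (etale_space X (section_sheaf X Y)) Y (germ_value X Y)"
  unfolding cover_iso_iff_homeomorphic_map
proof (intro conjI germ_value_hom bijective_open_imp_homeomorphic_map)
  let ?S = "section_sheaf X Y" and ?E = "etale_space X (section_sheaf X Y)"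
  note hom = cover_homD[OF germ_value_hom[of X Y]]
  show "continuous_map (total ?E) (total Y) (germ_value X Y)" by (rule hom(1))
  have cont: "continuous_map (total Y) X (proj Y)"
    using Y by (simp add: is_local_homeomorphism_def)
  show "germ_value X Y ` topspace (total ?E) = topspace (total Y)"
  proof (intro subset_antisym subsetI)
    fix y assume y: "y \<in> topspace (total Y)"
    obtain V s where V: "openin (total Y) V" "y \<in> V" "openin X (proj Y ` V)"
      and s: "s \<in> sect ?S (proj Y ` V)" "s (proj Y y) = y"
      by (rule local_section[OF Y y])
    have x: "proj Y y \<in> proj Y ` V" using V(2) by (rule imageI)
    show "y \<in> germ_value X Y ` topspace (total ?E)"
      using germ_value_germ[OF V(3) s(1) x] s(2) topspace_etale_spaceI[OF V(3) s(1) x]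
      by (metis image_eqI)
  qed (use hom(3) in auto)
  show "inj_on (germ_value X Y) (topspace (total ?E))"
  proof (rule inj_onI)
    fix p q assume p: "p \<in> topspace (total ?E)" and q: "q \<in> topspace (total ?E)"
      and eq: "germ_value X Y p = germ_value X Y q"
    obtain U s x where U: "openin X U" "s \<in> sect ?S U" "x \<in> U" and ps: "p = (x, germ X ?S x U s)"
      using p by (rule topspace_etale_spaceE)
    obtain V t z where V: "openin X V" "t \<in> sect ?S V" "z \<in> V" and qt: "q = (z, germ X ?S z V t)"
      using q by (rule topspace_etale_spaceE)
    have st: "s x = t z"
      using eq unfolding ps qt germ_value_germ[OF U] germ_value_germ[OF V] .
    have "proj Y (s x) = x" "proj Y (t z) = z"
      using U V by (auto simp: mem_section_sheaf)
    then have z: "z = x" using st by simp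
    have xV: "x \<in> V" and st': "s x = t x" using V(3) st z by auto
    obtain W where W: "openin X W" "x \<in> W" "W \<subseteq> U" "W \<subseteq> V" and agree: "\<forall>y\<in>W. s y = t y"
      by (rule openin_sections_agree[OF Y U(1) V(1) U(2) V(2) U(3) xV st'])
    have "res ?S U W s = res ?S V W t"
      using agree by (auto intro: restrict_ext)
    then have "germ X ?S x U s = germ X ?S x V t"
      by (rule germ_eqI[OF is_presheaf_section_sheaf U(1,2) V(1,2) W])
    then show "p = q" unfolding ps qt z by simp
  qed
  show "open_map (total ?E) (total Y) (germ_value X Y)"
    unfolding open_map_def
  proof (intro allI impI)
    fix A assume A: "openin (total ?E) A"
    show "openin (total Y) (germ_value X Y ` A)"
    proof (subst openin_subopen, intro ballI)
      fix y assume "y \<in> germ_value X Y ` A"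
      then obtain p where p: "p \<in> A" "y = germ_value X Y p" by blast
      have "p \<in> topspace (total ?E)" using p(1) openin_subset[OF A] by blast
      then obtain U s x where U: "openin X U" "s \<in> sect ?S U" "x \<in> U" and ps: "p = (x, germ X ?S x U s)"
        by (rule topspace_etale_spaceE)
      have y: "y = s x" unfolding p(2) ps by (rule germ_value_germ[OF U])
      obtain V where V: "openin (total Y) V" "s x \<in> V" "inj_on (proj Y) V"
        by (rule local_section[OF Y section_topspace[OF U]])
      let ?N = "{z \<in> U. (z, germ X ?S z U s) \<in> A}"
      have N: "openin X ?N"
        using A openin_etale_space_iff[OF is_presheaf_section_sheaf] U by blast
      have topU: "topspace (subtopology X U) = U"
        using openin_subset[OF U(1)] by auto
      have "openin (subtopology X U) {z \<in> topspace (subtopology X U). s z \<in> V}"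
        using U(2) by (intro openin_continuous_map_preimage[OF _ V(1)]) (simp add: mem_section_sheaf)
      then have M: "openin X {z \<in> U. s z \<in> V}"
        unfolding topU using openin_open_subtopology[OF U(1)] by blast
      \<comment> \<open>Points of \<open>V\<close> over those z at which the germ of
        \<open>s\<close> lies in \<open>A\<close> and s z lies in \<open>V\<close>. The projection
        is injective on \<open>V\<close>, so a point v of this set equals the value of
        \<open>s\<close> below it and is therefore the value of a germ in \<open>A\<close>.\<close>
      let ?T = "V \<inter> {v \<in> topspace (total Y). proj Y v \<in> ?N \<inter> {z \<in> U. s z \<in> V}}"
      have "openin (total Y) ?T"
        by (intro openin_Int V(1) openin_continuous_map_preimage[OF cont] N M)
      moreover have "proj Y (s x) = x"
        using U by (simp add: mem_section_sheaf)
      then have "y \<in> ?T"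
        using y V(2) U(3) section_topspace[OF U] p(1) ps by simp
      moreover have "?T \<subseteq> germ_value X Y ` A"
      proof
        fix v assume v: "v \<in> ?T"
        let ?z = "proj Y v"
        have z: "?z \<in> U" "s ?z \<in> V" "(?z, germ X ?S ?z U s) \<in> A" "v \<in> V" using v by auto
        have "proj Y (s ?z) = ?z" using z(1) U(2) by (simp add: mem_section_sheaf)
        then have "s ?z = v" by (rule inj_onD[OF V(3) _ z(2,4)])
        then have "v = germ_value X Y (?z, germ X ?S ?z U s)"
          using germ_value_germ[OF U(1,2) z(1)] by simp
        then show "v \<in> germ_value X Y ` A" using z(3) by (rule image_eqI)
      qed
      ultimately show "\<exists>T. openin (total Y) T \<and> y \<in> T \<and> T \<subseteq> germ_value X Y ` A" by blast
    qed
  qed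
qed

text \<open>Both sides take the germ of \<open>s\<close> at \<open>x\<close> to \<phi> (s
  x).\<close>

lemma germ_value_natural:
  assumes \<phi>: "\<phi> \<in> cover_hom Y Z" and p: "p \<in> topspace (total (etale_space X (section_sheaf X Y)))"
  shows "germ_value X Z (etale_map X (section_sheaf X Y) (section_sheaf X Z) (section_map X Y \<phi>) p) =
    \<phi> (germ_value X Y p)"
proof -
  obtain U s x where U: "openin X U" "s \<in> sect (section_sheaf X Y) U" "x \<in> U"
    and ps: "p = (x, germ X (section_sheaf X Y) x U s)"
    using p by (rule topspace_etale_spaceE)
  note h = section_map_hom[OF \<phi>, of X]
  show ?thesis
    unfolding ps etale_map_germ[OF is_presheaf_section_sheaf is_presheaf_section_sheaf h U]
      germ_value_germ[OF U] germ_value_germ[OF U(1) sheaf_hom_sect[OF h U(1,2)] U(3)]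
    by (simp add: section_map_apply U)
qed

section \<open>Covers and local constancy\<close>

lemma continuous_map_discrete_topology:
  "continuous_map X (discrete_topology S) f \<longleftrightarrow>
     f \<in> topspace X \<rightarrow> S \<and> (\<forall>c\<in>S. openin X {x \<in> topspace X. f x = c})"
proof
  assume f: "continuous_map X (discrete_topology S) f"
  have "openin X {x \<in> topspace X. f x \<in> {c}}" if "c \<in> S" for c
    using that by (intro openin_continuous_map_preimage[OF f]) simp
  then show "f \<in> topspace X \<rightarrow> S \<and> (\<forall>c\<in>S. openin X {x \<in> topspace X. f x = c})"
    using continuous_map_funspace[OF f] by simp
next
  assume f: "f \<in> topspace X \<rightarrow> S \<and> (\<forall>c\<in>S. openin X {x \<in> topspace X. f x = c})"
  have "openin X {x \<in> topspace X. f x \<in> A}" if "A \<subseteq> S" for A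
  proof -
    have "openin X (\<Union>c\<in>A. {x \<in> topspace X. f x = c})"
      using f that by (intro openin_Union) auto
    moreover have "{x \<in> topspace X. f x \<in> A} = (\<Union>c\<in>A. {x \<in> topspace X. f x = c})" by blast
    ultimately show ?thesis by simp
  qed
  then show "continuous_map X (discrete_topology S) f"
    using f by (simp add: continuous_map_def)
qed

lemma openin_locally_constant_level:
  assumes U: "openin X U" and f: "f \<in> sect (constant_sheaf X S) U"
  shows "f \<in> U \<rightarrow> S" and "c \<in> S \<Longrightarrow> openin X {x \<in> U. f x = c}"
proof -
  have top: "topspace (subtopology X U) = U"
    using openin_subset[OF U] by auto
  have f': "f \<in> U \<rightarrow> S \<and> (\<forall>c\<in>S. openin (subtopology X U) {x \<in> U. f x = c})"
    using f unfolding mem_constant_sheaf continuous_map_discrete_topology top by blast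
  then show "f \<in> U \<rightarrow> S" by blast
  show "openin X {x \<in> U. f x = c}" if "c \<in> S"
    using f' that openin_open_subtopology[OF U] by blast
qed

lemma mem_constant_sheafI:
  assumes U: "openin X U" and "f \<in> extensional U" "f \<in> U \<rightarrow> S"
    and op: "\<And>c. c \<in> S \<Longrightarrow> openin X {x \<in> U. f x = c}"
  shows "f \<in> sect (constant_sheaf X S) U"
proof -
  have top: "topspace (subtopology X U) = U"
    using openin_subset[OF U] by auto
  have "openin (subtopology X U) {x \<in> U. f x = c}" if "c \<in> S" for c
    using op[OF that] openin_open_subtopology[OF U] by blast
  then show ?thesis
    using assms(2,3) unfolding mem_constant_sheaf continuous_map_discrete_topology top by blast
qed

text \<open>Lets the constant sheaf on the subspace be treated as the one on \<open>X\<close>, so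
  that level sets are open in \<open>X\<close> itself.\<close>

lemma constant_sheaf_subtopology:
  "W \<subseteq> U \<Longrightarrow> sect (constant_sheaf (subtopology X U) S) W = sect (constant_sheaf X S) W"
  by (simp add: constant_sheaf_def subtopology_subtopology_subset)

text \<open>Over an evenly covered set, a section is determined by the sheet it runs through at each
  point. The sheets are indexed by the points of a fibre, made into constant functions only to
  have the type of sections.\<close>

lemma evenly_covered_section_sheaf_constant:
  fixes Y :: "('a, 'b) over_space"
  assumes U: "openin X U"
    and V: "\<And>y. y \<in> J \<Longrightarrow> openin (total Y) (V y)"
      "\<And>y. y \<in> J \<Longrightarrow> homeomorphic_map (subtopology (total Y) (V y)) (subtopology X U) (proj Y)"
    and disj: "disjoint_family_on V J"
    and un: "{y \<in> topspace (total Y). proj Y y \<in> U} = (\<Union>y\<in>J. V y)"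
  shows "sheaves_isomorphic (subtopology X U) (section_sheaf X Y)
    (constant_sheaf (subtopology X U) ((\<lambda>y (_ :: 'a). y) ` J))"
proof -
  let ?S = "(\<lambda>y (_ :: 'a). y) ` J"
  let ?XU = "subtopology X U"
  \<comment> \<open>The index of the sheet containing \<open>v\<close>; disjointness of the sheets
    makes the description unique.\<close>
  define i where "i v = (THE y. y \<in> J \<and> v \<in> V y)" for v
  have i: "i v = y" if "y \<in> J" "v \<in> V y" for y v
    unfolding i_def using that disj by (intro the_equality) (auto simp: disjoint_family_on_def)
  have "\<exists>g. homeomorphic_maps (subtopology (total Y) (V y)) ?XU (proj Y) g" if "y \<in> J" for y
    using V(2)[OF that] by (simp add: homeomorphic_map_maps)
  then obtain g where g: "\<And>y. y \<in> J \<Longrightarrow> homeomorphic_maps (subtopology (total Y) (V y)) ?XU (proj Y) (g y)"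
    by metis
  have topU: "topspace ?XU = U"
    using openin_subset[OF U] by auto
  have topV: "topspace (subtopology (total Y) (V y)) = V y" if "y \<in> J" for y
    using openin_subset[OF V(1)[OF that]] by auto
  have g1: "g y (proj Y v) = v" if "y \<in> J" "v \<in> V y" for y v
    using g[OF that(1)] that(2) unfolding homeomorphic_maps_def topV[OF that(1)] by blast
  have g2: "proj Y (g y x) = x" if "y \<in> J" "x \<in> U" for y x
    using g[OF that(1)] that(2) unfolding homeomorphic_maps_def topU by blast
  have cont_g: "continuous_map ?XU (subtopology (total Y) (V y)) (g y)" if "y \<in> J" for y
    using g[OF that] by (simp add: homeomorphic_maps_def)
  have gV: "g y x \<in> V y" if "y \<in> J" "x \<in> U" for y x
    using continuous_map_funspace[OF cont_g[OF that(1)]] that(2) unfolding topV[OF that(1)] topU by blast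
  have W: "openin X W \<and> W \<subseteq> U" if "openin ?XU W" for W
    using that openin_open_subtopology[OF U] by blast
  have sheet: "\<exists>y\<in>J. s x \<in> V y" if "openin X W" "W \<subseteq> U" "s \<in> sect (section_sheaf X Y) W" "x \<in> W" for W s x
  proof -
    have "s x \<in> {y \<in> topspace (total Y). proj Y y \<in> U}"
      using that section_topspace[OF that(1,3,4)] by (auto simp: mem_section_sheaf)
    then show ?thesis unfolding un by blast
  qed
  define \<alpha> where "\<alpha> W s = (\<lambda>x\<in>W. \<lambda>_ :: 'a. i (s x))" for W and s :: "'a \<Rightarrow> 'b"
  have \<alpha>_sect: "\<alpha> W s \<in> sect (constant_sheaf ?XU ?S) W"
    if W: "openin X W" "W \<subseteq> U" and s: "s \<in> sect (section_sheaf X Y) W" for W s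
    unfolding constant_sheaf_subtopology[OF W(2)]
  proof (rule mem_constant_sheafI[OF W(1)])
    show "\<alpha> W s \<in> extensional W" by (simp add: \<alpha>_def)
    show "\<alpha> W s \<in> W \<rightarrow> ?S"
    proof
      fix x assume x: "x \<in> W"
      then obtain y where "y \<in> J" "s x \<in> V y" using sheet[OF W s] by blast
      then show "\<alpha> W s x \<in> ?S" using x i by (simp add: \<alpha>_def)
    qed
    fix c assume "c \<in> ?S"
    then obtain y where y: "y \<in> J" and c: "c = (\<lambda>_. y)" by blast
    \<comment> \<open>The level set belonging to \<open>y\<close> is the set of points where
      \<open>s\<close> runs through the sheet \<open>V y\<close>; it is open because sheets are open
      and \<open>s\<close> is continuous.\<close>
    have "\<alpha> W s x = c \<longleftrightarrow> s x \<in> V y" if x: "x \<in> W" for x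
    proof -
      obtain z where z: "z \<in> J" "s x \<in> V z" using sheet[OF W s x] by blast
      have "\<alpha> W s x = c \<longleftrightarrow> z = y"
        using x i[OF z] by (simp add: \<alpha>_def c fun_eq_iff)
      also have "\<dots> \<longleftrightarrow> s x \<in> V y"
        using z y i by auto
      finally show ?thesis .
    qed
    then have eq: "{x \<in> W. \<alpha> W s x = c} = {x \<in> W. s x \<in> V y}" by blast
    have "openin (subtopology X W) {x \<in> topspace (subtopology X W). s x \<in> V y}"
      using s by (intro openin_continuous_map_preimage[OF _ V(1)[OF y]]) (simp add: mem_section_sheaf)
    moreover have "topspace (subtopology X W) = W"
      using openin_subset[OF W(1)] by auto
    ultimately have "openin (subtopology X W) {x \<in> W. s x \<in> V y}"
      by (simp only:)
    then show "openin X {x \<in> W. \<alpha> W s x = c}"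
      unfolding eq using openin_open_subtopology[OF W(1)] by blast
  qed
  define a where "a = (\<lambda>W\<in>{W. openin ?XU W}. \<lambda>s\<in>sect (section_sheaf X Y) W. \<alpha> W s)"
  have hom: "a \<in> sheaf_hom ?XU (section_sheaf X Y) (constant_sheaf ?XU ?S)"
    unfolding a_def
  proof (rule sheaf_hom_restrictI)
    fix A s assume A: "openin ?XU A" and s: "s \<in> sect (section_sheaf X Y) A"
    show "\<alpha> A s \<in> sect (constant_sheaf ?XU ?S) A"
      using W[OF A] s \<alpha>_sect by blast
    fix B assume B: "openin ?XU B" "B \<subseteq> A"
    show "res (section_sheaf X Y) A B s \<in> sect (section_sheaf X Y) B"
      using restrict_section[OF s B(2)] by simp
    show "\<alpha> B (res (section_sheaf X Y) A B s) = res (constant_sheaf ?XU ?S) A B (\<alpha> A s)"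
      using B(2) by (auto simp: \<alpha>_def fun_eq_iff)
  qed
  have "bij_betw (a A) (sect (section_sheaf X Y) A) (sect (constant_sheaf ?XU ?S) A)"
    if A: "openin ?XU A" for A
  proof (rule bij_betw_imageI)
    have AX: "openin X A" "A \<subseteq> U" using W[OF A] by auto
    have topA: "topspace (subtopology X A) = A" using openin_subset[OF AX(1)] by auto
    have a: "a A s = \<alpha> A s" if "s \<in> sect (section_sheaf X Y) A" for s
      using A that by (simp add: a_def)
    show "inj_on (a A) (sect (section_sheaf X Y) A)"
    proof (rule inj_onI)
      fix s t assume s: "s \<in> sect (section_sheaf X Y) A" and t: "t \<in> sect (section_sheaf X Y) A"
        and eq: "a A s = a A t"
      show "s = t"
      proof (rule extensionalityI[of _ A])
        fix x assume x: "x \<in> A"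
        obtain y where y: "y \<in> J" "s x \<in> V y" using sheet[OF AX s x] by blast
        obtain z where z: "z \<in> J" "t x \<in> V z" using sheet[OF AX t x] by blast
        have "\<alpha> A s x = \<alpha> A t x" using eq unfolding a[OF s] a[OF t] by simp
        then have "y = z"
          using x i[OF y] i[OF z] by (simp add: \<alpha>_def fun_eq_iff)
        moreover have "proj Y (s x) = proj Y (t x)"
          using s t x by (simp add: mem_section_sheaf)
        ultimately show "s x = t x"
          using g1[OF y] g1[OF z] by metis
      qed (use s t in \<open>simp_all add: mem_section_sheaf\<close>)
    qed
    show "a A ` sect (section_sheaf X Y) A = sect (constant_sheaf ?XU ?S) A"
    proof (intro subset_antisym subsetI)
      fix f assume "f \<in> sect (constant_sheaf ?XU ?S) A"
      then have f: "f \<in> sect (constant_sheaf X ?S) A"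
        unfolding constant_sheaf_subtopology[OF AX(2)] .
      have fA: "f x \<in> ?S" if "x \<in> A" for x
        using openin_locally_constant_level(1)[OF AX(1) f] that by blast
      \<comment> \<open>Values of \<open>f\<close> are constant functions, so evaluation at any
        argument, here \<open>undefined\<close>, recovers the index of the sheet.\<close>
      define q where "q x = f x undefined" for x
      have q: "q x \<in> J" "f x = (\<lambda>_. q x)" if "x \<in> A" for x
        using fA[OF that] by (auto simp: q_def)
      \<comment> \<open>The section that follows, at each point, the sheet named by
        \<open>f\<close>. On a level set of \<open>q\<close> it is the continuous inverse of one
        sheet, and distinct level sets are disjoint, so pasting applies.\<close>
      define s where "s = (\<lambda>x\<in>A. g (q x) x)"
      have "continuous_map (subtopology X A) (total Y) s"
      proof (rule pasting_lemma[where I=J and T="\<lambda>y. {x \<in> A. q x = y}" and f=g])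
        fix y assume y: "y \<in> J"
        have "{x \<in> A. q x = y} = {x \<in> A. f x = (\<lambda>_. y)}"
          using q by (auto simp: fun_eq_iff)
        then have op: "openin X {x \<in> A. q x = y}"
          using openin_locally_constant_level(2)[OF AX(1) f] y by simp
        then show "openin (subtopology X A) {x \<in> A. q x = y}"
          using openin_open_subtopology[OF AX(1)] by blast
        have "continuous_map (subtopology ?XU {x \<in> A. q x = y}) (total Y) (g y)"
          by (rule continuous_map_from_subtopology[OF continuous_map_into_fulltopology[OF cont_g[OF y]]])
        moreover have "subtopology ?XU {x \<in> A. q x = y} = subtopology (subtopology X A) {x \<in> A. q x = y}"
          using AX(2) by (subst (1 2) subtopology_subtopology_subset) auto
        ultimately show "continuous_map (subtopology (subtopology X A) {x \<in> A. q x = y}) (total Y) (g y)"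
          by simp
      next
        fix x assume "x \<in> topspace (subtopology X A)"
        then have "x \<in> A" by simp
        then show "\<exists>y. y \<in> J \<and> x \<in> {x \<in> A. q x = y} \<and> s x = g y x"
          using q(1) by (simp add: s_def)
      qed auto
      then have s: "s \<in> sect (section_sheaf X Y) A"
        using g2 q(1) AX(2) by (auto simp: mem_section_sheaf s_def subset_iff)
      have "a A s = f"
        unfolding a[OF s]
      proof (rule extensionalityI[of _ A])
        fix x assume x: "x \<in> A"
        have "i (s x) = q x"
          using x AX(2) q(1)[OF x] gV by (intro i) (auto simp: s_def)
        then show "\<alpha> A s x = f x"
          using x q(2)[OF x] by (simp add: \<alpha>_def)
      qed (use f in \<open>simp_all add: \<alpha>_def mem_constant_sheaf\<close>)
      then show "f \<in> a A ` sect (section_sheaf X Y) A"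
        using s by blast
    qed (use sheaf_hom_sect[OF hom A] in auto)
  qed
  then have iso: "is_sheaf_iso ?XU (section_sheaf X Y) (constant_sheaf ?XU ?S) a"
    using hom by (simp add: is_sheaf_iso_def)
  \<comment> \<open>The record is the sheaf of sections over \<open>X\<close> read over the
    subspace, not \<open>section_sheaf ?XU Y\<close>; hence the laws are checked directly.\<close>
  have pre: "is_presheaf ?XU (section_sheaf X Y)"
    unfolding is_presheaf_def
  proof (intro conjI allI impI ballI)
    fix A B assume "openin ?XU A \<and> openin ?XU B \<and> B \<subseteq> A"
    then show "res (section_sheaf X Y) A B \<in> sect (section_sheaf X Y) A \<rightarrow> sect (section_sheaf X Y) B"
      using restrict_section by auto
  next
    fix A s assume "openin ?XU A" and s: "s \<in> sect (section_sheaf X Y) A"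
    then show "res (section_sheaf X Y) A A s = s"
      by (auto simp: mem_section_sheaf intro: extensional_restrict)
  next
    fix A B C s assume "openin ?XU A \<and> openin ?XU B \<and> openin ?XU C \<and> C \<subseteq> B \<and> B \<subseteq> A"
    then show "res (section_sheaf X Y) B C (res (section_sheaf X Y) A B s) = res (section_sheaf X Y) A C s"
      by (simp add: restrict_restrict Int_absorb1)
  qed
  show ?thesis
    using iso sheaves_isomorphic_iff[OF pre is_presheaf_constant_sheaf] by blast
qed

lemma is_locally_constant_section_sheaf:
  fixes Y :: "('a, 'b) over_space"
  assumes Y: "is_cover X Y"
  shows "is_locally_constant X (section_sheaf X Y)"
proof -
  let ?P = "\<lambda>U. \<exists>S :: ('a \<Rightarrow> 'b) set.
    sheaves_isomorphic (subtopology X U) (section_sheaf X Y) (constant_sheaf (subtopology X U) S)"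
  \<comment> \<open>All open sets over which the sheaf is constant; no choice of a neighbourhood for
    each point is then required.\<close>
  let ?\<U> = "{U. openin X U \<and> ?P U}"
  have "\<Union>?\<U> = topspace X"
  proof (intro subset_antisym subsetI)
    fix x assume x: "x \<in> topspace X"
    obtain U V where U: "openin X U" "x \<in> U"
      and V: "\<forall>y\<in>{y \<in> topspace (total Y). proj Y y = x}. openin (total Y) (V y) \<and> y \<in> V y \<and>
        homeomorphic_map (subtopology (total Y) (V y)) (subtopology X U) (proj Y)"
      and disj: "disjoint_family_on V {y \<in> topspace (total Y). proj Y y = x}"
      and un: "{y \<in> topspace (total Y). proj Y y \<in> U} = (\<Union>y\<in>{y \<in> topspace (total Y). proj Y y = x}. V y)"
      by (rule is_coverE[OF Y x])
    have "?P U"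
      using evenly_covered_section_sheaf_constant[OF U(1) _ _ disj un] V by blast
    then show "x \<in> \<Union>?\<U>" using U by blast
  qed (use openin_subset in blast)
  then show ?thesis
    unfolding is_locally_constant_def by (intro exI[of _ ?\<U>]) simp
qed

text \<open>Over a set \<open>U\<close> where \<open>F\<close> is constant with values in
  \<open>S\<close>, each value gives a section on all of \<open>U\<close>, and its germs form a
  sheet. A section of \<open>F\<close> is locally one of these, so the sheets cover; distinct values
  have distinct germs at every point, so the sheets are disjoint.\<close>

lemma is_cover_etale_space:
  fixes F :: "('a, 'c) presheaf"
  assumes F: "is_sheaf X F" and lc: "is_locally_constant X F"
  shows "is_cover X (etale_space X F)"
proof -
  let ?E = "etale_space X F"
  have pre: "is_presheaf X F" using F by (rule is_sheaf_is_presheaf)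
  obtain \<U> where \<U>: "\<forall>U\<in>\<U>. openin X U" "\<Union>\<U> = topspace X"
    and iso: "\<forall>U\<in>\<U>. \<exists>S :: 'c set. sheaves_isomorphic (subtopology X U) F (constant_sheaf (subtopology X U) S)"
    using lc unfolding is_locally_constant_def by blast
  have "\<exists>U V. openin X U \<and> x \<in> U \<and>
      (\<forall>p\<in>{p \<in> topspace (total ?E). proj ?E p = x}. openin (total ?E) (V p) \<and> p \<in> V p \<and>
         homeomorphic_map (subtopology (total ?E) (V p)) (subtopology X U) (proj ?E)) \<and>
      disjoint_family_on V {p \<in> topspace (total ?E). proj ?E p = x} \<and>
      {p \<in> topspace (total ?E). proj ?E p \<in> U} = (\<Union>p\<in>{p \<in> topspace (total ?E). proj ?E p = x}. V p)"
    if x: "x \<in> topspace X" for x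
  proof -
    obtain U where "U \<in> \<U>" and xU: "x \<in> U" using \<U>(2) x by blast
    then have U: "openin X U" using \<U>(1) by blast
    obtain S :: "'c set" where
      "sheaves_isomorphic (subtopology X U) F (constant_sheaf (subtopology X U) S)"
      using iso \<open>U \<in> \<U>\<close> by blast
    then obtain \<alpha> where \<alpha>: "is_sheaf_iso (subtopology X U) F (constant_sheaf (subtopology X U) S) \<alpha>"
      unfolding sheaves_isomorphic_def using sheaf_isoI by blast
    have opU: "openin (subtopology X U) W" if "openin X W" "W \<subseteq> U" for W
      using that openin_open_subtopology[OF U] by blast
    have bij: "bij_betw (\<alpha> W) (sect F W) (sect (constant_sheaf X S) W)" if "openin X W" "W \<subseteq> U" for W
      using \<alpha> opU[OF that] unfolding is_sheaf_iso_def constant_sheaf_subtopology[OF that(2), of X S, symmetric]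
      by blast
    have \<alpha>_sect: "\<alpha> W s \<in> sect (constant_sheaf X S) W"
      if "openin X W" "W \<subseteq> U" "s \<in> sect F W" for W s
      using bij[OF that(1,2)] that(3) by (rule bij_betwE[rule_format])
    have \<alpha>_inj: "s = t" if "openin X W" "W \<subseteq> U" "s \<in> sect F W" "t \<in> sect F W" "\<alpha> W s = \<alpha> W t" for W s t
      using bij[OF that(1,2)] that(3-5) by (meson bij_betw_imp_inj_on inj_onD)
    have \<alpha>_res: "\<alpha> W (res F V W s) = restrict (\<alpha> V s) W"
      if "openin X V" "openin X W" "W \<subseteq> V" "V \<subseteq> U" "s \<in> sect F V" for V W s
      using sheaf_hom_res[OF sheaf_iso_hom[OF \<alpha>] opU[OF that(1,4)] opU[OF that(2)] that(3,5)] that(3,4)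
      by auto
    have "\<exists>s. s \<in> sect F U \<and> \<alpha> U s = (\<lambda>x\<in>U. c)" if "c \<in> S" for c
    proof -
      have "{x \<in> U. restrict (\<lambda>x. c) U x = d} = (if c = d then U else {})" for d by auto
      then have "(\<lambda>x\<in>U. c) \<in> sect (constant_sheaf X S) U"
        using that U by (intro mem_constant_sheafI) auto
      then show ?thesis
        using bij_betw_imp_surj_on[OF bij[OF U subset_refl]] by (metis imageE)
    qed
    \<comment> \<open>\<open>k c\<close> is the section of \<open>F\<close> over \<open>U\<close>
      that corresponds to the constant function with value \<open>c\<close>.\<close>
    then obtain k where k: "\<And>c. c \<in> S \<Longrightarrow> k c \<in> sect F U" "\<And>c. c \<in> S \<Longrightarrow> \<alpha> U (k c) = (\<lambda>x\<in>U. c)"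
      by metis
    have germ_k: "germ X F y W t = germ X F y U (k c)"
      if W: "openin X W" "W \<subseteq> U" "t \<in> sect F W" "y \<in> W" and c: "c = \<alpha> W t y" for W t y c
    proof -
      have cS: "c \<in> S"
        using openin_locally_constant_level(1)[OF W(1) \<alpha>_sect[OF W(1-3)]] W(4) c by blast
      \<comment> \<open>The level set through \<open>y\<close> is open because the function is
        locally constant; on it \<open>t\<close> and \<open>k c\<close> correspond to the same
        constant function and hence coincide.\<close>
      let ?N = "{z \<in> W. \<alpha> W t z = c}"
      have N: "openin X ?N" "?N \<subseteq> W" "?N \<subseteq> U"
        using openin_locally_constant_level(2)[OF W(1) \<alpha>_sect[OF W(1-3)] cS] W(2) by auto
      have "res F W ?N t = res F U ?N (k c)"
      proof (rule \<alpha>_inj[OF N(1,3)])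
        show "res F W ?N t \<in> sect F ?N" by (rule presheaf_res_sect[OF pre W(1) N(1,2) W(3)])
        show "res F U ?N (k c) \<in> sect F ?N" by (rule presheaf_res_sect[OF pre U N(1,3) k(1)[OF cS]])
        have "restrict (\<alpha> W t) ?N = restrict (\<lambda>x\<in>U. c) ?N"
          using N(3) by (auto simp: fun_eq_iff restrict_def)
        then show "\<alpha> ?N (res F W ?N t) = \<alpha> ?N (res F U ?N (k c))"
          using \<alpha>_res[OF W(1) N(1,2) W(2,3)] \<alpha>_res[OF U N(1,3) subset_refl k(1)[OF cS]] k(2)[OF cS]
          by simp
      qed
      then show ?thesis
        using W(4) c by (intro germ_eqI[OF pre W(1,3) U k(1)[OF cS] N(1) _ N(2,3)]) simp
    qed
    have sheet: "\<exists>c\<in>S. (fst p, germ X F (fst p) U (k c)) = p"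
      if p: "p \<in> topspace (total ?E)" "fst p \<in> U" for p
    proof -
      obtain W t y where W: "openin X W" "t \<in> sect F W" "y \<in> W" and pt: "p = (y, germ X F y W t)"
        using p(1) by (rule topspace_etale_spaceE)
      have y: "y \<in> U" using p(2) pt by simp
      \<comment> \<open>The representative may be defined outside \<open>U\<close>, where
        \<open>\<alpha>\<close> says nothing. Restricting it to the overlap leaves the germ
        unchanged.\<close>
      have WU: "openin X (W \<inter> U)" using W(1) U by blast
      let ?t = "res F W (W \<inter> U) t"
      have t: "?t \<in> sect F (W \<inter> U)" by (rule presheaf_res_sect[OF pre W(1) WU _ W(2)]) simp
      have "germ X F y W t = germ X F y (W \<inter> U) ?t"
        using germ_res[OF pre W(1) WU _ _ W(2), of y] W(3) y by simp
      also have "\<dots> = germ X F y U (k (\<alpha> (W \<inter> U) ?t y))"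
        using W(3) y by (intro germ_k[OF WU _ t]) auto
      finally have "(fst p, germ X F (fst p) U (k (\<alpha> (W \<inter> U) ?t y))) = p"
        using pt by simp
      moreover have "\<alpha> (W \<inter> U) ?t y \<in> S"
        using openin_locally_constant_level(1)[OF WU \<alpha>_sect[OF WU _ t]] W(3) y by auto
      ultimately show ?thesis by blast
    qed
    \<comment> \<open>Needed at every point y of \<open>U\<close> to make the sheets disjoint, and
      at \<open>x\<close> to identify the index of a sheet. Germs agree only if two constant
      functions agree on a set containing y.\<close>
    have k_inj: "c = d" if cd: "c \<in> S" "d \<in> S" and y: "y \<in> U" and eq: "germ X F y U (k c) = germ X F y U (k d)"
      for c d y
    proof -
      obtain W where W: "openin X W" "y \<in> W" "W \<subseteq> U" "res F U W (k c) = res F U W (k d)"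
        by (rule germ_eqE[OF eq U y k(1)[OF cd(2)]])
      have "restrict (\<lambda>x\<in>U. c) W = restrict (\<lambda>x\<in>U. d) W"
        using \<alpha>_res[OF U W(1,3) subset_refl k(1)[OF cd(1)]] \<alpha>_res[OF U W(1,3) subset_refl k(1)[OF cd(2)]]
        unfolding W(4) k(2)[OF cd(1)] k(2)[OF cd(2)] by simp
      from fun_cong[OF this, of y] show ?thesis
        using W(2) y by simp
    qed
    let ?F = "{p \<in> topspace (total ?E). proj ?E p = x}"
    have "\<forall>p\<in>?F. \<exists>c. c \<in> S \<and> (x, germ X F x U (k c)) = p"
    proof
      fix p assume "p \<in> ?F"
      then have p: "p \<in> topspace (total ?E)" "fst p = x" by auto
      show "\<exists>c. c \<in> S \<and> (x, germ X F x U (k c)) = p"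
        using sheet[OF p(1)] xU unfolding p(2) by blast
    qed
    \<comment> \<open>The definition of a cover wants the sheets indexed by the fibre over
      \<open>x\<close> and not by \<open>S\<close>, so each point of the fibre is assigned its
      value.\<close>
    then obtain c where "\<forall>p\<in>?F. c p \<in> S \<and> (x, germ X F x U (k (c p))) = p"
      by (rule bchoice[THEN exE])
    then have c: "c p \<in> S" "(x, germ X F x U (k (c p))) = p" if "p \<in> ?F" for p
      using that by blast+
    let ?V = "\<lambda>p. germ_section X F U (k (c p)) ` U"
    have 1: "openin (total ?E) (?V p)" if "p \<in> ?F" for p
      by (rule openin_germ_section_image[OF U k(1)[OF c(1)[OF that]]])
    have 2: "p \<in> ?V p" if "p \<in> ?F" for p
    proof (rule image_eqI[OF _ xU])
      show "p = germ_section X F U (k (c p)) x" using c(2)[OF that] xU by simp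
    qed
    have 3: "homeomorphic_map (subtopology (total ?E) (?V p)) (subtopology X U) (proj ?E)" if p: "p \<in> ?F" for p
    proof -
      let ?s = "germ_section X F U (k (c p))"
      have topU: "topspace (subtopology X U) = U" using openin_subset[OF U] by auto
      have "continuous_map (subtopology (total ?E) (?V p)) (subtopology X U) fst"
        using continuous_map_proj_etale_space[OF pre]
        by (auto simp: continuous_map_in_subtopology continuous_map_from_subtopology)
      moreover have "continuous_map (subtopology X U) (subtopology (total ?E) (?V p)) ?s"
        using continuous_map_germ_section[OF pre U k(1)[OF c(1)[OF p]]]
        by (auto simp: continuous_map_in_subtopology)
      moreover have "?s (fst q) = q" if "q \<in> ?V p" for q
        using that by auto
      moreover have "fst (?s y) = y" if "y \<in> U" for y
        using that by simp
      ultimately have "homeomorphic_maps (subtopology (total ?E) (?V p)) (subtopology X U) fst ?s"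
        unfolding homeomorphic_maps_def topU by simp
      then show ?thesis
        unfolding proj_etale_space by (rule homeomorphic_maps_imp_map)
    qed
    have 4: "disjoint_family_on ?V ?F"
      unfolding disjoint_family_on_def
    proof (intro ballI impI)
      fix p q assume p: "p \<in> ?F" and q: "q \<in> ?F" and "p \<noteq> q"
      then have "c p \<noteq> c q" using c(2)[OF p] c(2)[OF q] by metis
      then have "germ X F y U (k (c p)) \<noteq> germ X F y U (k (c q))" if "y \<in> U" for y
        using k_inj[OF c(1)[OF p] c(1)[OF q] that] by blast
      then show "?V p \<inter> ?V q = {}" by (auto simp: germ_section_def)
    qed
    have 5: "{p \<in> topspace (total ?E). proj ?E p \<in> U} = (\<Union>p\<in>?F. ?V p)"
    proof (intro subset_antisym subsetI)
      fix q assume q: "q \<in> {p \<in> topspace (total ?E). proj ?E p \<in> U}"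
      then obtain d where d: "d \<in> S" "(fst q, germ X F (fst q) U (k d)) = q"
        using sheet[of q] by auto
      \<comment> \<open>The sheet of the value \<open>d\<close> meets the fibre over
        \<open>x\<close> in this point, whose assigned value is again \<open>d\<close>. Hence no
        sheet is lost by indexing with the fibre.\<close>
      let ?p = "(x, germ X F x U (k d))"
      have p: "?p \<in> ?F" using U k(1)[OF d(1)] xU by auto
      have "germ X F x U (k d) = germ X F x U (k (c ?p))" using c(2)[OF p] by simp
      then have "d = c ?p" by (rule k_inj[OF d(1) c(1)[OF p] xU])
      moreover have "germ_section X F U (k d) (fst q) = q" "fst q \<in> U" using q d(2) by auto
      ultimately have "q \<in> ?V ?p" by (metis image_eqI)
      then show "q \<in> (\<Union>p\<in>?F. ?V p)" using p by blast
    next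
      fix q assume "q \<in> (\<Union>p\<in>?F. ?V p)"
      then obtain p where p: "p \<in> ?F" "q \<in> ?V p" by blast
      then show "q \<in> {p \<in> topspace (total ?E). proj ?E p \<in> U}"
        using U k(1)[OF c(1)[OF p(1)]] by auto
    qed
    show ?thesis
      by (intro exI[of _ U] exI[of _ ?V] conjI ballI U xU 1 2 3 4 5)
  qed
  moreover have "continuous_map (total ?E) X (proj ?E)"
    using continuous_map_proj_etale_space[OF pre] by simp
  ultimately show ?thesis
    unfolding is_cover_def Let_def by (intro conjI ballI)
qed

section \<open>Trivial covers\<close>

text \<open>The slice through a point is open because the fibre is discrete, and it is mapped
  homeomorphically onto the whole of \<open>X\<close>.\<close>

lemma is_local_homeomorphism_trivial_cover: "is_local_homeomorphism X (trivial_cover X I)"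
  unfolding is_local_homeomorphism_def trivial_cover_def over_space.simps
proof (intro conjI ballI)
  let ?T = "prod_topology X (discrete_topology I)"
  show "continuous_map ?T X fst" by (rule continuous_map_fst)
  fix p assume p: "p \<in> topspace ?T"
  then obtain x i where xi: "p = (x, i)" "x \<in> topspace X" "i \<in> I" by auto
  let ?V = "topspace X \<times> {i}"
  have V: "openin ?T ?V"
    using xi(3) by (simp add: openin_prod_Times_iff)
  have img: "fst ` ?V = topspace X" by force
  have "continuous_map (subtopology ?T ?V) X fst"
    by (intro continuous_map_from_subtopology continuous_map_fst)
  moreover have "continuous_map X (subtopology ?T ?V) (\<lambda>x. (x, i))"
    using xi(3) by (auto simp: continuous_map_in_subtopology continuous_map_pairwise o_def)
  ultimately have "homeomorphic_maps (subtopology ?T ?V) X fst (\<lambda>x. (x, i))"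
    by (auto simp: homeomorphic_maps_def)
  then have "homeomorphic_map (subtopology ?T ?V) X fst"
    by (rule homeomorphic_maps_imp_map)
  then have "homeomorphic_map (subtopology ?T ?V) (subtopology X (fst ` ?V)) fst"
    unfolding img by simp
  then show "\<exists>V. openin ?T V \<and> p \<in> V \<and> openin X (fst ` V) \<and>
      homeomorphic_map (subtopology ?T V) (subtopology X (fst ` V)) fst"
    using V xi img by (intro exI[of _ ?V]) auto
qed

text \<open>A section of the projection is the graph of a continuous map to the discrete fibre;
  taking second components and forming graphs are inverse to each other.\<close>

lemma section_sheaf_trivial_cover:
  "sheaves_isomorphic X (section_sheaf X (trivial_cover X I)) (constant_sheaf X I)"
proof -
  let ?S = "section_sheaf X (trivial_cover X I)" and ?C = "constant_sheaf X I"
  define \<alpha> where "\<alpha> = (\<lambda>U\<in>{U. openin X U}. \<lambda>s\<in>sect ?S U. \<lambda>x\<in>U. snd (s x))"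
  have \<alpha>: "\<alpha> U s = (\<lambda>x\<in>U. snd (s x))" if "openin X U" "s \<in> sect ?S U" for U s
    using that by (simp add: \<alpha>_def)
  have hom: "\<alpha> \<in> sheaf_hom X ?S ?C"
    unfolding \<alpha>_def
  proof (rule sheaf_hom_restrictI)
    fix U s assume U: "openin X U" and s: "s \<in> sect ?S U"
    have "continuous_map (subtopology X U) (prod_topology X (discrete_topology I)) s"
      using s by (simp add: mem_section_sheaf trivial_cover_def)
    then have "continuous_map (subtopology X U) (discrete_topology I) (snd \<circ> s)"
      by (rule continuous_map_compose[OF _ continuous_map_snd])
    then have "continuous_map (subtopology X U) (discrete_topology I) (\<lambda>x\<in>U. snd (s x))"
      by (rule continuous_map_eq) simp
    then show "(\<lambda>x\<in>U. snd (s x)) \<in> sect ?C U"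
      by (simp add: mem_constant_sheaf)
    fix V assume V: "openin X V" "V \<subseteq> U"
    show "res ?S U V s \<in> sect ?S V"
      using restrict_section[OF s V(2)] by simp
    show "(\<lambda>x\<in>V. snd (res ?S U V s x)) = res ?C U V (\<lambda>x\<in>U. snd (s x))"
      using V(2) by (auto simp: fun_eq_iff)
  qed
  have "bij_betw (\<alpha> U) (sect ?S U) (sect ?C U)" if U: "openin X U" for U
  proof (rule bij_betw_byWitness[where f'="\<lambda>f. \<lambda>x\<in>U. (x, f x)"])
    have C_S: "(\<lambda>x\<in>U. (x, f x)) \<in> sect ?S U" if f: "f \<in> sect ?C U" for f
    proof -
      have "continuous_map (subtopology X U) (prod_topology X (discrete_topology I)) (\<lambda>x. (x, f x))"
        using f by (simp add: mem_constant_sheaf continuous_map_pairwise o_def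
            continuous_map_from_subtopology)
      then have "continuous_map (subtopology X U) (prod_topology X (discrete_topology I)) (\<lambda>x\<in>U. (x, f x))"
        by (rule continuous_map_eq) simp
      then show ?thesis
        by (simp add: mem_section_sheaf trivial_cover_def)
    qed
    then show "(\<lambda>f. \<lambda>x\<in>U. (x, f x)) ` sect ?C U \<subseteq> sect ?S U" by blast
    show "\<alpha> U ` sect ?S U \<subseteq> sect ?C U"
      using sheaf_hom_sect[OF hom U] by blast
    show "\<forall>f\<in>sect ?C U. \<alpha> U (\<lambda>x\<in>U. (x, f x)) = f"
    proof
      fix f assume f: "f \<in> sect ?C U"
      then have "f \<in> extensional U" by (simp add: mem_constant_sheaf)
      then show "\<alpha> U (\<lambda>x\<in>U. (x, f x)) = f"
        unfolding \<alpha>[OF U C_S[OF f]] by (intro extensionalityI[of _ U]) simp_all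
    qed
    show "\<forall>s\<in>sect ?S U. (\<lambda>x\<in>U. (x, \<alpha> U s x)) = s"
    proof
      fix s assume s: "s \<in> sect ?S U"
      have ext: "s \<in> extensional U" and fst: "\<And>x. x \<in> U \<Longrightarrow> fst (s x) = x"
        using s by (simp_all add: mem_section_sheaf trivial_cover_def)
      show "(\<lambda>x\<in>U. (x, \<alpha> U s x)) = s"
        unfolding \<alpha>[OF U s] by (intro extensionalityI[of _ U] ext) (simp_all add: prod_eq_iff fst)
    qed
  qed
  then have "is_sheaf_iso X ?S ?C \<alpha>"
    using hom by (simp add: is_sheaf_iso_def)
  then show ?thesis
    unfolding sheaves_isomorphic_iff[OF is_presheaf_section_sheaf is_presheaf_constant_sheaf] by blast
qed

lemma covers_isomorphic_etale_section_sheaf: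
  "is_local_homeomorphism X Y \<Longrightarrow> covers_isomorphic (etale_space X (section_sheaf X Y)) Y"
  using germ_value_iso unfolding covers_isomorphic_def by blast

text \<open>No germs are computed: the constant sheaf is the sheaf of sections of the trivial cover,
  and a local homeomorphism is recovered from its sections.\<close>

lemma etale_space_constant_sheaf:
  "covers_isomorphic (etale_space X (constant_sheaf X I)) (trivial_cover X I)"
  by (rule covers_isomorphic_trans[OF covers_isomorphic_etale_space[OF is_presheaf_constant_sheaf
        is_presheaf_section_sheaf sheaves_isomorphic_sym[OF section_sheaf_trivial_cover]]
      covers_isomorphic_etale_section_sheaf[OF is_local_homeomorphism_trivial_cover]])

text \<open>One direction passes to sheaves of sections; the other passes to etale spaces and then
  evaluates germs to return from the etale space to \<open>Y\<close>.\<close>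

lemma trivial_cover_iff_constant_section_sheaf:
  assumes Y: "is_cover X Y"
  shows "covers_isomorphic Y (trivial_cover X I) \<longleftrightarrow>
    sheaves_isomorphic X (section_sheaf X Y) (constant_sheaf X I)"
proof
  assume "covers_isomorphic Y (trivial_cover X I)"
  from sheaves_isomorphic_section_sheaf[OF this]
  show "sheaves_isomorphic X (section_sheaf X Y) (constant_sheaf X I)"
    by (rule sheaves_isomorphic_trans[OF is_presheaf_section_sheaf is_presheaf_section_sheaf
          is_presheaf_constant_sheaf _ section_sheaf_trivial_cover])
next
  assume "sheaves_isomorphic X (section_sheaf X Y) (constant_sheaf X I)"
  then have "covers_isomorphic (etale_space X (section_sheaf X Y)) (etale_space X (constant_sheaf X I))"
    by (rule covers_isomorphic_etale_space[OF is_presheaf_section_sheaf is_presheaf_constant_sheaf])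
  then have "covers_isomorphic (etale_space X (section_sheaf X Y)) (trivial_cover X I)"
    by (rule covers_isomorphic_trans[OF _ etale_space_constant_sheaf])
  then show "covers_isomorphic Y (trivial_cover X I)"
    by (rule covers_isomorphic_trans[OF covers_isomorphic_sym[OF
            covers_isomorphic_etale_section_sheaf[OF is_cover_imp_local_homeomorphism[OF Y]]]])
qed

text \<open>The mirror image of the statement for covers, with \<open>germ_map\<close> in place of
  evaluation leading back from the sections of the etale space to \<open>F\<close>.\<close>

lemma constant_sheaf_iff_trivial_etale_space:
  assumes F: "is_sheaf X F"
  shows "sheaves_isomorphic X F (constant_sheaf X I) \<longleftrightarrow>
    covers_isomorphic (etale_space X F) (trivial_cover X I)"
proof
  have pre: "is_presheaf X F" using F by (rule is_sheaf_is_presheaf)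
  {
    assume "sheaves_isomorphic X F (constant_sheaf X I)"
    then have "covers_isomorphic (etale_space X F) (etale_space X (constant_sheaf X I))"
      by (rule covers_isomorphic_etale_space[OF pre is_presheaf_constant_sheaf])
    then show "covers_isomorphic (etale_space X F) (trivial_cover X I)"
      by (rule covers_isomorphic_trans[OF _ etale_space_constant_sheaf])
  }
  assume "covers_isomorphic (etale_space X F) (trivial_cover X I)"
  then have "sheaves_isomorphic X (section_sheaf X (etale_space X F)) (section_sheaf X (trivial_cover X I))"
    by (rule sheaves_isomorphic_section_sheaf)
  then have "sheaves_isomorphic X (section_sheaf X (etale_space X F)) (constant_sheaf X I)"
    by (rule sheaves_isomorphic_trans[OF is_presheaf_section_sheaf is_presheaf_section_sheaf
          is_presheaf_constant_sheaf _ section_sheaf_trivial_cover])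
  moreover have "sheaves_isomorphic X F (section_sheaf X (etale_space X F))"
    unfolding sheaves_isomorphic_iff[OF pre is_presheaf_section_sheaf] using germ_map_iso[OF F] by blast
  ultimately show "sheaves_isomorphic X F (constant_sheaf X I)"
    by (rule sheaves_isomorphic_trans[OF pre is_presheaf_section_sheaf is_presheaf_constant_sheaf, rotated])
qed

section \<open>The equivalence\<close>

lemma germ_eq_if_mem:
  assumes F: "is_presheaf X F" and U: "openin X U" "s \<in> sect F U" and Vt: "(V, t) \<in> germ X F x U s"
  shows "germ X F x V t = germ X F x U s"
proof -
  obtain W where "openin X V" "t \<in> sect F V" "openin X W" "x \<in> W" "W \<subseteq> V" "W \<subseteq> U"
    "res F V W t = res F U W s"
    using Vt by (auto simp: mem_germ)
  then show ?thesis
    using U by (intro germ_eqI[OF F]) auto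
qed

text \<open>A point of the etale space is determined by a representative of its germ, and the
  representatives inject into an infinite type that contains its own functions on the base.\<close>

lemma etale_space_points_inject:
  fixes F :: "('a, 'a \<Rightarrow> 'u) presheaf"
  assumes F: "is_presheaf X F" and inf: "infinite (UNIV :: 'u set)"
    and "\<exists>c :: ('a \<Rightarrow> 'u) \<Rightarrow> 'u. inj c"
  shows "\<exists>e :: 'a \<times> ('a set \<times> ('a \<Rightarrow> 'u)) set \<Rightarrow> 'u. inj_on e (topspace (total (etale_space X F)))"
proof -
  obtain c :: "('a \<Rightarrow> 'u) \<Rightarrow> 'u" where c: "inj c" using assms(3) by blast
  \<comment> \<open>A pairing function, available because an infinite set is equipotent to its
    square.\<close>
  obtain h :: "'u \<times> 'u \<Rightarrow> 'u" where "bij_betw h (UNIV \<times> UNIV) UNIV"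
    using card_of_Times_same_infinite[OF inf] card_of_ordIso by blast
  then have h: "inj h" by (simp add: bij_betw_def)
  obtain u v :: 'u where uv: "u \<noteq> v"
    using inf by (metis finite.simps UNIV_I finite_subset insertI1 subsetI singletonD)
  \<comment> \<open>Codes a subset of the base by its indicator function with the two values
    \<open>u\<close> and \<open>v\<close>, and thence by an element of \<open>'u\<close>.\<close>
  define b where "b A = c (\<lambda>y. if y \<in> A then u else v)" for A
  have b: "A = B" if "b A = b B" for A B
  proof -
    have eq: "(\<lambda>y. if y \<in> A then u else v) = (\<lambda>y. if y \<in> B then u else v)"
      using that c by (simp add: b_def inj_eq)
    have "y \<in> A \<longleftrightarrow> y \<in> B" for y
      using fun_cong[OF eq, of y] uv by (simp split: if_splits)
    then show ?thesis by blast
  qed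
  define r where "r p = (SOME q. q \<in> snd p)" for p :: "'a \<times> ('a set \<times> ('a \<Rightarrow> 'u)) set"
  \<comment> \<open>Encodes the base point, as a singleton, together with the domain and the section
    of the chosen representative. These data determine the germ, while the germ as a set of pairs
    would be too large to encode.\<close>
  define e where "e p = h (b {fst p}, h (b (fst (r p)), c (snd (r p))))" for p
  have r: "(fst p, germ X F (fst p) (fst (r p)) (snd (r p))) = p"
    if p: "p \<in> topspace (total (etale_space X F))" for p
  proof -
    obtain U s x where U: "openin X U" "s \<in> sect F U" "x \<in> U" and ps: "p = (x, germ X F x U s)"
      using p by (rule topspace_etale_spaceE)
    have "r p \<in> germ X F x U s"
      unfolding r_def ps snd_conv using germ_self[OF U(1,3,2)] by (rule someI)
    then have "germ X F x (fst (r p)) (snd (r p)) = germ X F x U s"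
      by (intro germ_eq_if_mem[OF F U(1,2)]) simp
    then show ?thesis by (simp add: ps)
  qed
  have "inj_on e (topspace (total (etale_space X F)))"
  proof (rule inj_onI)
    fix p q assume p: "p \<in> topspace (total (etale_space X F))" and q: "q \<in> topspace (total (etale_space X F))"
      and "e p = e q"
    then have "b {fst p} = b {fst q}" "b (fst (r p)) = b (fst (r q))" "snd (r p) = snd (r q)"
      using h c by (simp_all add: e_def inj_eq)
    then have "fst p = fst q" "r p = r q"
      using b by (auto intro: prod_eqI)
    then show "p = q"
      using r[OF p] r[OF q] by metis
  qed
  then show ?thesis by blast
qed

lemma is_functor_section_func:
  "is_functor (cover_cat X) (locally_constant_sheaf_cat X) (section_func X)"
  unfolding is_functor_def
  by (intro conjI is_category_cover_cat is_category_locally_constant_sheaf_cat)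
    (auto simp: cover_cat_def locally_constant_sheaf_cat_def section_func_def
      is_sheaf_section_sheaf is_locally_constant_section_sheaf section_map_hom section_map_id
      section_map_comp)

text \<open>\<open>Z\<close> and \<open>\<theta>\<close> are arbitrary: any family of covers
  isomorphic to the etale spaces gives an inverse functor. The question of fitting the points into
  \<open>'u\<close> is thereby kept apart from the categorical argument.\<close>

lemma section_func_equivalence:
  fixes X :: "'a topology"
    and Z :: "('a, 'a \<Rightarrow> 'u) presheaf \<Rightarrow> ('a, 'u) over_space"
  defines "sheaves \<equiv> locally_constant_sheaf_cat X ::
    (('a, 'a \<Rightarrow> 'u) presheaf, 'a set \<Rightarrow> ('a \<Rightarrow> 'u) \<Rightarrow> ('a \<Rightarrow> 'u)) cat"
  assumes \<theta>: "\<And>F. F \<in> Obj sheaves \<Longrightarrow> is_cover_iso (etale_space X F) (Z F) (\<theta> F)"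
  shows "\<exists>G. is_equivalence (cover_cat X) sheaves (section_func X) G \<and> represents_etale_functor X G"
proof -
  have obj: "is_sheaf X F" "is_locally_constant X F" "is_presheaf X F" if "F \<in> Obj sheaves" for F
    using that by (auto simp: sheaves_def locally_constant_sheaf_cat_def is_sheaf_is_presheaf)
  have sheaves: "Hom sheaves = sheaf_hom X" "Ident sheaves = sheaf_id X"
    "Comp sheaves = (\<lambda>F G H. sheaf_comp X F)"
    by (simp_all add: sheaves_def locally_constant_sheaf_cat_def)
  have covers: "Obj (cover_cat X) = {Y. is_cover X Y}" "Hom (cover_cat X) = cover_hom"
    "Ident (cover_cat X) = cover_id" "Comp (cover_cat X) = (\<lambda>Y Z W. cover_comp Y)"
    for X :: "'a topology"
    by (simp_all add: cover_cat_def)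
  have "\<exists>\<psi>. is_cover_iso (Z F) (etale_space X F) \<psi> \<and>
      (\<forall>p\<in>topspace (total (etale_space X F)). \<psi> (\<theta> F p) = p) \<and>
      (\<forall>z\<in>topspace (total (Z F)). \<theta> F (\<psi> z) = z)" if F: "F \<in> Obj sheaves" for F
    by (rule cover_iso_inverse[OF \<theta>[OF F]]) blast
  then obtain \<psi> where \<psi>: "\<And>F. F \<in> Obj sheaves \<Longrightarrow> is_cover_iso (Z F) (etale_space X F) (\<psi> F)"
    and \<psi>\<theta>: "\<And>F p. F \<in> Obj sheaves \<Longrightarrow> p \<in> topspace (total (etale_space X F)) \<Longrightarrow> \<psi> F (\<theta> F p) = p"
    and \<theta>\<psi>: "\<And>F z. F \<in> Obj sheaves \<Longrightarrow> z \<in> topspace (total (Z F)) \<Longrightarrow> \<theta> F (\<psi> F z) = z"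
    by metis
  have \<theta>h: "\<theta> F \<in> cover_hom (etale_space X F) (Z F)" and \<psi>h: "\<psi> F \<in> cover_hom (Z F) (etale_space X F)"
    if "F \<in> Obj sheaves" for F
    using \<theta>[OF that] \<psi>[OF that] by (simp_all add: is_cover_iso_def)
  have coverZ: "is_cover X (Z F)" if "F \<in> Obj sheaves" for F
    by (rule is_cover_cover_iso[OF \<theta>[OF that] is_cover_etale_space[OF obj(1,2)[OF that]]])
  have section_obj: "section_sheaf X Y \<in> Obj sheaves" if "is_cover X Y" for Y :: "('a, 'u) over_space"
    using that is_locally_constant_section_sheaf
    by (simp add: sheaves_def locally_constant_sheaf_cat_def is_sheaf_section_sheaf)
  \<comment> \<open>Conjugation of the map of etale spaces by the chosen isomorphisms; in a
    composite, the inner \<open>\<theta>\<close> and \<open>\<psi>\<close> cancel.\<close>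
  define m where "m F H \<alpha> = cover_comp (Z F) (\<theta> H) (cover_comp (Z F) (etale_map X F H \<alpha>) (\<psi> F))"
    for F H :: "('a, 'a \<Rightarrow> 'u) presheaf" and \<alpha>
  define G where "G = \<lparr>on_obj = Z, on_hom = m\<rparr>"
  have etale: "etale_map X F H \<alpha> \<in> cover_hom (etale_space X F) (etale_space X H)"
    if "F \<in> Obj sheaves" "H \<in> Obj sheaves" "\<alpha> \<in> sheaf_hom X F H" for F H \<alpha>
    by (rule etale_map_hom[OF obj(3)[OF that(1)] obj(3)[OF that(2)] that(3)])
  have m_hom: "m F H \<alpha> \<in> cover_hom (Z F) (Z H)"
    if "F \<in> Obj sheaves" "H \<in> Obj sheaves" "\<alpha> \<in> sheaf_hom X F H" for F H \<alpha>
    unfolding m_def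
    by (rule cover_comp_hom[OF cover_comp_hom[OF \<psi>h[OF that(1)] etale[OF that]] \<theta>h[OF that(2)]])
  have m_apply: "m F H \<alpha> z = \<theta> H (etale_map X F H \<alpha> (\<psi> F z))" if "z \<in> topspace (total (Z F))" for F H \<alpha> z
    using that by (simp add: m_def)
  \<comment> \<open>This is the square demanded by \<open>represents_etale_functor\<close>; it is
    used once more for the naturality of \<open>\<epsilon>\<close>.\<close>
  have m_\<theta>: "cover_comp (etale_space X F) (m F H \<alpha>) (\<theta> F) =
      cover_comp (etale_space X F) (\<theta> H) (etale_map X F H \<alpha>)"
    if F: "F \<in> Obj sheaves" and H: "H \<in> Obj sheaves" and \<alpha>: "\<alpha> \<in> sheaf_hom X F H" for F H \<alpha>
    by (rule cover_hom_eqI[OF cover_comp_hom[OF \<theta>h[OF F] m_hom[OF F H \<alpha>]]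
          cover_comp_hom[OF etale[OF F H \<alpha>] \<theta>h[OF H]]])
      (simp add: m_apply \<psi>\<theta>[OF F] cover_homD(3)[OF \<theta>h[OF F]])
  have G: "is_functor sheaves (cover_cat X) G"
    unfolding is_functor_def sheaves covers G_def func.simps
  proof (intro conjI ballI)
    show "is_category sheaves" unfolding sheaves_def by (rule is_category_locally_constant_sheaf_cat)
    show "is_category (cover_cat X)" by (rule is_category_cover_cat)
  next
    fix F assume F: "F \<in> Obj sheaves"
    show "Z F \<in> {Y. is_cover X Y}" using coverZ[OF F] by simp
    show "m F F (sheaf_id X F) = cover_id (Z F)"
    proof (rule cover_hom_eqI[OF m_hom[OF F F sheaf_id_hom[OF obj(3)[OF F]]] cover_id_hom])
      fix z assume z: "z \<in> topspace (total (Z F))"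
      show "m F F (sheaf_id X F) z = cover_id (Z F) z"
        unfolding m_apply[OF z] etale_map_id[OF obj(3)[OF F]]
        using z by (simp add: cover_homD(3)[OF \<psi>h[OF F]] \<theta>\<psi>[OF F])
    qed
  next
    fix F H \<alpha> assume F: "F \<in> Obj sheaves" and H: "H \<in> Obj sheaves" and \<alpha>: "\<alpha> \<in> sheaf_hom X F H"
    show "m F H \<alpha> \<in> cover_hom (Z F) (Z H)" by (rule m_hom[OF F H \<alpha>])
    fix K \<beta> assume K: "K \<in> Obj sheaves" and \<beta>: "\<beta> \<in> sheaf_hom X H K"
    note \<beta>\<alpha> = sheaf_comp_hom[OF obj(3)[OF F] \<alpha> \<beta>]
    show "m F K (sheaf_comp X F \<beta> \<alpha>) = cover_comp (Z F) (m H K \<beta>) (m F H \<alpha>)"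
    proof (rule cover_hom_eqI[OF m_hom[OF F K \<beta>\<alpha>] cover_comp_hom[OF m_hom[OF F H \<alpha>] m_hom[OF H K \<beta>]]])
      fix z assume z: "z \<in> topspace (total (Z F))"
      \<comment> \<open>The cancellation of \<open>\<psi>\<close> against \<open>\<theta>\<close>
        and the composition law hold only at points of the total spaces, so membership is followed
        along the composite.\<close>
      have p: "\<psi> F z \<in> topspace (total (etale_space X F))"
        by (rule cover_homD(3)[OF \<psi>h[OF F] z])
      have q: "etale_map X F H \<alpha> (\<psi> F z) \<in> topspace (total (etale_space X H))"
        by (rule cover_homD(3)[OF etale[OF F H \<alpha>] p])
      show "m F K (sheaf_comp X F \<beta> \<alpha>) z = cover_comp (Z F) (m H K \<beta>) (m F H \<alpha>) z"
        unfolding cover_comp_apply[OF z] m_apply[OF z] m_apply[OF cover_homD(3)[OF \<theta>h[OF H] q]]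
          \<psi>\<theta>[OF H q] etale_map_comp[OF obj(3)[OF F] obj(3)[OF H] obj(3)[OF K] \<alpha> \<beta>] cover_comp_apply[OF p]
        by (rule refl)
    qed
  qed
  have S: "is_functor (cover_cat X) sheaves (section_func X)"
    unfolding sheaves_def by (rule is_functor_section_func)
  have section_func: "on_obj (section_func X) = section_sheaf X"
    "on_hom (section_func X) = (\<lambda>Y Z. section_map X Y)" for X :: "'a topology"
    by (simp_all add: section_func_def)
  \<comment> \<open>From the composite to the identity: go back from the copy to the etale space
    with \<open>\<psi>\<close>, then evaluate germs.\<close>
  have "is_natural_iso (cover_cat X) (cover_cat X) (comp_func G (section_func X)) id_func
      (\<lambda>Y. cover_comp (Z (section_sheaf X Y)) (germ_value X Y) (\<psi> (section_sheaf X Y)))"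
    unfolding is_natural_iso_def comp_func_def id_func_def is_iso_def G_def covers section_func func.simps
      is_cover_iso_def[symmetric] mem_Collect_eq
  proof (intro conjI ballI)
    fix Y :: "('a, 'u) over_space" assume "Y \<in> {Y. is_cover X Y}"
    then have Y: "is_cover X Y" by simp
    show "is_cover_iso (Z (section_sheaf X Y)) Y
        (cover_comp (Z (section_sheaf X Y)) (germ_value X Y) (\<psi> (section_sheaf X Y)))"
      by (rule cover_iso_comp[OF \<psi>[OF section_obj[OF Y]]
            germ_value_iso[OF is_cover_imp_local_homeomorphism[OF Y]]])
    fix Y' and \<phi> :: "'u \<Rightarrow> 'u" assume "Y' \<in> {Y. is_cover X Y}" and \<phi>: "\<phi> \<in> cover_hom Y Y'"
    then have Y': "is_cover X Y'" by simp
    let ?F = "section_sheaf X Y" and ?F' = "section_sheaf X Y'"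
    note F = section_obj[OF Y] and F' = section_obj[OF Y']
    note \<alpha> = section_map_hom[OF \<phi>, of X]
    show "cover_comp (Z ?F) \<phi> (cover_comp (Z ?F) (germ_value X Y) (\<psi> ?F)) =
        cover_comp (Z ?F) (cover_comp (Z ?F') (germ_value X Y') (\<psi> ?F')) (m ?F ?F' (section_map X Y \<phi>))"
    proof (rule cover_hom_eqI)
      show "cover_comp (Z ?F) \<phi> (cover_comp (Z ?F) (germ_value X Y) (\<psi> ?F)) \<in> cover_hom (Z ?F) Y'"
        by (rule cover_comp_hom[OF cover_comp_hom[OF \<psi>h[OF F] germ_value_hom] \<phi>])
      show "cover_comp (Z ?F) (cover_comp (Z ?F') (germ_value X Y') (\<psi> ?F')) (m ?F ?F' (section_map X Y \<phi>))
          \<in> cover_hom (Z ?F) Y'"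
        by (rule cover_comp_hom[OF m_hom[OF F F' \<alpha>] cover_comp_hom[OF \<psi>h[OF F'] germ_value_hom]])
      fix z assume z: "z \<in> topspace (total (Z ?F))"
      have p: "\<psi> ?F z \<in> topspace (total (etale_space X ?F))"
        by (rule cover_homD(3)[OF \<psi>h[OF F] z])
      have q: "etale_map X ?F ?F' (section_map X Y \<phi>) (\<psi> ?F z) \<in> topspace (total (etale_space X ?F'))"
        by (rule cover_homD(3)[OF etale[OF F F' \<alpha>] p])
      show "cover_comp (Z ?F) \<phi> (cover_comp (Z ?F) (germ_value X Y) (\<psi> ?F)) z =
          cover_comp (Z ?F) (cover_comp (Z ?F') (germ_value X Y') (\<psi> ?F')) (m ?F ?F' (section_map X Y \<phi>)) z"
        unfolding cover_comp_apply[OF z] m_apply[OF z] cover_comp_apply[OF cover_homD(3)[OF \<theta>h[OF F'] q]]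
          \<psi>\<theta>[OF F' q] germ_value_natural[OF \<phi> p]
        by (rule refl)
    qed
  qed
  then have unit: "\<exists>\<eta>. is_natural_iso (cover_cat X) (cover_cat X) id_func (comp_func G (section_func X)) \<eta>"
    by (rule natural_iso_inverse[OF is_functor_comp_func[OF S G] is_functor_id_func[OF is_category_cover_cat]])
  \<comment> \<open>A section of \<open>F\<close> is turned into a section of the etale space and
    then carried to the copy by \<open>\<theta>\<close>.\<close>
  define \<epsilon> where "\<epsilon> F = sheaf_comp X F (section_map X (etale_space X F) (\<theta> F)) (germ_map X F)" for F
  have \<epsilon>_iso: "is_sheaf_iso X F (section_sheaf X (Z F)) (\<epsilon> F)" if F: "F \<in> Obj sheaves" for F
    unfolding \<epsilon>_def
    by (rule sheaf_iso_comp[OF obj(3)[OF F] germ_map_iso[OF obj(1)[OF F]] section_map_iso[OF \<theta>[OF F]]])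
  have "is_natural_iso sheaves sheaves id_func (comp_func (section_func X) G) \<epsilon>"
    unfolding is_natural_iso_def comp_func_def id_func_def is_iso_def G_def sheaves section_func func.simps
  proof (intro conjI ballI)
    fix F assume F: "F \<in> Obj sheaves"
    show "\<epsilon> F \<in> sheaf_hom X F (section_sheaf X (Z F))"
      by (rule sheaf_iso_hom[OF \<epsilon>_iso[OF F]])
    obtain \<beta> where "is_sheaf_iso X (section_sheaf X (Z F)) F \<beta>"
      "sheaf_comp X F \<beta> (\<epsilon> F) = sheaf_id X F"
      "sheaf_comp X (section_sheaf X (Z F)) (\<epsilon> F) \<beta> = sheaf_id X (section_sheaf X (Z F))"
      by (rule sheaf_iso_inverse[OF obj(3)[OF F] is_presheaf_section_sheaf \<epsilon>_iso[OF F]])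
    then show "\<exists>\<beta>\<in>sheaf_hom X (section_sheaf X (Z F)) F. sheaf_comp X F \<beta> (\<epsilon> F) = sheaf_id X F \<and>
        sheaf_comp X (section_sheaf X (Z F)) (\<epsilon> F) \<beta> = sheaf_id X (section_sheaf X (Z F))"
      using sheaf_iso_hom by blast
    fix H \<alpha> assume H: "H \<in> Obj sheaves" and \<alpha>: "\<alpha> \<in> sheaf_hom X F H"
    show "sheaf_comp X F (section_map X (Z F) (m F H \<alpha>)) (\<epsilon> F) = sheaf_comp X F (\<epsilon> H) \<alpha>"
    proof (rule sheaf_hom_eqI)
      note mh = section_map_hom[OF m_hom[OF F H \<alpha>], of X]
      show "sheaf_comp X F (section_map X (Z F) (m F H \<alpha>)) (\<epsilon> F) \<in> sheaf_hom X F (section_sheaf X (Z H))"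
        by (rule sheaf_comp_hom[OF obj(3)[OF F] sheaf_iso_hom[OF \<epsilon>_iso[OF F]] mh])
      show "sheaf_comp X F (\<epsilon> H) \<alpha> \<in> sheaf_hom X F (section_sheaf X (Z H))"
        by (rule sheaf_comp_hom[OF obj(3)[OF F] \<alpha> sheaf_iso_hom[OF \<epsilon>_iso[OF H]]])
      fix U s assume U: "openin X U" and s: "s \<in> sect F U"
      let ?S = "\<lambda>F. section_sheaf X (etale_space X F)"
      have g: "germ_map X F U s \<in> sect (?S F) U"
        by (rule sheaf_hom_sect[OF germ_map_hom[OF obj(3)[OF F]] U s])
      note \<alpha>s = sheaf_hom_sect[OF \<alpha> U s]
      \<comment> \<open>Naturality combines two squares: \<open>m_\<theta>\<close> moves the
        morphism past \<open>\<theta>\<close>, and \<open>germ_map_natural\<close> moves it past the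
        passage to germs.\<close>
      have "sheaf_comp X F (section_map X (Z F) (m F H \<alpha>)) (\<epsilon> F) U s =
          section_map X (etale_space X F) (cover_comp (etale_space X F) (m F H \<alpha>) (\<theta> F)) U (germ_map X F U s)"
        unfolding section_map_comp[OF \<theta>h[OF F] m_hom[OF F H \<alpha>]] \<epsilon>_def
          sheaf_comp_apply[OF U s] sheaf_comp_apply[OF U g] by (rule refl)
      also have "\<dots> = section_map X (etale_space X H) (\<theta> H) U (germ_map X H U (\<alpha> U s))"
        unfolding m_\<theta>[OF F H \<alpha>] section_map_comp[OF etale[OF F H \<alpha>] \<theta>h[OF H]] sheaf_comp_apply[OF U g]
          germ_map_natural[OF obj(3)[OF F] obj(3)[OF H] \<alpha> U s] by (rule refl)
      also have "\<dots> = sheaf_comp X F (\<epsilon> H) \<alpha> U s"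
        unfolding \<epsilon>_def sheaf_comp_apply[OF U s] sheaf_comp_apply[OF U \<alpha>s] by (rule refl)
      finally show "sheaf_comp X F (section_map X (Z F) (m F H \<alpha>)) (\<epsilon> F) U s = sheaf_comp X F (\<epsilon> H) \<alpha> U s" .
    qed
  qed
  then have counit: "\<exists>\<epsilon>. is_natural_iso sheaves sheaves (comp_func (section_func X) G) id_func \<epsilon>"
    by (rule natural_iso_inverse[OF is_functor_id_func is_functor_comp_func[OF G S], rotated])
      (unfold sheaves_def, rule is_category_locally_constant_sheaf_cat)
  have "represents_etale_functor X G"
    unfolding represents_etale_functor_def sheaves_def[symmetric] sheaves
    by (intro exI[of _ \<theta>] conjI ballI) (simp_all add: G_def \<theta> m_\<theta>)
  then show ?thesis
    using S G unit counit unfolding is_equivalence_def by (intro exI[of _ G]) simp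
qed

theorem theorem1p6p6:
  fixes X :: "'a topology"
  assumes "connected_space X"
    and "locally_path_connected_space X"
    and "semilocally_simply_connected_space X"
    and "infinite (UNIV :: 'u set)"
    and "\<exists>c :: ('a \<Rightarrow> 'u) \<Rightarrow> 'u. inj c"
  shows
    "(\<exists>G. is_equivalence
            (cover_cat X :: (('a, 'u) over_space, 'u \<Rightarrow> 'u) cat)
            (locally_constant_sheaf_cat X ::
               (('a, 'a \<Rightarrow> 'u) presheaf, 'a set \<Rightarrow> ('a \<Rightarrow> 'u) \<Rightarrow> ('a \<Rightarrow> 'u)) cat)
            (section_func X) G \<and>
          represents_etale_functor X G) \<and>
     (\<forall>I :: 'u set. I \<noteq> {} \<longrightarrow>
        sheaves_isomorphic X (section_sheaf X (trivial_cover X I)) (constant_sheaf X I) \<and>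
        covers_isomorphic (etale_space X (constant_sheaf X I)) (trivial_cover X I) \<and>
        (\<forall>Y :: ('a, 'u) over_space. is_cover X Y \<longrightarrow>
           (covers_isomorphic Y (trivial_cover X I) \<longleftrightarrow>
            sheaves_isomorphic X (section_sheaf X Y) (constant_sheaf X I))) \<and>
        (\<forall>F :: ('a, 'a \<Rightarrow> 'u) presheaf. is_sheaf X F \<and> is_locally_constant X F \<longrightarrow>
           (sheaves_isomorphic X F (constant_sheaf X I) \<longleftrightarrow>
            covers_isomorphic (etale_space X F) (trivial_cover X I))))"
proof (intro conjI allI impI)
  \<comment> \<open>The size assumptions on \<open>'u\<close> enter the equivalence only here: the
    etale space of each sheaf has a copy with points in \<open>'u\<close>, and a family of copies is
    then chosen.\<close>
  have "\<exists>Z \<phi>. is_cover_iso (etale_space X F) Z (\<phi> :: _ \<Rightarrow> 'u)"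
    if F: "F \<in> Obj (locally_constant_sheaf_cat X)" for F :: "('a, 'a \<Rightarrow> 'u) presheaf"
  proof -
    have "is_presheaf X F"
      using F by (simp add: locally_constant_sheaf_cat_def is_sheaf_is_presheaf)
    from etale_space_points_inject[OF this assms(4,5)]
    obtain e :: "_ \<Rightarrow> 'u" where "inj_on e (topspace (total (etale_space X F)))" ..
    then obtain Z :: "('a, 'u) over_space" and \<phi> where "is_cover_iso (etale_space X F) Z \<phi>"
      by (rule cover_iso_transport)
    then show ?thesis by blast
  qed
  then obtain Z :: "('a, 'a \<Rightarrow> 'u) presheaf \<Rightarrow> ('a, 'u) over_space" and \<theta>
    where "\<And>F. F \<in> Obj (locally_constant_sheaf_cat X) \<Longrightarrow> is_cover_iso (etale_space X F) (Z F) (\<theta> F)"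
    by metis
  then show "\<exists>G. is_equivalence
            (cover_cat X :: (('a, 'u) over_space, 'u \<Rightarrow> 'u) cat)
            (locally_constant_sheaf_cat X ::
               (('a, 'a \<Rightarrow> 'u) presheaf, 'a set \<Rightarrow> ('a \<Rightarrow> 'u) \<Rightarrow> ('a \<Rightarrow> 'u)) cat)
            (section_func X) G \<and>
          represents_etale_functor X G"
    by (rule section_func_equivalence)
qed (simp_all add: section_sheaf_trivial_cover etale_space_constant_sheaf
    trivial_cover_iff_constant_section_sheaf constant_sheaf_iff_trivial_etale_space)
end
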